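(* Let $G$ be a finite group, let $L/K$ be a finite Galois extension of fields of characteristic $p>0$ with Galois group $\Gamma$, let $b$ be a block idempotent of $LG$, and let $(P,e)$ be a maximal $(LG,b)$-Brauer pair. Let $\tilde b$ be the block idempotent of $KG$ associated with $b$ and $\tilde e$ the block idempotent of $KC_G(P)$ associated with $e$. Set $\mathcal{F}:=\mathcal{F}_{(P,e)}(LGb)$ and $\tilde{\mathcal{F}}:=\mathcal{F}_{(P,\tilde e)}(KG\tilde b)$. Let $g_0\in N_G(P,\tilde e)$ be such that $g_0N_G(P,e)$ generates the (cyclic) group $N_G(P,\tilde e)/N_G(P,e)$, and let $\sigma\in\mathrm{Aut}(P)$ be the automorphism $u\mapsto g_0ug_0^{-1}$. Then $\tilde{\mathcal{F}}=\langle \mathcal{F},\sigma\rangle$. More precisely, $\sigma\in\mathrm{Aut}_{\tilde{\mathcal{F}}}(P)$ and, for any subgroups $Q$ and $R$ of $P$ and any $\varphi\in\mathrm{Hom}_{\tilde{\mathcal{F}}}(Q,R)$, there exist $i\in\mathbb{Z}$, $\psi\in\mathrm{Hom}_{\mathcal{F}}(Q,\sigma^{-i}(R))$ and $\psi'\in\mathrm{Hom}_{\mathcal{F}}(\sigma^i(Q),R)$ with $\varphi=\sigma^i|_{\sigma^{-i}(R)}\circ\psi=\psi'\circ\sigma^i|_Q$, where $\sigma^i|_{\sigma^{-i}(R)}\colon\sigma^{-i}(R)\to R$ and $\sigma^i|_Q\colon Q\to\sigma^i(Q)$ denote the restrictions of $\sigma^i$.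
   Context: Brauer pairs. Let $k$ be a field of characteristic $p>0$ and $G$ a finite group. A block idempotent of $kG$ is a primitive idempotent of $Z(kG)$. $G$ acts on $kG$ by conjugation, ${}^{x}a=xax^{-1}$, and $(kG)^P$ denotes the fixed points of a subgroup $P$. For a $p$-subgroup $P\le G$, the Brauer homomorphism $\mathrm{Br}_P\colon(kG)^P\to kC_G(P)$, $\sum_{g\in G}\alpha_g g\mapsto\sum_{g\in C_G(P)}\alpha_g g$, is a surjective $k$-algebra homomorphism. A $kG$-Brauer pair is a pair $(P,e)$ with $P$ a $p$-subgroup of $G$ and $e$ a block idempotent of $kC_G(P)$; for a block idempotent $b$ of $kG$ it is a $(kG,b)$-Brauer pair if $\mathrm{Br}_P(b)e=e$. An idempotent $i\in(kG)^P$ is associated to $(P,e)$ if $e\,\mathrm{Br}_P(i)=\mathrm{Br}_P(i)\ne0$. One writes $(Q,f)\le(P,e)$ if $Q\le P$ and every primitive idempotent $i$ of $(kG)^P$ associated to $(P,e)$ is also associated to $(Q,f)$; this is a partial order, respected by the conjugation action ${}^{x}(P,e)=({}^{x}P,{}^{x}e)$ of $G$. A maximal $(kG,b)$-Brauer pair is one that is maximal for $\le$ among $(kG,b)$-Brauer pairs. For every Brauer pair $(P,e)$ and $Q\le P$ there is a unique block idempotent $e_Q$ of $kC_G(Q)$ with $(Q,e_Q)\le(P,e)$. $N_G(P,e)$ denotes the stabilizer of $(P,e)$ in $G$. Fusion systems. For a finite $p$-group $P$, a fusion system $\mathcal{F}$ over $P$ is a subcategory of the category of finite groups whose objects are the subgroups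 of $P$, such that for all $Q,R\le P$: (i) $\mathrm{Hom}_{\mathcal{F}}(Q,R)$ contains all homomorphisms $Q\to R$ induced by conjugation with elements of $P$, and all its elements are injective; (ii) for $\varphi\in\mathrm{Hom}_{\mathcal{F}}(Q,R)$, the isomorphism $Q\to\varphi(Q)$, $u\mapsto\varphi(u)$, and its inverse are morphisms in $\mathcal{F}$. $\mathrm{Aut}_{\mathcal{F}}(Q):=\mathrm{Hom}_{\mathcal{F}}(Q,Q)$. $\langle\mathcal{F},\sigma\rangle$ denotes the intersection of all fusion systems over $P$ that contain $\mathcal{F}$ and $\sigma$. For a block idempotent $b$ of $kG$ and a maximal $(kG,b)$-Brauer pair $(P,e)$, $\mathcal{F}_{(P,e)}(kGb)$ is the fusion system over $P$ in which $\mathrm{Hom}(Q,R)$ is the set of homomorphisms $\varphi\colon Q\to R$ for which there is $x\in G$ with $\varphi(u)=xux^{-1}$ for all $u\in Q$ and ${}^{x}(Q,e_Q)\le(R,e_R)$. Galois action. $\Gamma=\mathrm{Gal}(L/K)$ acts on $LG$ (and on $LC_G(P)$) by applying $\gamma\in\Gamma$ to coefficients. For a block idempotent $b$ of $LG$, $\tilde b$ is the sum of the distinct $\Gamma$-conjugates of $b$; it is the unique block idempotent of $KG$ with $b\tilde b=b$. Similarly for a block idempotent $e$ of $LC_G(P)$, $\tilde e$ is the sum of the distinct $\Gamma$-conjugates of $e$, a block idempotent of $KC_G(P)$. If $(P,e)$ is a maximal $(LG,b)$-Brauer pair then $(P,\tilde e)$ is a maximal $(KG,\tilde b)$-Brauer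 pair, and $N_G(P,e)$ is normal in $N_G(P,\tilde e)$ with cyclic quotient. *)

theory Defs
  imports "HOL-Algebra.Embedded_Algebras" "HOL-Algebra.QuotRing"
    "HOL-Algebra.Generated_Groups" "HOL-Algebra.Multiplicative_Group" "HOL-Algebra.Bij"
begin

section \<open>Fields\<close>

text \<open>The additive order of \<open>\<one>\<close>; it is 0 when this order is infinite.\<close>

definition ring_char :: "('l, 'm) ring_scheme \<Rightarrow> nat"
  where "ring_char k = group.ord (add_monoid k) \<one>\<^bsub>k\<^esub>"

definition galois_group :: "('l, 'm) ring_scheme \<Rightarrow> 'l set \<Rightarrow> ('l \<Rightarrow> 'l) set"
  where "galois_group L K = {\<gamma> \<in> ring_iso L L \<inter> extensional (carrier L). \<forall>x\<in>K. \<gamma> x = x}"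

definition finite_galois_extension :: "('l, 'm) ring_scheme \<Rightarrow> 'l set \<Rightarrow> bool"
  where "finite_galois_extension L K \<longleftrightarrow>
    field L \<and> subfield K L \<and> ring.finite_dimension L K (carrier L) \<and>
    {x \<in> carrier L. \<forall>\<gamma>\<in>galois_group L K. \<gamma> x = x} = K"


section \<open>Group algebras\<close>

text \<open>
  Elements of \<open>kG\<close> are coefficient functions that vanish off the carrier of \<open>G\<close>. So, for a
  subgroup \<open>H\<close> of \<open>G\<close> and a subfield \<open>K\<close> of \<open>L\<close>, the algebras of \<open>H\<close> and over \<open>K\<close> are
  literally subsets of those of \<open>G\<close> and over \<open>L\<close>. Subgroups and subfields are the records
  \<open>G\<lparr>carrier := H\<rparr>\<close> and \<open>L\<lparr>carrier := K\<rparr>\<close>.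
\<close>

definition group_algebra ::
    "('l, 'm) ring_scheme \<Rightarrow> ('g, 'n) monoid_scheme \<Rightarrow> ('g \<Rightarrow> 'l) ring"
  where "group_algebra k G =
    \<lparr>carrier = {a. (\<forall>g\<in>carrier G. a g \<in> carrier k) \<and> (\<forall>g. g \<notin> carrier G \<longrightarrow> a g = \<zero>\<^bsub>k\<^esub>)},
     mult = (\<lambda>a b g. if g \<in> carrier G
       then (\<Oplus>\<^bsub>k\<^esub>h\<in>carrier G. a h \<otimes>\<^bsub>k\<^esub> b (inv\<^bsub>G\<^esub> h \<otimes>\<^bsub>G\<^esub> g)) else \<zero>\<^bsub>k\<^esub>),
     one = (\<lambda>g. if g = \<one>\<^bsub>G\<^esub> then \<one>\<^bsub>k\<^esub> else \<zero>\<^bsub>k\<^esub>),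
     zero = (\<lambda>g. \<zero>\<^bsub>k\<^esub>),
     add = (\<lambda>a b g. a g \<oplus>\<^bsub>k\<^esub> b g)\<rparr>"

definition group_elem :: "('l, 'm) ring_scheme \<Rightarrow> 'g \<Rightarrow> ('g \<Rightarrow> 'l)"
  where "group_elem k x = (\<lambda>g. if g = x then \<one>\<^bsub>k\<^esub> else \<zero>\<^bsub>k\<^esub>)"

definition conj_elem ::
    "('l, 'm) ring_scheme \<Rightarrow> ('g, 'n) monoid_scheme \<Rightarrow> 'g \<Rightarrow> ('g \<Rightarrow> 'l) \<Rightarrow> ('g \<Rightarrow> 'l)"
  where "conj_elem k G x a =
    group_elem k x \<otimes>\<^bsub>group_algebra k G\<^esub> a \<otimes>\<^bsub>group_algebra k G\<^esub> group_elem k (inv\<^bsub>G\<^esub> x)"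

definition fixed_algebra ::
    "('l, 'm) ring_scheme \<Rightarrow> ('g, 'n) monoid_scheme \<Rightarrow> 'g set \<Rightarrow> ('g \<Rightarrow> 'l) ring"
  where "fixed_algebra k G P = (group_algebra k G)
    \<lparr>carrier := {a \<in> carrier (group_algebra k G). \<forall>x\<in>P. conj_elem k G x a = a}\<rparr>"

definition ring_center :: "('a, 'm) ring_scheme \<Rightarrow> ('a, 'm) ring_scheme"
  where "ring_center A =
    A\<lparr>carrier := {z \<in> carrier A. \<forall>a\<in>carrier A. z \<otimes>\<^bsub>A\<^esub> a = a \<otimes>\<^bsub>A\<^esub> z}\<rparr>"

definition idempotent_elem :: "('a, 'm) ring_scheme \<Rightarrow> 'a \<Rightarrow> bool"
  where "idempotent_elem A i \<longleftrightarrow> i \<in> carrier A \<and> i \<otimes>\<^bsub>A\<^esub> i = i"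

definition primitive_idempotent :: "('a, 'm) ring_scheme \<Rightarrow> 'a \<Rightarrow> bool"
  where "primitive_idempotent A i \<longleftrightarrow>
    idempotent_elem A i \<and> i \<noteq> \<zero>\<^bsub>A\<^esub> \<and>
    (\<nexists>j j'. idempotent_elem A j \<and> idempotent_elem A j' \<and> j \<noteq> \<zero>\<^bsub>A\<^esub> \<and> j' \<noteq> \<zero>\<^bsub>A\<^esub> \<and>
      j \<otimes>\<^bsub>A\<^esub> j' = \<zero>\<^bsub>A\<^esub> \<and> j' \<otimes>\<^bsub>A\<^esub> j = \<zero>\<^bsub>A\<^esub> \<and> i = j \<oplus>\<^bsub>A\<^esub> j')"

definition block_idempotent ::
    "('l, 'm) ring_scheme \<Rightarrow> ('g, 'n) monoid_scheme \<Rightarrow> ('g \<Rightarrow> 'l) \<Rightarrow> bool"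
  where "block_idempotent k G b \<longleftrightarrow> primitive_idempotent (ring_center (group_algebra k G)) b"

text \<open>
  The sum of the distinct Galois conjugates of \<open>b\<close>, formed in \<open>LG\<close>. Since \<open>\<gamma> \<zero> = \<zero>\<close>,
  applying \<open>\<gamma>\<close> to the coefficients of \<open>b\<close> is composition with \<open>\<gamma>\<close>.
\<close>

definition galois_conjugate_sum ::
    "('l, 'm) ring_scheme \<Rightarrow> 'l set \<Rightarrow> ('g, 'n) monoid_scheme \<Rightarrow> ('g \<Rightarrow> 'l) \<Rightarrow> ('g \<Rightarrow> 'l)"
  where "galois_conjugate_sum L K G b =
    (\<Oplus>\<^bsub>group_algebra L G\<^esub>c \<in> (\<lambda>\<gamma>. \<gamma> \<circ> b) ` galois_group L K. c)"


section \<open>Brauer pairs\<close>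

definition centralizer :: "('g, 'n) monoid_scheme \<Rightarrow> 'g set \<Rightarrow> 'g set"
  where "centralizer G P = {g \<in> carrier G. \<forall>u\<in>P. g \<otimes>\<^bsub>G\<^esub> u = u \<otimes>\<^bsub>G\<^esub> g}"

definition centralizer_algebra ::
    "('l, 'm) ring_scheme \<Rightarrow> ('g, 'n) monoid_scheme \<Rightarrow> 'g set \<Rightarrow> ('g \<Rightarrow> 'l) ring"
  where "centralizer_algebra k G P = group_algebra k (G\<lparr>carrier := centralizer G P\<rparr>)"

definition brauer_hom ::
    "('l, 'm) ring_scheme \<Rightarrow> ('g, 'n) monoid_scheme \<Rightarrow> 'g set \<Rightarrow> ('g \<Rightarrow> 'l) \<Rightarrow> ('g \<Rightarrow> 'l)"
  where "brauer_hom k G P a = (\<lambda>g. if g \<in> centralizer G P then a g else \<zero>\<^bsub>k\<^esub>)"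

text \<open>The prime for which the first component is a \<open>p\<close>-subgroup is the characteristic of \<open>k\<close>.\<close>

fun brauer_pair ::
    "('l, 'm) ring_scheme \<Rightarrow> ('g, 'n) monoid_scheme \<Rightarrow> 'g set \<times> ('g \<Rightarrow> 'l) \<Rightarrow> bool"
  where "brauer_pair k G (P, e) \<longleftrightarrow>
    subgroup P G \<and> (\<exists>n. card P = ring_char k ^ n) \<and>
    block_idempotent k (G\<lparr>carrier := centralizer G P\<rparr>) e"

fun block_brauer_pair ::
    "('l, 'm) ring_scheme \<Rightarrow> ('g, 'n) monoid_scheme \<Rightarrow> ('g \<Rightarrow> 'l) \<Rightarrow> 'g set \<times> ('g \<Rightarrow> 'l) \<Rightarrow> bool"
  where "block_brauer_pair k G b (P, e) \<longleftrightarrow>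
    brauer_pair k G (P, e) \<and> brauer_hom k G P b \<otimes>\<^bsub>centralizer_algebra k G P\<^esub> e = e"

fun associated ::
    "('l, 'm) ring_scheme \<Rightarrow> ('g, 'n) monoid_scheme \<Rightarrow> ('g \<Rightarrow> 'l) \<Rightarrow> 'g set \<times> ('g \<Rightarrow> 'l) \<Rightarrow> bool"
  where "associated k G i (P, e) \<longleftrightarrow>
    idempotent_elem (fixed_algebra k G P) i \<and>
    e \<otimes>\<^bsub>centralizer_algebra k G P\<^esub> brauer_hom k G P i = brauer_hom k G P i \<and>
    brauer_hom k G P i \<noteq> \<zero>\<^bsub>centralizer_algebra k G P\<^esub>"

fun brauer_le ::
    "('l, 'm) ring_scheme \<Rightarrow> ('g, 'n) monoid_scheme \<Rightarrow>
      'g set \<times> ('g \<Rightarrow> 'l) \<Rightarrow> 'g set \<times> ('g \<Rightarrow> 'l) \<Rightarrow> bool"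
  where "brauer_le k G (Q, f) (P, e) \<longleftrightarrow>
    brauer_pair k G (Q, f) \<and> brauer_pair k G (P, e) \<and> Q \<subseteq> P \<and>
    (\<forall>i. primitive_idempotent (fixed_algebra k G P) i \<and> associated k G i (P, e)
      \<longrightarrow> associated k G i (Q, f))"

definition maximal_brauer_pair ::
    "('l, 'm) ring_scheme \<Rightarrow> ('g, 'n) monoid_scheme \<Rightarrow> ('g \<Rightarrow> 'l) \<Rightarrow> 'g set \<times> ('g \<Rightarrow> 'l) \<Rightarrow> bool"
  where "maximal_brauer_pair k G b X \<longleftrightarrow>
    block_brauer_pair k G b X \<and>
    (\<forall>Y. block_brauer_pair k G b Y \<and> brauer_le k G X Y \<longrightarrow> Y = X)"

fun conj_pair ::
    "('l, 'm) ring_scheme \<Rightarrow> ('g, 'n) monoid_scheme \<Rightarrow> 'g \<Rightarrow>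
      'g set \<times> ('g \<Rightarrow> 'l) \<Rightarrow> 'g set \<times> ('g \<Rightarrow> 'l)"
  where "conj_pair k G x (P, e) = ((x <#\<^bsub>G\<^esub> P) #>\<^bsub>G\<^esub> inv\<^bsub>G\<^esub> x, conj_elem k G x e)"

definition pair_stabilizer ::
    "('l, 'm) ring_scheme \<Rightarrow> ('g, 'n) monoid_scheme \<Rightarrow> 'g set \<times> ('g \<Rightarrow> 'l) \<Rightarrow> 'g set"
  where "pair_stabilizer k G X = {x \<in> carrier G. conj_pair k G x X = X}"

text \<open>The pair \<open>(Q, e\<^sub>Q)\<close>, where \<open>X = (P, e)\<close> and \<open>Q\<close> is a subgroup of \<open>P\<close>.\<close>

definition subpair ::
    "('l, 'm) ring_scheme \<Rightarrow> ('g, 'n) monoid_scheme \<Rightarrow> 'g set \<times> ('g \<Rightarrow> 'l) \<Rightarrow> 'g set \<Rightarrow>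
      'g set \<times> ('g \<Rightarrow> 'l)"
  where "subpair k G X Q =
    (Q, THE f. block_idempotent k (G\<lparr>carrier := centralizer G Q\<rparr>) f \<and> brauer_le k G (Q, f) X)"


section \<open>Fusion systems\<close>

text \<open>
  A system of morphisms over \<open>P\<close> is given by its sets \<open>F Q R\<close> of morphisms from \<open>Q\<close> to \<open>R\<close>.
  Morphisms are extensional on their domain, and \<open>F Q R\<close> is empty unless \<open>Q\<close> and \<open>R\<close> are
  subgroups of \<open>P\<close>, so that equality of categories is equality of functions; inclusion is the
  pointwise order.
\<close>

type_synonym 'g hom_system = "'g set \<Rightarrow> 'g set \<Rightarrow> ('g \<Rightarrow> 'g) set"

definition group_homs :: "('g, 'n) monoid_scheme \<Rightarrow> 'g hom_system"
  where "group_homs P Q R = hom (P\<lparr>carrier := Q\<rparr>) (P\<lparr>carrier := R\<rparr>) \<inter> extensional Q"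

definition conj_map :: "('g, 'n) monoid_scheme \<Rightarrow> 'g \<Rightarrow> 'g set \<Rightarrow> 'g \<Rightarrow> 'g"
  where "conj_map G x Q = (\<lambda>u\<in>Q. x \<otimes>\<^bsub>G\<^esub> u \<otimes>\<^bsub>G\<^esub> inv\<^bsub>G\<^esub> x)"

definition fusion_system :: "('g, 'n) monoid_scheme \<Rightarrow> 'g hom_system \<Rightarrow> bool"
  where "fusion_system P F \<longleftrightarrow>
    (\<forall>Q R. \<not> (subgroup Q P \<and> subgroup R P) \<longrightarrow> F Q R = {}) \<and>
    (\<forall>Q R. F Q R \<subseteq> {\<phi> \<in> group_homs P Q R. inj_on \<phi> Q}) \<and>
    (\<forall>Q R S. \<forall>\<phi>\<in>F Q R. \<forall>\<psi>\<in>F R S. compose Q \<psi> \<phi> \<in> F Q S) \<and>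
    (\<forall>Q R. subgroup Q P \<and> subgroup R P \<longrightarrow>
      (\<forall>x\<in>carrier P. conj_map P x Q ` Q \<subseteq> R \<longrightarrow> conj_map P x Q \<in> F Q R)) \<and>
    (\<forall>Q R. \<forall>\<phi>\<in>F Q R.
      \<phi> \<in> F Q (\<phi> ` Q) \<and> restrict (inv_into Q \<phi>) (\<phi> ` Q) \<in> F (\<phi> ` Q) Q)"

definition generated_fusion_system ::
    "('g, 'n) monoid_scheme \<Rightarrow> 'g hom_system \<Rightarrow> ('g \<Rightarrow> 'g) \<Rightarrow> 'g hom_system"
  where "generated_fusion_system P F \<sigma> =
    Inf {E. fusion_system P E \<and> F \<le> E \<and> \<sigma> \<in> E (carrier P) (carrier P)}"

text \<open>
  The fusion system of the block \<open>b\<close> with respect to the maximal Brauer pair \<open>(P, e)\<close>. The block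
  only determines which pairs are allowed; the morphisms depend on the pair alone.
\<close>

fun block_fusion_system ::
    "('l, 'm) ring_scheme \<Rightarrow> ('g, 'n) monoid_scheme \<Rightarrow> ('g \<Rightarrow> 'l) \<Rightarrow> 'g set \<times> ('g \<Rightarrow> 'l) \<Rightarrow>
      'g hom_system"
  where "block_fusion_system k G b (P, e) Q R =
    {\<phi> \<in> group_homs G Q R.
      subgroup Q (G\<lparr>carrier := P\<rparr>) \<and> subgroup R (G\<lparr>carrier := P\<rparr>) \<and>
      (\<exists>x\<in>carrier G. (\<forall>u\<in>Q. \<phi> u = x \<otimes>\<^bsub>G\<^esub> u \<otimes>\<^bsub>G\<^esub> inv\<^bsub>G\<^esub> x) \<and>
        brauer_le k G (conj_pair k G x (subpair k G (P, e) Q)) (subpair k G (P, e) R))}"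

end

theory Submission
  imports Defs "HOL-Algebra.Sylow"
begin

text \<open>
  A group element \<open>x\<close> induces a morphism of the fusion system of \<open>(P, e)\<close> on \<open>Q\<close> exactly if it moves the
  subpair of \<open>(P, e)\<close> at \<open>Q\<close> to another subpair of \<open>(P, e)\<close> (\<open>mem_block_fusion_system\<close>). The field \<open>L\<close> is
  called \<open>k\<close> in the lemmas.

  Let \<open>x\<close> do so over \<open>K\<close>, for the pair formed with the Galois sum of \<open>e\<close>. The subpairs over \<open>K\<close> are the Galois
  sums of the subpairs over \<open>L\<close> (\<open>brauer_le_gsum\<close>), so over \<open>L\<close> the element \<open>x\<close> moves the subpair at \<open>Q\<close> to
  a conjugate by some \<open>\<gamma>\<close> of a subpair of \<open>(P, e)\<close>, that is, to a subpair of \<open>(P, \<gamma> e)\<close>. The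
  pair \<open>(P, \<gamma> e)\<close> contains a \<open>G\<close>-conjugate of a \<open>b\<close>-subpair, so it belongs to \<open>b\<close> too. Pairs of \<open>b\<close> with the
  same group as a maximal one are \<open>G\<close>-conjugate to it (\<open>maximal_pairs_conjugate\<close>): \<open>(P, \<gamma> e)\<close> is the conjugate
  of \<open>(P, e)\<close> by some \<open>h\<close>, which necessarily stabilizes the Galois sum of \<open>e\<close>. Then \<open>h\<inverse> x\<close> induces a
  morphism over \<open>L\<close> (\<open>fuses_gsum_split\<close>). As the stabilizer of the Galois sum is generated by \<open>g\<^sub>0\<close> modulo the
  stabilizer of \<open>e\<close>, one may take \<open>h\<close> to be a power of \<open>g\<^sub>0\<close>. This is the factorization of the morphisms, and it
  places them in every fusion system that contains \<open>F\<close> and \<open>\<sigma>\<close>. Conversely the system over \<open>K\<close> is a fusion system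
  (\<open>fusion_system_block\<close>) containing both.

  Three facts about Brauer pairs over an arbitrary field of characteristic \<open>p\<close> support this. They rest on
  two tools. First, for a primitive idempotent \<open>i\<close> of a finite-dimensional algebra \<open>B\<close>, the algebra
  \<open>i B i\<close> is local in the form needed here: an element is invertible if its image under a multiplicative map
  is a nonzero idempotent (\<open>primitive_corner_local\<close>). Secondly, an element of \<open>kC\<^sub>G(Q)\<close> fixed by the normalizer
  of \<open>Q\<close> in \<open>H\<close> and killed by the Brauer maps of all larger \<open>p\<close>-subgroups of the normalizer is the image
  of an element of \<open>(kG)\<^sup>H\<close>, supported on the conjugates of its support (\<open>extend_from_centralizer\<close>). This
  replaces relative traces and is a statement about Sylow subgroups of centralizers.

  \<^item> Subpairs exist and are unique (\<open>subpair_exists\<close>, \<open>brauer_le_unique\<close>). By downward induction on \<open>Q\<close>, with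
    \<open>R\<close> the normalizer of \<open>Q\<close> in \<open>P\<close>: some \<open>R\<close>-stable block \<open>f\<close> of \<open>kC\<^sub>G(Q)\<close> satisfies \<open>Br\<^sub>R(f) e\<^sub>R = e\<^sub>R\<close>. For a
    primitive idempotent \<open>i\<close> associated to \<open>(P, e)\<close>, the part of \<open>Br\<^sub>Q(i)\<close> outside \<open>f\<close> extends to \<open>y \<in> (kG)\<^sup>P\<close> with
    \<open>Br\<^sub>P(y) = 0\<close>, so \<open>i y i\<close> is not invertible and its idempotent image is zero.

  \<^item> The order is transitive and invariant under conjugation and field automorphisms (\<open>brauer_le_trans\<close>,
    \<open>brauer_le_twist\<close>).

  \<^item> A maximal pair \<open>(P, e)\<close> of \<open>b\<close> is determined by \<open>P\<close> up to conjugacy. By maximality the sum \<open>s\<close> of the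
    conjugates of \<open>e\<close> under the normalizer of \<open>P\<close> extends to a central \<open>y\<close>; the image \<open>s\<close> of \<open>b y\<close> is a nonzero
    idempotent, so \<open>b y\<close> is invertible in \<open>Z(kG) b\<close>, and no block outside the sum can lie under \<open>Br\<^sub>P(b)\<close>.
\<close>


section \<open>Conjugation and p-groups acting on finite sets\<close>

definition (in monoid) cj :: "'a \<Rightarrow> 'a \<Rightarrow> 'a"
  where "cj x u = x \<otimes> u \<otimes> inv x"

definition (in monoid) normalizer :: "'a set \<Rightarrow> 'a set \<Rightarrow> 'a set"
  where "normalizer H Q = {t \<in> H. cj t ` Q = Q}"

definition (in monoid) p_subgroup :: "nat \<Rightarrow> 'a set \<Rightarrow> bool"
  where "p_subgroup p Q \<longleftrightarrow> subgroup Q G \<and> (\<exists>n. card Q = p ^ n)"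

definition (in monoid) acts :: "'a set \<Rightarrow> ('a \<Rightarrow> 'x \<Rightarrow> 'x) \<Rightarrow> 'x set \<Rightarrow> bool"
  where "acts H f X \<longleftrightarrow> (\<forall>h\<in>H. \<forall>x\<in>X. f h x \<in> X) \<and> (\<forall>x\<in>X. f \<one> x = x) \<and>
    (\<forall>h\<in>H. \<forall>h'\<in>H. \<forall>x\<in>X. f (h \<otimes> h') x = f h (f h' x))"

context group
begin

lemma cj_closed [simp]: "x \<in> carrier G \<Longrightarrow> u \<in> carrier G \<Longrightarrow> cj x u \<in> carrier G"
  by (simp add: cj_def)

lemma cj_one [simp]: "u \<in> carrier G \<Longrightarrow> cj \<one> u = u"
  by (simp add: cj_def)

lemma cj_mult: "x \<in> carrier G \<Longrightarrow> y \<in> carrier G \<Longrightarrow> u \<in> carrier G \<Longrightarrow> cj (x \<otimes> y) u = cj x (cj y u)"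
  by (simp add: cj_def inv_mult_group m_assoc)

lemma cj_hom: "x \<in> carrier G \<Longrightarrow> u \<in> carrier G \<Longrightarrow> v \<in> carrier G \<Longrightarrow> cj x (u \<otimes> v) = cj x u \<otimes> cj x v"
  by (simp add: cj_def m_assoc inv_solve_left)

lemma cj_of_one [simp]: "x \<in> carrier G \<Longrightarrow> cj x \<one> = \<one>"
  by (simp add: cj_def)

lemma cj_inv: "x \<in> carrier G \<Longrightarrow> u \<in> carrier G \<Longrightarrow> cj x (inv u) = inv (cj x u)"
  by (simp add: cj_def inv_mult_group m_assoc)

lemma cj_cancel [simp]:
  assumes "x \<in> carrier G" "u \<in> carrier G"
  shows "cj x (cj (inv x) u) = u" "cj (inv x) (cj x u) = u"
  using assms by (simp_all flip: cj_mult)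

lemma inj_on_cj: "x \<in> carrier G \<Longrightarrow> Q \<subseteq> carrier G \<Longrightarrow> inj_on (cj x) Q"
  by (rule inj_on_inverseI[where g = "cj (inv x)"]) auto

lemma cj_one_image [simp]: "Q \<subseteq> carrier G \<Longrightarrow> cj \<one> ` Q = Q"
  by (simp add: subset_iff cong: image_cong)

lemma cj_image_mult:
  "x \<in> carrier G \<Longrightarrow> y \<in> carrier G \<Longrightarrow> Q \<subseteq> carrier G \<Longrightarrow> cj (x \<otimes> y) ` Q = cj x ` cj y ` Q"
  unfolding image_image by (intro image_cong) (auto simp: cj_mult)

lemma cj_image_cancel [simp]:
  assumes "x \<in> carrier G" "Q \<subseteq> carrier G"
  shows "cj x ` cj (inv x) ` Q = Q" "cj (inv x) ` cj x ` Q = Q"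
  using assms by (simp_all flip: cj_image_mult)

lemma card_cj_image [simp]: "x \<in> carrier G \<Longrightarrow> Q \<subseteq> carrier G \<Longrightarrow> card (cj x ` Q) = card Q"
  by (simp add: card_image inj_on_cj)

lemma subgroup_cj_image:
  assumes "x \<in> carrier G" "subgroup Q G"
  shows "subgroup (cj x ` Q) G"
proof (rule subgroupI)
  have Q: "Q \<subseteq> carrier G" using assms(2) by (rule subgroup.subset)
  show "cj x ` Q \<subseteq> carrier G" using Q assms by auto
  show "cj x ` Q \<noteq> {}" using subgroup.one_closed[OF assms(2)] by auto
  show "inv a \<in> cj x ` Q" if "a \<in> cj x ` Q" for a
    using that Q assms by (auto simp: subset_iff subgroup.m_inv_closed simp flip: cj_inv)
  show "a \<otimes> b \<in> cj x ` Q" if "a \<in> cj x ` Q" "b \<in> cj x ` Q" for a b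
    using that Q assms subgroup.m_closed[OF assms(2)] by (auto simp: subset_iff simp flip: cj_hom)
qed

lemma cj_in_subgroup: "subgroup H G \<Longrightarrow> x \<in> H \<Longrightarrow> u \<in> H \<Longrightarrow> cj x u \<in> H"
  by (simp add: cj_def subgroup.m_closed subgroup.m_inv_closed)

lemma cj_image_self:
  assumes "subgroup H G" "x \<in> H"
  shows "cj x ` H = H"
proof
  show "cj x ` H \<subseteq> H" using assms cj_in_subgroup by auto
  show "H \<subseteq> cj x ` H"
  proof
    fix u assume u: "u \<in> H"
    have "cj x (cj (inv x) u) = u" using assms u by (meson cj_cancel(1) subgroup.mem_carrier)
    moreover have "cj (inv x) u \<in> H" using assms u by (simp add: cj_in_subgroup subgroup.m_inv_closed)
    ultimately show "u \<in> cj x ` H" by (metis imageI)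
  qed
qed

lemma conj_set_eq: "x \<in> carrier G \<Longrightarrow> (x <# Q) #> inv x = cj x ` Q"
  by (auto simp: cj_def l_coset_def r_coset_def)

lemma p_subgroup_cj: "p_subgroup p Q \<Longrightarrow> x \<in> carrier G \<Longrightarrow> p_subgroup p (cj x ` Q)"
  by (auto simp: p_subgroup_def subgroup_cj_image subgroup.subset)

lemma normalizer_subgroup:
  assumes "subgroup H G" "Q \<subseteq> carrier G"
  shows "subgroup (normalizer H Q) G"
proof (rule subgroupI)
  have H: "H \<subseteq> carrier G" using assms by (simp add: subgroup.subset)
  show "normalizer H Q \<subseteq> carrier G" using H by (auto simp: normalizer_def)
  have "\<one> \<in> normalizer H Q" using assms by (simp add: normalizer_def subgroup.one_closed)
  then show "normalizer H Q \<noteq> {}" by auto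
  show "inv a \<in> normalizer H Q" if "a \<in> normalizer H Q" for a
    using that H assms cj_image_cancel(2)[of a Q]
    by (auto simp: normalizer_def subgroup.m_inv_closed subset_iff)
  show "a \<otimes> b \<in> normalizer H Q" if "a \<in> normalizer H Q" "b \<in> normalizer H Q" for a b
    using that H assms by (auto simp: normalizer_def subgroup.m_closed cj_image_mult subset_iff)
qed

lemma centralizer_subgroup:
  assumes "P \<subseteq> carrier G"
  shows "subgroup (centralizer G P) G"
proof (rule subgroupI)
  show "centralizer G P \<subseteq> carrier G" by (auto simp: centralizer_def)
  have "\<one> \<in> centralizer G P" using assms by (auto simp: centralizer_def)
  then show "centralizer G P \<noteq> {}" by auto
  show "inv a \<in> centralizer G P" if a: "a \<in> centralizer G P" for a
  proof -
    have "inv a \<otimes> u = u \<otimes> inv a" if u: "u \<in> P" for u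
    proof -
      have c: "a \<in> carrier G" "u \<in> carrier G" "a \<otimes> u = u \<otimes> a"
        using a u assms by (auto simp: centralizer_def)
      have "u \<otimes> inv a = inv a \<otimes> (a \<otimes> u) \<otimes> inv a" using c(1,2) by (simp flip: m_assoc)
      also have "\<dots> = inv a \<otimes> (u \<otimes> a) \<otimes> inv a" using c by simp
      also have "\<dots> = inv a \<otimes> u" using c(1,2) by (simp add: m_assoc)
      finally show ?thesis by simp
    qed
    then show ?thesis using a by (auto simp: centralizer_def)
  qed
  show "a \<otimes> b \<in> centralizer G P" if ab: "a \<in> centralizer G P" "b \<in> centralizer G P" for a b
  proof -
    have "a \<otimes> b \<otimes> u = u \<otimes> (a \<otimes> b)" if u: "u \<in> P" for u
    proof -
      have c: "a \<in> carrier G" "b \<in> carrier G" "u \<in> carrier G" "a \<otimes> u = u \<otimes> a" "b \<otimes> u = u \<otimes> b"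
        using ab u assms by (auto simp: centralizer_def)
      have "a \<otimes> b \<otimes> u = a \<otimes> u \<otimes> b" using c(1-3) by (simp add: m_assoc c(5))
      also have "\<dots> = u \<otimes> (a \<otimes> b)" using c(1-3) by (simp add: m_assoc c(4))
      finally show ?thesis .
    qed
    then show ?thesis using ab by (auto simp: centralizer_def)
  qed
qed

lemma in_centralizer_iff_cj:
  assumes "P \<subseteq> carrier G" "g \<in> carrier G"
  shows "g \<in> centralizer G P \<longleftrightarrow> (\<forall>u\<in>P. cj u g = g)" "g \<in> centralizer G P \<longleftrightarrow> (\<forall>u\<in>P. cj g u = u)"
  using assms by (auto simp: centralizer_def cj_def subset_iff) (metis inv_solve_right m_closed)+

lemma cj_centralizer_iff:
  assumes "x \<in> carrier G" "P \<subseteq> carrier G" "g \<in> carrier G"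
  shows "cj x g \<in> centralizer G (cj x ` P) \<longleftrightarrow> g \<in> centralizer G P"
proof -
  have "cj (cj x g) (cj x u) = cj x u \<longleftrightarrow> cj g u = u" if "u \<in> P" for u
  proof -
    have u: "u \<in> carrier G" using that assms by auto
    have "cj (cj x g) (cj x u) = cj x (cj g u)"
      using assms u by (simp add: cj_def inv_mult_group m_assoc) (simp add: flip: m_assoc)
    then show ?thesis using inj_on_cj[of x "carrier G"] assms u by (auto simp: inj_on_def)
  qed
  then show ?thesis
    using assms by (subst (1 2) in_centralizer_iff_cj(2)) auto
qed

lemma centralizer_cj_image:
  assumes "x \<in> carrier G" "P \<subseteq> carrier G"
  shows "centralizer G (cj x ` P) = cj x ` centralizer G P"
proof
  show "cj x ` centralizer G P \<subseteq> centralizer G (cj x ` P)"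
    using assms cj_centralizer_iff by (metis (no_types, lifting) centralizer_subgroup image_subsetI subgroup.mem_carrier)
  show "centralizer G (cj x ` P) \<subseteq> cj x ` centralizer G P"
  proof
    fix g assume g: "g \<in> centralizer G (cj x ` P)"
    then have gG: "g \<in> carrier G" by (simp add: centralizer_def)
    have "cj (inv x) g \<in> centralizer G P"
      using cj_centralizer_iff[of x P "cj (inv x) g"] assms g gG by simp
    then show "g \<in> cj x ` centralizer G P" using assms gG by (metis cj_cancel(1) imageI)
  qed
qed

lemma centralizer_mono: "Q \<subseteq> P \<Longrightarrow> centralizer G P \<subseteq> centralizer G Q"
  by (auto simp: centralizer_def)

lemma centralizer_sym: "P \<subseteq> carrier G \<Longrightarrow> Q \<subseteq> carrier G \<Longrightarrow> P \<subseteq> centralizer G Q \<longleftrightarrow> Q \<subseteq> centralizer G P"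
  by (auto simp: centralizer_def subset_iff)

text \<open>
  The fibres of \<open>h \<mapsto> f h x\<close> are cosets of the stabilizer of \<open>x\<close>, so they all have the same size.
\<close>

lemma orbit_card_dvd:
  assumes H: "subgroup H G" "finite H" and act: "acts H f X" and x: "x \<in> X"
  shows "card ((\<lambda>h. f h x) ` H) dvd card H"
proof -
  define S where "S = {h \<in> H. f h x = x}"
  have HG: "H \<subseteq> carrier G" using H by (simp add: subgroup.subset)
  have fib: "card {h \<in> H. f h x = f a x} = card S" if a: "a \<in> H" for a
  proof -
    have ia: "inv a \<in> H" using a H by (simp add: subgroup.m_inv_closed)
    have aG: "a \<in> carrier G" using a HG by auto
    have "(\<lambda>h. a \<otimes> h) ` S = {h \<in> H. f h x = f a x}"
    proof
      show "(\<lambda>h. a \<otimes> h) ` S \<subseteq> {h \<in> H. f h x = f a x}"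
        using a H act x by (auto simp: S_def acts_def subgroup.m_closed)
      show "{h \<in> H. f h x = f a x} \<subseteq> (\<lambda>h. a \<otimes> h) ` S"
      proof safe
        fix h assume h: "h \<in> H" "f h x = f a x"
        have "f (inv a \<otimes> h) x = f (inv a) (f a x)" using act h ia x by (auto simp: acts_def)
        also have "\<dots> = f (inv a \<otimes> a) x" using act a ia x by (auto simp: acts_def)
        also have "\<dots> = x" using aG act x by (simp add: acts_def)
        finally have "inv a \<otimes> h \<in> S" using H ia h by (simp add: S_def subgroup.m_closed)
        moreover have "h = a \<otimes> (inv a \<otimes> h)" using h aG HG by (auto simp flip: m_assoc)
        ultimately show "h \<in> (\<lambda>h. a \<otimes> h) ` S" by auto
      qed
    qed
    moreover have "inj_on (\<lambda>h. a \<otimes> h) S" using aG HG by (auto simp: inj_on_def S_def subset_iff)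
    ultimately show ?thesis using card_image by metis
  qed
  have "card H = (\<Sum>h\<in>H. 1)" by simp
  also have "\<dots> = (\<Sum>y\<in>(\<lambda>h. f h x) ` H. \<Sum>h\<in>{h \<in> H. f h x = y}. 1)"
    by (rule sum.image_gen) (rule H)
  also have "\<dots> = (\<Sum>y\<in>(\<lambda>h. f h x) ` H. card S)"
    using fib by (intro sum.cong) (auto simp del: card_eq_sum simp add: card_eq_sum[symmetric])
  finally show ?thesis by simp
qed

text \<open>
  Removing the non-trivial orbits one at a time; each of them has size divisible by \<open>p\<close>. Both a
  congruence of cardinalities and an identity of sums in characteristic \<open>p\<close> come from this rule.
\<close>

lemma p_group_action_induct [consumes 4, case_names fixed orbit]:
  fixes p :: nat
  assumes p: "prime p" and H: "p_subgroup p H" and act: "acts H f X" and fin: "finite X"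
    and fixed: "\<And>Y. Y \<subseteq> X \<Longrightarrow> \<forall>h\<in>H. \<forall>x\<in>Y. f h x = x \<Longrightarrow> Z Y"
    and orbit: "\<And>Y x. Y \<subseteq> X \<Longrightarrow> x \<in> X \<Longrightarrow> Y \<inter> (\<lambda>h. f h x) ` H = {} \<Longrightarrow>
      p dvd card ((\<lambda>h. f h x) ` H) \<Longrightarrow> \<forall>y\<in>(\<lambda>h. f h x) ` H. \<exists>h\<in>H. f h y \<noteq> y \<Longrightarrow>
      Z Y \<Longrightarrow> Z (Y \<union> (\<lambda>h. f h x) ` H)"
  shows "Z X"
proof -
  have Hs: "subgroup H G" using H by (simp add: p_subgroup_def)
  obtain n where n: "card H = p ^ n" using H by (auto simp: p_subgroup_def)
  have Hf: "finite H" using n p by (metis card_ge_0_finite prime_gt_0_nat zero_less_power)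
  have "Z Y" if "Y \<subseteq> X" "acts H f Y" for Y
    using finite_subset[OF that(1) fin] that
  proof (induction Y rule: finite_psubset_induct)
    case (psubset Y)
    show ?case
    proof (cases "\<forall>h\<in>H. \<forall>x\<in>Y. f h x = x")
      case True
      then show ?thesis using fixed psubset.prems by blast
    next
      case False
      then obtain x h0 where x: "x \<in> Y" "h0 \<in> H" "f h0 x \<noteq> x" by blast
      let ?O = "(\<lambda>h. f h x) ` H"
      have one: "\<one> \<in> H" using Hs by (simp add: subgroup.one_closed)
      have xO: "x \<in> ?O" using psubset.prems(2) x one by (force simp: acts_def)
      have OY: "?O \<subseteq> Y" using psubset.prems(2) x by (auto simp: acts_def)
      have undo: "f (inv h) (f h y) = y" if "h \<in> H" "y \<in> Y" for h y
      proof -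
        have "f (inv h) (f h y) = f (inv h \<otimes> h) y"
          using psubset.prems(2) that Hs by (simp add: acts_def subgroup.m_inv_closed)
        also have "\<dots> = y" using psubset.prems(2) that Hs by (simp add: acts_def subgroup.mem_carrier)
        finally show ?thesis .
      qed
      have Ocl: "f h y \<in> ?O" if hy: "h \<in> H" "y \<in> ?O" for h y
      proof -
        obtain h' where h': "h' \<in> H" "y = f h' x" using hy by auto
        have "f h y = f (h \<otimes> h') x" using psubset.prems(2) hy h' x by (auto simp: acts_def)
        then show ?thesis using hy h' Hs by (auto simp: subgroup.m_closed)
      qed
      have "card ?O dvd p ^ n" using orbit_card_dvd[OF Hs Hf psubset.prems(2) x(1)] n by simp
      then obtain m where m: "card ?O = p ^ m" using p divides_primepow_nat by metis
      have "card ?O \<noteq> 1"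
      proof
        assume "card ?O = 1"
        then obtain z where "?O = {z}" by (auto simp: card_1_singleton_iff)
        then show False using xO x by (metis imageI singletonD)
      qed
      then have pd: "p dvd card ?O" using m by (metis dvd_power power_0 not_gr_zero)
      have nf: "\<forall>y\<in>?O. \<exists>h\<in>H. f h y \<noteq> y"
      proof (rule ballI, rule ccontr)
        fix y assume y: "y \<in> ?O" and "\<not> (\<exists>h\<in>H. f h y \<noteq> y)"
        then have fy: "\<forall>h\<in>H. f h y = y" by auto
        obtain h where h: "h \<in> H" "y = f h x" using y by auto
        have "x = f (inv h) y" using undo h x by simp
        then have "x = y" using fy Hs h by (simp add: subgroup.m_inv_closed)
        then show False using fy x by auto
      qed
      have rest: "acts H f (Y - ?O)"
      proof -
        have "f h y \<notin> ?O" if "h \<in> H" "y \<in> Y - ?O" for h y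
          using Ocl[of "inv h" "f h y"] undo that Hs by (auto simp: subgroup.m_inv_closed)
        then show ?thesis using psubset.prems(2) by (auto simp: acts_def)
      qed
      have "Y - ?O \<subset> Y" using xO x by auto
      then have "Z (Y - ?O)" using psubset.IH rest psubset.prems by blast
      then have "Z ((Y - ?O) \<union> ?O)"
        using psubset.prems x by (intro orbit[OF _ _ _ pd nf]) auto
      then show ?thesis using OY by (simp add: Un_absorb2 Un_commute)
    qed
  qed
  then show ?thesis using act by blast
qed

lemma card_fixed_points_cong:
  fixes p :: nat
  assumes "prime p" "p_subgroup p H" "acts H f X" "finite X"
  shows "card X mod p = card {x \<in> X. \<forall>h\<in>H. f h x = x} mod p"
  using assms
proof (induction rule: p_group_action_induct)
  case (fixed Y)
  then have "{x \<in> Y. \<forall>h\<in>H. f h x = x} = Y" by auto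
  then show ?case by simp
next
  case (orbit Y x)
  let ?O = "(\<lambda>h. f h x) ` H"
  have "finite ?O"
    using assms(3,4) orbit.hyps(2) by (auto intro!: finite_subset[of _ X] simp: acts_def)
  moreover have "finite Y" using orbit.hyps(1) assms(4) finite_subset by blast
  ultimately have c: "card (Y \<union> ?O) = card Y + card ?O"
    using orbit.hyps(3) by (simp add: card_Un_disjoint)
  have "{y \<in> Y \<union> ?O. \<forall>h\<in>H. f h y = y} = {y \<in> Y. \<forall>h\<in>H. f h y = y}"
    using orbit.hyps(5) by fastforce
  moreover have "(card Y + card ?O) mod p = card Y mod p"
    using orbit.hyps(4) by (metis add.right_neutral mod_add_right_eq dvd_eq_mod_eq_0)
  ultimately show ?case unfolding c using orbit.IH by simp
qed

lemma card_coset_space: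
  assumes "finite (carrier G)" "subgroup C G" "subgroup S G" "S \<subseteq> C"
  shows "card ((\<lambda>c. S #> c) ` C) * card S = card C"
proof -
  have C: "group (G\<lparr>carrier := C\<rparr>)" using assms by (simp add: subgroup_imp_group)
  have "subgroup S (G\<lparr>carrier := C\<rparr>)" using assms by (simp add: subgroup_incl)
  then have "card (rcosets\<^bsub>G\<lparr>carrier := C\<rparr>\<^esub> S) * card S = card C"
    using group.lagrange[OF C] by (simp add: order_def)
  moreover have "rcosets\<^bsub>G\<lparr>carrier := C\<rparr>\<^esub> S = (\<lambda>c. S #> c) ` C"
    by (auto simp: RCOSETS_def r_coset_def)
  ultimately show ?thesis by simp
qed

text \<open>
  Let \<open>Q\<close> act on the cosets \<open>S #> c\<close> by right multiplication with inverses. The coset of \<open>c\<close> is fixed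
  exactly if conjugation by \<open>c\<close> carries \<open>Q\<close> into \<open>S\<close>.
\<close>

lemma card_coset_fixed_points_cong:
  fixes p :: nat
  assumes p: "prime p" and fin: "finite (carrier G)"
    and sub: "subgroup C G" "subgroup S G" "S \<subseteq> C" "Q \<subseteq> C" "p_subgroup p Q"
  shows "card ((\<lambda>c. S #> c) ` C) mod p = card ((\<lambda>c. S #> c) ` {c \<in> C. cj c ` Q \<subseteq> S}) mod p"
proof -
  have CG: "C \<subseteq> carrier G" "S \<subseteq> carrier G" using sub by (simp_all add: subgroup.subset)
  have Qs: "subgroup Q G" using sub by (simp add: p_subgroup_def)
  let ?X = "(\<lambda>c. S #> c) ` C" and ?f = "\<lambda>q X. X #> inv q"
  have act: "acts Q ?f ?X"
    unfolding acts_def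
  proof (intro conjI ballI)
    fix q X assume q: "q \<in> Q" and "X \<in> ?X"
    then obtain c where c: "c \<in> C" "X = S #> c" by auto
    have "X #> inv q = S #> (c \<otimes> inv q)"
      using c q CG sub by (auto simp: coset_mult_assoc subset_iff)
    then show "X #> inv q \<in> ?X" using c q sub by (auto simp: subgroup.m_closed subgroup.m_inv_closed)
  next
    fix X assume "X \<in> ?X"
    then obtain c where c: "c \<in> C" "X = S #> c" by auto
    then show "X #> inv \<one> = X" using CG by (auto simp: coset_mult_assoc subset_iff)
  next
    fix q q' X assume q: "q \<in> Q" "q' \<in> Q" and "X \<in> ?X"
    then obtain c where c: "c \<in> C" "X = S #> c" by auto
    have "q \<in> carrier G" "q' \<in> carrier G" "c \<in> carrier G" using q c CG sub by auto
    then show "X #> inv (q \<otimes> q') = X #> inv q' #> inv q"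
      using c CG by (simp add: coset_mult_assoc inv_mult_group m_assoc r_coset_subset_G)
  qed
  have fp: "{X \<in> ?X. \<forall>q\<in>Q. ?f q X = X} = (\<lambda>c. S #> c) ` {c \<in> C. cj c ` Q \<subseteq> S}"
  proof -
    have "(\<forall>q\<in>Q. S #> c #> inv q = S #> c) \<longleftrightarrow> cj c ` Q \<subseteq> S" if c: "c \<in> C" for c
    proof -
      have cG: "c \<in> carrier G" using c CG by auto
      have "S #> c #> inv q = S #> c \<longleftrightarrow> cj c (inv q) \<in> S" if q: "q \<in> Q" for q
      proof -
        have qG: "q \<in> carrier G" using q sub CG by auto
        have "S #> c #> inv q = S #> c \<longleftrightarrow> S #> (c \<otimes> inv q \<otimes> inv c) = S"
          using cG qG CG coset_mult_inv1[of S "c \<otimes> inv q" c] coset_mult_inv2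
          by (auto simp: coset_mult_assoc)
        also have "\<dots> \<longleftrightarrow> cj c (inv q) \<in> S"
          unfolding cj_def using cG qG sub(2) coset_join1[of S "c \<otimes> inv q \<otimes> inv c"] coset_join2
          by (meson CG(2) coset_join1 coset_join2 inv_closed m_closed)
        finally show ?thesis .
      qed
      then have "(\<forall>q\<in>Q. S #> c #> inv q = S #> c) \<longleftrightarrow> (\<forall>q\<in>Q. cj c (inv q) \<in> S)" by simp
      also have "\<dots> \<longleftrightarrow> (\<forall>q\<in>Q. cj c q \<in> S)"
        using Qs by (metis inv_inv subgroup.m_inv_closed subgroup.mem_carrier)
      finally show ?thesis by auto
    qed
    then show ?thesis by auto
  qed
  have "finite ?X" using CG fin finite_subset by blast
  from card_fixed_points_cong[OF p sub(5) act this] show ?thesis unfolding fp .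
qed

lemma p_subgroup_subgroup:
  fixes p :: nat
  assumes "prime p" "finite (carrier G)" "p_subgroup p P" "subgroup Q G" "Q \<subseteq> P"
  shows "p_subgroup p Q"
proof -
  have "card Q dvd card P"
    using card_coset_space[of P Q] assms by (metis dvd_triv_right p_subgroup_def)
  then show ?thesis using assms divides_primepow_nat by (metis p_subgroup_def)
qed

lemma cj_image_subset_eq:
  assumes "finite (carrier G)" "Q \<subseteq> carrier G" "c \<in> carrier G" "cj c ` Q \<subseteq> S" "card S = card Q" "S \<subseteq> carrier G"
  shows "cj c ` Q = S"
  by (metis assms card_cj_image card_subset_eq finite_subset)

text \<open>
  The fixed points of \<open>Q\<close> on the cosets of \<open>Q\<close> in \<open>P\<close> are the cosets inside the normalizer; their
  number is divisible by \<open>p\<close> and not zero.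
\<close>

lemma p_group_normalizer_grows:
  fixes p :: nat
  assumes p: "prime p" and fin: "finite (carrier G)" and P: "p_subgroup p P"
    and Q: "subgroup Q G" "Q \<subset> P"
  shows "Q \<subset> normalizer P Q"
proof -
  have Ps: "subgroup P G" using P by (simp add: p_subgroup_def)
  have PG: "P \<subseteq> carrier G" "Q \<subseteq> carrier G" using Ps Q by (simp_all add: subgroup.subset)
  have Qp: "p_subgroup p Q" using p_subgroup_subgroup[OF p fin P Q(1)] Q by auto
  let ?F = "(\<lambda>c. Q #> c) ` {c \<in> P. cj c ` Q \<subseteq> Q}"
  have c: "card ((\<lambda>c. Q #> c) ` P) * card Q = card P" using card_coset_space[OF fin Ps Q(1)] Q by auto
  have "card Q < card P" using Q PG fin by (meson finite_subset psubset_card_mono)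
  then have "card ((\<lambda>c. Q #> c) ` P) \<noteq> 1" using c by auto
  moreover obtain n where "card ((\<lambda>c. Q #> c) ` P) = p ^ n"
    using c P p by (metis dvd_triv_left divides_primepow_nat p_subgroup_def)
  ultimately have "p dvd card ((\<lambda>c. Q #> c) ` P)" by (metis dvd_power power_0 not_gr_zero)
  then have pF: "p dvd card ?F"
    using card_coset_fixed_points_cong[OF p fin Ps Q(1) psubset_imp_subset[OF Q(2)]
      psubset_imp_subset[OF Q(2)] Qp] by (simp only: dvd_eq_mod_eq_0)
  have sub: "Q \<subseteq> normalizer P Q"
    using Q cj_image_self[OF Q(1)] by (auto simp: normalizer_def)
  have one: "Q \<in> ?F"
    using PG Ps by (auto intro!: image_eqI[of _ _ \<one>] simp: subgroup.one_closed)
  have "\<not> ?F \<subseteq> {Q}"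
  proof
    assume "?F \<subseteq> {Q}"
    then have "?F = {Q}" using one by blast
    then have "card ?F = 1" by simp
    then have "p dvd 1" using pF by metis
    then show False using p by auto
  qed
  then obtain t where t: "t \<in> P" "cj t ` Q \<subseteq> Q" "Q #> t \<noteq> Q" by auto
  have "cj t ` Q = Q" using cj_image_subset_eq[OF fin PG(2) _ t(2)] t PG by auto
  then have "t \<in> normalizer P Q" using t by (simp add: normalizer_def)
  moreover have "t \<notin> Q" using t coset_join2 Q PG by blast
  ultimately show ?thesis using sub by auto
qed

text \<open>
  A \<open>p\<close>-subgroup \<open>Q\<close> of \<open>C\<close> that is a maximal \<open>p\<close>-subgroup of its normalizer is a Sylow subgroup:
  some Sylow subgroup contains \<open>Q\<close>, and \<open>Q\<close> would grow inside it.
\<close>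

lemma conjugate_if_maximal_in_normalizer:
  fixes p :: nat
  assumes p: "prime p" and fin: "finite (carrier G)" and C: "subgroup C G"
    and Q: "p_subgroup p Q" "Q \<subseteq> C"
    and max: "\<And>S. p_subgroup p S \<Longrightarrow> Q \<subset> S \<Longrightarrow> S \<subseteq> normalizer C Q \<Longrightarrow> False"
    and Q': "p_subgroup p Q'" "Q' \<subseteq> C" "card Q' = card Q"
  shows "\<exists>c\<in>C. cj c ` Q' = Q"
proof -
  have CG: "C \<subseteq> carrier G" using C by (simp add: subgroup.subset)
  have Cf: "finite C" using CG fin finite_subset by blast
  have Qs: "subgroup Q G" "subgroup Q' G" using Q Q' by (simp_all add: p_subgroup_def)
  have Cne: "card C \<noteq> 0" using subgroup.one_closed[OF C] Cf by auto
  have conj: "\<exists>c\<in>C. cj c ` R \<subseteq> S"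
    if "subgroup S G" "S \<subseteq> C" "\<not> p dvd card ((\<lambda>c. S #> c) ` C)" "p_subgroup p R" "R \<subseteq> C" for R S
  proof (rule ccontr)
    assume "\<not> ?thesis"
    then have none: "{c \<in> C. cj c ` R \<subseteq> S} = {}" by auto
    have "card ((\<lambda>c. S #> c) ` C) mod p = 0"
      using card_coset_fixed_points_cong[OF p fin C that(1,2,5,4)] unfolding none by simp
    then show False using that by auto
  qed
  obtain a m where am: "card C = p ^ a * m" "\<not> p dvd m"
    using prime_power_canonical[OF p, of "card C"] Cne by (auto simp: mult.commute)
  have grpC: "group (G\<lparr>carrier := C\<rparr>)" using C by (simp add: subgroup_imp_group)
  obtain S where S: "subgroup S (G\<lparr>carrier := C\<rparr>)" "card S = p ^ a"
    using sylow_thm[OF p grpC, of a m] am Cf by (auto simp: order_def)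
  have SG: "subgroup S G" "S \<subseteq> C" using S C incl_subgroup subgroup.subset by fastforce+
  have idx: "\<not> p dvd card ((\<lambda>c. T #> c) ` C)" if "subgroup T G" "T \<subseteq> C" "card T = p ^ a" for T
  proof -
    have "card ((\<lambda>c. T #> c) ` C) * p ^ a = p ^ a * m"
      using card_coset_space[OF fin C that(1,2)] am that by simp
    then have "card ((\<lambda>c. T #> c) ` C) = m" using p prime_gt_0_nat[of p] by simp
    then show ?thesis using am by simp
  qed
  (* a conjugate of the Sylow subgroup S contains Q *)
  obtain c where c: "c \<in> C" "cj c ` Q \<subseteq> S" using conj[OF SG idx[OF SG S(2)] Q] by auto
  have cG: "c \<in> carrier G" using c CG by auto
  have ic: "inv c \<in> C" "inv c \<in> carrier G" using c C CG by (auto simp: subgroup.m_inv_closed)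
  define S' where "S' = cj (inv c) ` S"
  have S's: "subgroup S' G" using SG ic by (simp add: S'_def subgroup_cj_image)
  have S'C: "S' \<subseteq> C" using SG ic C by (auto simp: S'_def subset_iff intro: cj_in_subgroup)
  have S'c: "card S' = p ^ a" using S SG CG ic by (simp add: S'_def subset_trans)
  have "cj (inv c) ` cj c ` Q \<subseteq> S'" using c unfolding S'_def by (intro image_mono)
  then have QS: "Q \<subseteq> S'" using Q CG cG by (simp add: subset_trans)
  have S'p: "p_subgroup p S'" using S's S'c by (auto simp: p_subgroup_def)
  have "Q = S'"
  proof (rule ccontr)
    assume "Q \<noteq> S'"
    then have "Q \<subset> normalizer S' Q" using p_group_normalizer_grows[OF p fin S'p Qs(1)] QS by auto
    moreover have "p_subgroup p (normalizer S' Q)"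
      using p_subgroup_subgroup[OF p fin S'p] normalizer_subgroup[OF S's] Qs
      by (auto simp: subgroup.subset normalizer_def)
    ultimately show False using max S'C by (auto simp: normalizer_def)
  qed
  (* now Q itself has index prime to p, so the same fixed point argument applies to it *)
  then obtain d where d: "d \<in> C" "cj d ` Q' \<subseteq> Q" using conj[OF Qs(1) Q(2) idx Q'(1,2)] Qs Q S'c by auto
  then have "cj d ` Q' = Q"
    using cj_image_subset_eq[OF fin _ _ d(2)] Q' Qs CG subgroup.subset by (metis subsetD)
  then show ?thesis using d by auto
qed

end

section \<open>Sums in abelian monoids and fields of positive characteristic\<close>

lemma (in abelian_monoid) finsum_commute:
  assumes "finite A" "finite B" "\<And>a b. a \<in> A \<Longrightarrow> b \<in> B \<Longrightarrow> f a b \<in> carrier G"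
  shows "(\<Oplus>a\<in>A. \<Oplus>b\<in>B. f a b) = (\<Oplus>b\<in>B. \<Oplus>a\<in>A. f a b)"
  using assms(1,3)
proof (induction A rule: finite_induct)
  case empty
  then show ?case by simp
next
  case (insert x F)
  have "(\<Oplus>a\<in>insert x F. \<Oplus>b\<in>B. f a b) = (\<Oplus>b\<in>B. f x b) \<oplus> (\<Oplus>b\<in>B. \<Oplus>a\<in>F. f a b)"
    using insert by (simp add: Pi_def)
  also have "\<dots> = (\<Oplus>b\<in>B. f x b \<oplus> (\<Oplus>a\<in>F. f a b))"
    using insert by (subst finsum_addf) (auto simp: Pi_def)
  also have "\<dots> = (\<Oplus>b\<in>B. \<Oplus>a\<in>insert x F. f a b)"
    using insert by (intro finsum_cong') (auto simp: Pi_def)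
  finally show ?case .
qed

lemma (in abelian_monoid) finsum_mono_neutral:
  assumes "finite B" "A \<subseteq> B" "\<And>b. b \<in> B - A \<Longrightarrow> f b = \<zero>" "\<And>b. b \<in> A \<Longrightarrow> f b \<in> carrier G"
  shows "finsum G f B = finsum G f A"
proof (rule add.finprod_mono_neutral_cong_right)
  show "f \<in> B \<rightarrow> carrier G" using assms by (metis DiffI Pi_I zero_closed)
qed (use assms in auto)

lemma (in abelian_monoid) finsum_bij:
  assumes "bij_betw h A B" "\<And>b. b \<in> B \<Longrightarrow> f b \<in> carrier G"
  shows "finsum G f B = finsum G (\<lambda>a. f (h a)) A"
  using assms finsum_reindex[of f h A] by (auto simp: bij_betw_def Pi_def)

lemma (in abelian_monoid) finsum_delta:
  assumes "finite A" "x \<in> A" "f x \<in> carrier G" "\<And>a. a \<in> A \<Longrightarrow> a \<noteq> x \<Longrightarrow> f a = \<zero>"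
  shows "finsum G f A = f x"
proof -
  have "finsum G f A = finsum G f {x}"
    by (rule finsum_mono_neutral) (use assms in auto)
  then show ?thesis using assms by simp
qed

lemma (in ring) finsum_const_char_dvd:
  assumes "ring_char R dvd card A" "a \<in> carrier R"
  shows "(\<Oplus>x\<in>A. a) = \<zero>"
proof -
  have "[card A] \<cdot> \<one> = \<zero>"
    using assms add.pow_eq_id[of \<one> "card A"] by (simp add: ring_char_def)
  then have "([card A] \<cdot> \<one>) \<otimes> a = \<zero>" using assms by simp
  then have "[card A] \<cdot> a = \<zero>" using assms by (simp add: add_pow_ldistr)
  then show ?thesis using assms add.finprod_const[of a A] by simp
qed

lemma (in domain) prime_ring_char:
  assumes "ring_char R > 0"
  shows "prime (ring_char R)"
proof -
  have z: "[n] \<cdot> \<one> = \<zero> \<longleftrightarrow> ring_char R dvd n" for n :: nat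
    using add.pow_eq_id[of \<one> n] by (simp add: ring_char_def)
  show ?thesis
    unfolding prime_nat_iff
  proof (intro conjI allI impI)
    have "ring_char R \<noteq> 1" using z[of 1] by auto
    then show "1 < ring_char R" using assms by simp
    fix a assume "a dvd ring_char R"
    then obtain b where b: "ring_char R = a * b" by auto
    have "([a] \<cdot> \<one>) \<otimes> ([b] \<cdot> \<one>) = [(a * b)] \<cdot> \<one>"
      by (simp add: add_pow_ldistr add.nat_pow_pow mult.commute)
    then have "([a] \<cdot> \<one>) \<otimes> ([b] \<cdot> \<one>) = \<zero>" using z b by simp
    then have "[a] \<cdot> \<one> = \<zero> \<or> [b] \<cdot> \<one> = \<zero>" by (intro integral) auto
    then have "ring_char R dvd a \<or> ring_char R dvd b" using z by simp
    then show "a = 1 \<or> a = ring_char R"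
      using b assms by (metis dvd_antisym dvd_triv_left dvd_triv_right mult_cancel2 nat_mult_1 not_gr_zero)
  qed
qed

text \<open>
  Gaussian elimination: if some vector \<open>v m\<close> is nonzero at \<open>s\<close>, subtract multiples of it from the others to
  make them vanish at \<open>s\<close>, and choose the coefficient of \<open>v m\<close> last.
\<close>

lemma (in field) linear_dependence:
  assumes "finite S" "finite J" "card S < card J" "\<And>j s. j \<in> J \<Longrightarrow> s \<in> S \<Longrightarrow> v j s \<in> carrier R"
  shows "\<exists>c. (\<forall>j\<in>J. c j \<in> carrier R) \<and> (\<exists>j\<in>J. c j \<noteq> \<zero>) \<and> (\<forall>s\<in>S. (\<Oplus>j\<in>J. c j \<otimes> v j s) = \<zero>)"
  using assms
proof (induction S arbitrary: J v rule: finite_induct)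
  case empty
  then have "J \<noteq> {}" by auto
  then show ?case by (intro exI[of _ "\<lambda>_. \<one>"]) auto
next
  case (insert s S)
  show ?case
  proof (cases "\<forall>j\<in>J. v j s = \<zero>")
    case True
    obtain c where c: "\<forall>j\<in>J. c j \<in> carrier R" "\<exists>j\<in>J. c j \<noteq> \<zero>" "\<forall>s\<in>S. (\<Oplus>j\<in>J. c j \<otimes> v j s) = \<zero>"
      using insert.IH[of J v] insert.prems insert.hyps by auto
    moreover have "(\<Oplus>j\<in>J. c j \<otimes> v j s) = \<zero>"
      using c True by (intro add.finprod_one_eqI) auto
    ultimately show ?thesis by auto
  next
    case False
    then obtain m where m: "m \<in> J" "v m s \<noteq> \<zero>" by auto
    have vm: "v m s \<in> carrier R" "v m s \<in> Units R" using m insert.prems by (auto simp: field_Units)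
    define d where "d j = v j s \<otimes> inv (v m s)" for j
    define w where "w j t = v j t \<ominus> d j \<otimes> v m t" for j t
    have dc: "d j \<in> carrier R" if "j \<in> J" for j using that insert.prems vm by (simp add: d_def)
    have "\<exists>c. (\<forall>j\<in>J - {m}. c j \<in> carrier R) \<and> (\<exists>j\<in>J - {m}. c j \<noteq> \<zero>) \<and>
        (\<forall>t\<in>S. (\<Oplus>j\<in>J - {m}. c j \<otimes> w j t) = \<zero>)"
    proof (rule insert.IH)
      show "card S < card (J - {m})" using insert.prems insert.hyps m by simp
      show "w j t \<in> carrier R" if "j \<in> J - {m}" "t \<in> S" for j t
        using that insert.prems m dc by (simp add: w_def)
    qed (use insert.prems in auto)
    then obtain c where c: "\<And>j. j \<in> J - {m} \<Longrightarrow> c j \<in> carrier R" "\<exists>j\<in>J - {m}. c j \<noteq> \<zero>"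
        "\<And>t. t \<in> S \<Longrightarrow> (\<Oplus>j\<in>J - {m}. c j \<otimes> w j t) = \<zero>" by auto
    define c' where "c' j = (if j = m then \<ominus> (\<Oplus>j\<in>J - {m}. c j \<otimes> d j) else c j)" for j
    have cd: "(\<Oplus>j\<in>J - {m}. c j \<otimes> d j) \<in> carrier R" using c dc by (intro finsum_closed) auto
    have c'c: "c' j \<in> carrier R" if "j \<in> J" for j using that c cd by (auto simp: c'_def)
    have key: "(\<Oplus>j\<in>J. c' j \<otimes> v j t) = (\<Oplus>j\<in>J - {m}. c j \<otimes> (v j t \<ominus> d j \<otimes> v m t))"
      if t: "t \<in> insert s S" for t
    proof -
      have vt: "v j t \<in> carrier R" if "j \<in> J" for j using that t insert.prems by auto
      have "(\<Oplus>j\<in>J. c' j \<otimes> v j t) = (\<Oplus>j\<in>insert m (J - {m}). c' j \<otimes> v j t)"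
        using m by (simp add: insert_absorb)
      also have "\<dots> = c' m \<otimes> v m t \<oplus> (\<Oplus>j\<in>J - {m}. c' j \<otimes> v j t)"
        using insert.prems(1) m c'c vt by (intro finsum_insert) auto
      also have "(\<Oplus>j\<in>J - {m}. c' j \<otimes> v j t) = (\<Oplus>j\<in>J - {m}. c j \<otimes> v j t)"
        using c vt by (intro finsum_cong') (auto simp: c'_def)
      also have "c' m \<otimes> v m t = \<ominus> (\<Oplus>j\<in>J - {m}. c j \<otimes> d j \<otimes> v m t)"
        using cd c dc vt m insert.prems(1) by (simp add: c'_def l_minus finsum_ldistr Pi_def)
      also have "\<ominus> (\<Oplus>j\<in>J - {m}. c j \<otimes> d j \<otimes> v m t) = (\<Oplus>j\<in>J - {m}. \<ominus> \<one> \<otimes> (c j \<otimes> d j \<otimes> v m t))"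
        using c dc vt m insert.prems(1)
        by (subst finsum_rdistr[symmetric]) (auto simp: Pi_def l_minus)
      also have "\<dots> \<oplus> (\<Oplus>j\<in>J - {m}. c j \<otimes> v j t) =
          (\<Oplus>j\<in>J - {m}. \<ominus> \<one> \<otimes> (c j \<otimes> d j \<otimes> v m t) \<oplus> c j \<otimes> v j t)"
        using c dc vt m by (subst finsum_addf) (auto simp: Pi_def)
      also have "\<dots> = (\<Oplus>j\<in>J - {m}. c j \<otimes> (v j t \<ominus> d j \<otimes> v m t))"
      proof (intro finsum_cong' refl)
        fix j assume j: "j \<in> J - {m}"
        have *: "c j \<in> carrier R" "d j \<in> carrier R" "v m t \<in> carrier R" "v j t \<in> carrier R"
          using j c dc vt m by auto
        then show "\<ominus> \<one> \<otimes> (c j \<otimes> d j \<otimes> v m t) \<oplus> c j \<otimes> v j t = c j \<otimes> (v j t \<ominus> d j \<otimes> v m t)"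
          by algebra
      qed (use c dc vt m in auto)
      finally show ?thesis .
    qed
    have "(\<Oplus>j\<in>J. c' j \<otimes> v j t) = \<zero>" if t: "t \<in> insert s S" for t
    proof (cases "t = s")
      case True
      have "v j s \<ominus> d j \<otimes> v m s = \<zero>" if "j \<in> J" for j
        using that vm insert.prems by (simp add: d_def m_assoc)
      then show ?thesis unfolding key[OF t] using c True by (intro add.finprod_one_eqI) auto
    next
      case False
      then show ?thesis unfolding key[OF t] using c(3)[of t] t by (simp add: w_def)
    qed
    moreover have "\<exists>j\<in>J. c' j \<noteq> \<zero>" using c(2) by (auto simp: c'_def)
    ultimately show ?thesis using c'c by blast
  qed
qed


section \<open>The group algebra\<close>

locale modular_group_algebra = field k + grp: group G
  for k :: "('l, 'm) ring_scheme" (structure) and G :: "('g, 'n) monoid_scheme" +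
  fixes p :: nat
  assumes fin: "finite (carrier G)" and ring_char: "ring_char k = p" and p_pos: "p > 0"
begin

abbreviation A where "A \<equiv> group_algebra k G"
abbreviation AC where "AC \<equiv> carrier (group_algebra k G)"
abbreviation gmult (infixl "\<cdot>" 70) where "x \<cdot> y \<equiv> x \<otimes>\<^bsub>G\<^esub> y"
abbreviation amult (infixl "\<star>" 70) where "a \<star> b \<equiv> a \<otimes>\<^bsub>group_algebra k G\<^esub> b"
abbreviation aadd (infixl "\<boxplus>" 65) where "a \<boxplus> b \<equiv> a \<oplus>\<^bsub>group_algebra k G\<^esub> b"
abbreviation aminus (infixl "\<boxminus>" 65) where "a \<boxminus> b \<equiv> a \<ominus>\<^bsub>group_algebra k G\<^esub> b"
abbreviation azero ("\<zero>\<^sub>A") where "\<zero>\<^sub>A \<equiv> \<zero>\<^bsub>group_algebra k G\<^esub>"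
abbreviation aone ("\<one>\<^sub>A") where "\<one>\<^sub>A \<equiv> \<one>\<^bsub>group_algebra k G\<^esub>"

lemma prime_p: "prime p"
  using prime_ring_char ring_char p_pos by simp

lemma in_AC: "a \<in> AC \<longleftrightarrow> (\<forall>g\<in>carrier G. a g \<in> carrier k) \<and> (\<forall>g. g \<notin> carrier G \<longrightarrow> a g = \<zero>)"
  by (simp add: group_algebra_def)

lemma AC_off: "a \<in> AC \<Longrightarrow> g \<notin> carrier G \<Longrightarrow> a g = \<zero>"
  by (simp add: in_AC)

lemma mult_apply: "g \<in> carrier G \<Longrightarrow> (a \<star> b) g = (\<Oplus>h\<in>carrier G. a h \<otimes> b (inv\<^bsub>G\<^esub> h \<cdot> g))"
  and mult_off: "g \<notin> carrier G \<Longrightarrow> (a \<star> b) g = \<zero>"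
  and add_apply: "(a \<boxplus> b) g = a g \<oplus> b g"
  and zero_apply: "\<zero>\<^sub>A g = \<zero>"
  and one_apply: "\<one>\<^sub>A g = (if g = \<one>\<^bsub>G\<^esub> then \<one> else \<zero>)"
  by (simp_all add: group_algebra_def)

lemma zero_eq: "\<zero>\<^sub>A = (\<lambda>_. \<zero>)"
  by (simp add: group_algebra_def)

lemma AC_coeff [simp]: "a \<in> AC \<Longrightarrow> a g \<in> carrier k"
  by (cases "g \<in> carrier G") (auto simp: in_AC)

lemma AC_I: "(\<And>g. g \<in> carrier G \<Longrightarrow> a g \<in> carrier k) \<Longrightarrow> (\<And>g. g \<notin> carrier G \<Longrightarrow> a g = \<zero>) \<Longrightarrow> a \<in> AC"
  unfolding in_AC by blast

lemma add_fun: "a \<boxplus> b = (\<lambda>g. a g \<oplus> b g)"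
  by (simp add: fun_eq_iff add_apply)

lemma mult_closed: "a \<in> AC \<Longrightarrow> b \<in> AC \<Longrightarrow> a \<star> b \<in> AC"
  by (intro AC_I) (auto simp: mult_apply mult_off intro!: finsum_closed)

lemma inv_mult_cancel [simp]:
  assumes "x \<in> carrier G" "y \<in> carrier G"
  shows "x \<cdot> (inv\<^bsub>G\<^esub> x \<cdot> y) = y" "inv\<^bsub>G\<^esub> x \<cdot> (x \<cdot> y) = y"
  using assms by (simp_all flip: grp.m_assoc)

lemma bij_left_mult: "x \<in> carrier G \<Longrightarrow> bij_betw (\<lambda>h. x \<cdot> h) (carrier G) (carrier G)"
  by (rule bij_betwI[where g = "\<lambda>h. inv\<^bsub>G\<^esub> x \<cdot> h"]) (simp_all add: Pi_def)

lemma bij_inv_mult: "x \<in> carrier G \<Longrightarrow> bij_betw (\<lambda>h. x \<cdot> inv\<^bsub>G\<^esub> h) (carrier G) (carrier G)"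
  by (rule bij_betwI[where g = "\<lambda>h. inv\<^bsub>G\<^esub> h \<cdot> x"])
    (simp_all add: Pi_def grp.inv_mult_group grp.m_assoc)

lemma bij_cj: "x \<in> carrier G \<Longrightarrow> bij_betw (grp.cj x) (carrier G) (carrier G)"
  by (rule bij_betwI[where g = "grp.cj (inv\<^bsub>G\<^esub> x)"]) auto

lemma mult_assoc:
  assumes a: "a \<in> AC" and b: "b \<in> AC" and c: "c \<in> AC"
  shows "a \<star> b \<star> c = a \<star> (b \<star> c)"
proof
  fix g
  show "(a \<star> b \<star> c) g = (a \<star> (b \<star> c)) g"
  proof (cases "g \<in> carrier G")
    case g: True
    have "(a \<star> b \<star> c) g =
        (\<Oplus>h\<in>carrier G. (\<Oplus>m\<in>carrier G. a m \<otimes> b (inv\<^bsub>G\<^esub> m \<cdot> h)) \<otimes> c (inv\<^bsub>G\<^esub> h \<cdot> g))"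
      using g a b c by (simp add: mult_apply cong: finsum_cong)
    also have "\<dots> = (\<Oplus>h\<in>carrier G. \<Oplus>m\<in>carrier G. a m \<otimes> b (inv\<^bsub>G\<^esub> m \<cdot> h) \<otimes> c (inv\<^bsub>G\<^esub> h \<cdot> g))"
      using a b c fin by (intro finsum_cong') (auto simp: finsum_ldistr)
    also have "\<dots> = (\<Oplus>m\<in>carrier G. \<Oplus>h\<in>carrier G. a m \<otimes> b (inv\<^bsub>G\<^esub> m \<cdot> h) \<otimes> c (inv\<^bsub>G\<^esub> h \<cdot> g))"
      using a b c fin by (intro finsum_commute) auto
    also have "\<dots> = (\<Oplus>m\<in>carrier G. a m \<otimes> (b \<star> c) (inv\<^bsub>G\<^esub> m \<cdot> g))"
    proof (rule finsum_cong')
      fix m assume m: "m \<in> carrier G"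
      have "(\<Oplus>h\<in>carrier G. a m \<otimes> b (inv\<^bsub>G\<^esub> m \<cdot> h) \<otimes> c (inv\<^bsub>G\<^esub> h \<cdot> g)) =
          (\<Oplus>h\<in>carrier G. a m \<otimes> b (inv\<^bsub>G\<^esub> m \<cdot> (m \<cdot> h)) \<otimes> c (inv\<^bsub>G\<^esub> (m \<cdot> h) \<cdot> g))"
        using a b c m by (intro finsum_bij bij_left_mult) auto
      also have "\<dots> = (\<Oplus>h\<in>carrier G. a m \<otimes> (b h \<otimes> c (inv\<^bsub>G\<^esub> h \<cdot> (inv\<^bsub>G\<^esub> m \<cdot> g))))"
        using a b c m g
        by (intro finsum_cong') (auto simp: m_assoc grp.inv_mult_group simp flip: grp.m_assoc)
      also have "\<dots> = a m \<otimes> (b \<star> c) (inv\<^bsub>G\<^esub> m \<cdot> g)"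
        using a b c m g fin by (simp add: mult_apply finsum_rdistr)
      finally show "(\<Oplus>h\<in>carrier G. a m \<otimes> b (inv\<^bsub>G\<^esub> m \<cdot> h) \<otimes> c (inv\<^bsub>G\<^esub> h \<cdot> g)) =
        a m \<otimes> (b \<star> c) (inv\<^bsub>G\<^esub> m \<cdot> g)" .
    qed (use a b c in \<open>auto simp: mult_closed\<close>)
    also have "\<dots> = (a \<star> (b \<star> c)) g" using g by (simp add: mult_apply)
    finally show ?thesis .
  qed (simp add: mult_off)
qed

lemma ring_group_algebra: "ring A"
proof (rule ringI)
  show "abelian_group A"
  proof (rule abelian_groupI)
    show "\<exists>b\<in>AC. b \<boxplus> a = \<zero>\<^sub>A" if a: "a \<in> AC" for a
    proof
      show "(\<lambda>g. \<ominus> a g) \<in> AC" using a by (intro AC_I) (auto simp: AC_off)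
      show "(\<lambda>g. \<ominus> a g) \<boxplus> a = \<zero>\<^sub>A" using a by (simp add: add_fun zero_eq l_neg)
    qed
    show "a \<boxplus> b \<in> AC" if "a \<in> AC" "b \<in> AC" for a b
      using that by (intro AC_I) (auto simp: add_apply AC_off)
    show "\<zero>\<^sub>A \<in> AC" by (intro AC_I) (auto simp: zero_apply)
  qed (simp_all add: add_fun zero_eq a_assoc a_comm a_lcomm)
  show "monoid A"
  proof (rule monoidI)
    show "\<one>\<^sub>A \<in> AC" by (intro AC_I) (auto simp: one_apply)
    show "\<one>\<^sub>A \<star> a = a" if a: "a \<in> AC" for a
    proof
      fix g
      show "(\<one>\<^sub>A \<star> a) g = a g"
      proof (cases "g \<in> carrier G")
        case True
        have "(\<one>\<^sub>A \<star> a) g = \<one>\<^sub>A \<one>\<^bsub>G\<^esub> \<otimes> a (inv\<^bsub>G\<^esub> \<one>\<^bsub>G\<^esub> \<cdot> g)"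
          unfolding mult_apply[OF True] using a True fin
          by (intro finsum_delta) (auto simp: one_apply)
        then show ?thesis using a True by (simp add: one_apply)
      qed (use a in \<open>simp add: mult_off AC_off\<close>)
    qed
    show "a \<star> \<one>\<^sub>A = a" if a: "a \<in> AC" for a
    proof
      fix g
      show "(a \<star> \<one>\<^sub>A) g = a g"
      proof (cases "g \<in> carrier G")
        case True
        have "(a \<star> \<one>\<^sub>A) g = a g \<otimes> \<one>\<^sub>A (inv\<^bsub>G\<^esub> g \<cdot> g)"
          unfolding mult_apply[OF True] using a True fin
          by (intro finsum_delta) (auto simp: one_apply grp.inv_solve_left')
        then show ?thesis using a True by (simp add: one_apply)
      qed (use a in \<open>simp add: mult_off AC_off\<close>)
    qed
  qed (auto simp: mult_closed mult_assoc)
  show "(a \<boxplus> b) \<star> c = a \<star> c \<boxplus> b \<star> c" if "a \<in> AC" "b \<in> AC" "c \<in> AC" for a b c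
  proof
    fix g
    show "((a \<boxplus> b) \<star> c) g = (a \<star> c \<boxplus> b \<star> c) g"
      using that by (cases "g \<in> carrier G")
        (auto simp: mult_apply mult_off add_apply l_distr Pi_def simp flip: finsum_addf)
  qed
  show "c \<star> (a \<boxplus> b) = c \<star> a \<boxplus> c \<star> b" if "a \<in> AC" "b \<in> AC" "c \<in> AC" for a b c
  proof
    fix g
    show "(c \<star> (a \<boxplus> b)) g = (c \<star> a \<boxplus> c \<star> b) g"
      using that by (cases "g \<in> carrier G")
        (auto simp: mult_apply mult_off add_apply r_distr Pi_def simp flip: finsum_addf)
  qed
qed

sublocale A: ring A
  by (rule ring_group_algebra)

lemma minus_apply: "a \<in> AC \<Longrightarrow> b \<in> AC \<Longrightarrow> (a \<boxminus> b) g = a g \<ominus> b g"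
proof -
  assume a: "a \<in> AC" "b \<in> AC"
  have "((a \<boxminus> b) \<boxplus> b) g = a g" using a by (simp add: A.minus_eq A.a_assoc A.l_neg)
  then have "(a \<boxminus> b) g \<oplus> b g = a g" by (simp add: add_apply)
  moreover have "(a \<boxminus> b) g \<in> carrier k" using a by auto
  ultimately show ?thesis using a by (metis AC_coeff add.inv_solve_right a_minus_def)
qed

lemma finsum_apply:
  assumes "finite S" "\<And>s. s \<in> S \<Longrightarrow> f s \<in> AC"
  shows "(\<Oplus>\<^bsub>A\<^esub>s\<in>S. f s) g = (\<Oplus>s\<in>S. f s g)"
  using assms
proof (induction S rule: finite_induct)
  case empty
  then show ?case by (simp add: zero_apply)
next
  case (insert x F)
  then show ?case by (simp add: add_apply Pi_def)
qed

definition smul :: "'l \<Rightarrow> ('g \<Rightarrow> 'l) \<Rightarrow> ('g \<Rightarrow> 'l)"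
  where "smul c a = (\<lambda>g. c \<otimes> a g)"

lemma smul_closed [simp]: "c \<in> carrier k \<Longrightarrow> a \<in> AC \<Longrightarrow> smul c a \<in> AC"
  by (intro AC_I) (auto simp: smul_def AC_off)

lemma smul_mult:
  assumes "c \<in> carrier k" "a \<in> AC" "b \<in> AC"
  shows "smul c a \<star> b = smul c (a \<star> b)" "a \<star> smul c b = smul c (a \<star> b)"
proof -
  have "(smul c a \<star> b) g = smul c (a \<star> b) g \<and> (a \<star> smul c b) g = smul c (a \<star> b) g" for g
  proof (cases "g \<in> carrier G")
    case g: True
    have r: "smul c (a \<star> b) g = (\<Oplus>h\<in>carrier G. c \<otimes> (a h \<otimes> b (inv\<^bsub>G\<^esub> h \<cdot> g)))"
      unfolding smul_def mult_apply[OF g] using assms fin by (intro finsum_rdistr) auto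
    have "(smul c a \<star> b) g = smul c (a \<star> b) g"
      unfolding r mult_apply[OF g] using assms by (intro finsum_cong') (auto simp: smul_def m_assoc)
    moreover have "(a \<star> smul c b) g = smul c (a \<star> b) g"
      unfolding r mult_apply[OF g] using assms by (intro finsum_cong') (auto simp: smul_def m_lcomm)
    ultimately show ?thesis by simp
  qed (use assms in \<open>simp add: smul_def mult_off\<close>)
  then show "smul c a \<star> b = smul c (a \<star> b)" "a \<star> smul c b = smul c (a \<star> b)" by auto
qed

lemma smul_eq_zero: "c \<in> carrier k \<Longrightarrow> a \<in> AC \<Longrightarrow> a \<noteq> \<zero>\<^sub>A \<Longrightarrow> smul c a = \<zero>\<^sub>A \<Longrightarrow> c = \<zero>"
  using integral by (fastforce simp: smul_def zero_eq fun_eq_iff)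

lemma smul_minus_one: "a \<in> AC \<Longrightarrow> smul (\<ominus> \<one>) a = \<ominus>\<^bsub>A\<^esub> a"
  using smul_closed[of "\<ominus> \<one>" a]
  by (intro A.minus_equality[symmetric]) (auto simp: smul_def add_apply zero_eq fun_eq_iff l_minus l_neg)

definition subalg :: "('g \<Rightarrow> 'l) set \<Rightarrow> bool"
  where "subalg B \<longleftrightarrow> B \<subseteq> AC \<and> \<zero>\<^sub>A \<in> B \<and> (\<forall>a\<in>B. \<forall>b\<in>B. a \<boxplus> b \<in> B \<and> a \<star> b \<in> B) \<and>
    (\<forall>c\<in>carrier k. \<forall>a\<in>B. smul c a \<in> B)"

lemma subalgD:
  assumes "subalg B"
  shows "a \<in> B \<Longrightarrow> a \<in> AC" "\<zero>\<^sub>A \<in> B" "a \<in> B \<Longrightarrow> b \<in> B \<Longrightarrow> a \<boxplus> b \<in> B" "a \<in> B \<Longrightarrow> b \<in> B \<Longrightarrow> a \<star> b \<in> B"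
    "c \<in> carrier k \<Longrightarrow> a \<in> B \<Longrightarrow> smul c a \<in> B" "a \<in> B \<Longrightarrow> b \<in> B \<Longrightarrow> a \<boxminus> b \<in> B"
proof -
  show "a \<in> B \<Longrightarrow> b \<in> B \<Longrightarrow> a \<boxminus> b \<in> B"
    using assms smul_minus_one[of b] by (auto simp: subalg_def A.minus_eq) (metis a_inv_closed one_closed subsetD)
qed (use assms in \<open>auto simp: subalg_def\<close>)

lemma subalg_finsum:
  assumes "subalg B" "finite S" "\<And>s. s \<in> S \<Longrightarrow> f s \<in> B"
  shows "(\<Oplus>\<^bsub>A\<^esub>s\<in>S. f s) \<in> B"
  using assms(2,3)
proof (induction S rule: finite_induct)
  case empty
  then show ?case using assms by (simp add: subalgD)
next
  case (insert x F)
  then have "f \<in> F \<rightarrow> AC" "f x \<in> AC" using subalgD(1)[OF assms(1)] by auto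
  then show ?case using insert assms by (simp add: subalgD)
qed

subsection \<open>Subgroups\<close>

definition kH :: "'g set \<Rightarrow> ('g \<Rightarrow> 'l) set"
  where "kH H = carrier (group_algebra k (G\<lparr>carrier := H\<rparr>))"

lemma kH_iff:
  assumes "H \<subseteq> carrier G"
  shows "a \<in> kH H \<longleftrightarrow> a \<in> AC \<and> (\<forall>g. g \<notin> H \<longrightarrow> a g = \<zero>)"
  using assms by (auto simp: kH_def group_algebra_def simp del: AC_coeff)

lemma kH_carrier [simp]: "kH (carrier G) = AC"
  using AC_off by (auto simp: kH_iff)

text \<open>
  The group algebra of a subgroup is the set of elements of \<open>kG\<close> supported on the subgroup. This lets all
  computations take place in the one ring \<open>kG\<close>.
\<close>

lemma mult_subgroup:
  assumes H: "subgroup H G" and a: "a \<in> kH H" and b: "b \<in> kH H"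
  shows "a \<otimes>\<^bsub>group_algebra k (G\<lparr>carrier := H\<rparr>)\<^esub> b = a \<star> b"
proof
  fix g
  have HG: "H \<subseteq> carrier G" using H by (rule subgroup.subset)
  note a' = a[unfolded kH_iff[OF HG]] and b' = b[unfolded kH_iff[OF HG]]
  have restr: "(a \<star> b) g = (\<Oplus>h\<in>H. a h \<otimes> b (inv\<^bsub>G\<^esub> h \<cdot> g))" if "g \<in> carrier G"
    unfolding mult_apply[OF that] using a' b' HG fin by (intro finsum_mono_neutral) auto
  show "(a \<otimes>\<^bsub>group_algebra k (G\<lparr>carrier := H\<rparr>)\<^esub> b) g = (a \<star> b) g"
  proof (cases "g \<in> H")
    case True
    then have "(a \<otimes>\<^bsub>group_algebra k (G\<lparr>carrier := H\<rparr>)\<^esub> b) g =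
        (\<Oplus>h\<in>H. a h \<otimes> b (inv\<^bsub>G\<lparr>carrier := H\<rparr>\<^esub> h \<cdot> g))"
      by (simp add: group_algebra_def del: AC_coeff)
    also have "\<dots> = (\<Oplus>h\<in>H. a h \<otimes> b (inv\<^bsub>G\<^esub> h \<cdot> g))"
      using H a' b' by (intro finsum_cong') auto
    finally show ?thesis using True HG restr by auto
  next
    case False
    have "(a \<star> b) g = \<zero>"
    proof (cases "g \<in> carrier G")
      case True
      have "inv\<^bsub>G\<^esub> h \<cdot> g \<notin> H" if h: "h \<in> H" for h
      proof
        assume "inv\<^bsub>G\<^esub> h \<cdot> g \<in> H"
        then have "h \<cdot> (inv\<^bsub>G\<^esub> h \<cdot> g) \<in> H" using h H by (simp add: subgroup.m_closed)
        then show False using False True h HG by (auto simp flip: grp.m_assoc)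
      qed
      then show ?thesis unfolding restr[OF True] using a' b' HG
        by (intro add.finprod_one_eqI) auto
    qed (simp add: mult_off)
    then show ?thesis using False by (simp add: group_algebra_def del: AC_coeff)
  qed
qed

lemma kH_mult_closed:
  assumes H: "subgroup H G" and a: "a \<in> kH H" and b: "b \<in> kH H"
  shows "a \<star> b \<in> kH H"
proof -
  have HG: "H \<subseteq> carrier G" using H by (rule subgroup.subset)
  have "(a \<star> b) g = \<zero>" if "g \<notin> H" for g
    unfolding mult_subgroup[OF assms, symmetric] using that by (simp add: group_algebra_def del: AC_coeff)
  then show ?thesis using a b by (auto simp: kH_iff[OF HG])
qed

lemma subalg_kH: "subgroup H G \<Longrightarrow> subalg (kH H)"
  using kH_mult_closed smul_closed
  by (auto simp: subalg_def kH_iff[OF subgroup.subset] add_apply zero_apply) (auto simp: smul_def)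

lemma one_kH: "subgroup H G \<Longrightarrow> \<one>\<^sub>A \<in> kH H"
  by (auto simp: kH_iff[OF subgroup.subset] one_apply subgroup.one_closed)

lemma kH_mono: "H \<subseteq> H' \<Longrightarrow> H' \<subseteq> carrier G \<Longrightarrow> kH H \<subseteq> kH H'"
  by (auto simp: kH_iff subset_iff)


subsection \<open>Conjugation and automorphisms of the coefficients\<close>

text \<open>
  Conjugation by \<open>x\<close> followed by an automorphism \<open>\<gamma>\<close> of the coefficients. Conjugation in \<open>kG\<close> is the
  case where \<open>\<gamma>\<close> is the identity, and the Galois action is the case \<open>x = \<one>\<close>; blocks and Brauer pairs are
  transported along both by the same lemmas.
\<close>

definition twist :: "('l \<Rightarrow> 'l) \<Rightarrow> 'g \<Rightarrow> ('g \<Rightarrow> 'l) \<Rightarrow> ('g \<Rightarrow> 'l)"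
  where "twist \<gamma> x a = (\<lambda>g. if g \<in> carrier G then \<gamma> (a (grp.cj (inv\<^bsub>G\<^esub> x) g)) else \<zero>)"

lemma id_iso: "(\<lambda>c. c) \<in> ring_iso k k"
  by (auto intro!: ring_iso_memI simp: bij_betw_def)

lemma isoD:
  assumes "\<gamma> \<in> ring_iso k k"
  shows "c \<in> carrier k \<Longrightarrow> \<gamma> c \<in> carrier k" "\<gamma> \<zero> = \<zero>" "\<gamma> \<one> = \<one>"
    "c \<in> carrier k \<Longrightarrow> d \<in> carrier k \<Longrightarrow> \<gamma> (c \<oplus> d) = \<gamma> c \<oplus> \<gamma> d"
    "c \<in> carrier k \<Longrightarrow> d \<in> carrier k \<Longrightarrow> \<gamma> (c \<otimes> d) = \<gamma> c \<otimes> \<gamma> d"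
    "(\<And>s. s \<in> S \<Longrightarrow> f s \<in> carrier k) \<Longrightarrow> \<gamma> (\<Oplus>s\<in>S. f s) = (\<Oplus>s\<in>S. \<gamma> (f s))"
proof -
  have h: "\<gamma> \<in> ring_hom k k" using assms by (simp add: ring_iso_def)
  interpret h: ring_hom_cring k k \<gamma>
    by (intro ring_hom_cringI h is_cring)
  show "\<gamma> \<zero> = \<zero>" "\<gamma> \<one> = \<one>" by simp_all
  show "(\<And>s. s \<in> S \<Longrightarrow> f s \<in> carrier k) \<Longrightarrow> \<gamma> (\<Oplus>s\<in>S. f s) = (\<Oplus>s\<in>S. \<gamma> (f s))"
    using h.hom_finsum[of f S] by (simp add: Pi_def comp_def)
qed (rule ring_iso_memE[OF assms]; assumption)+

lemma iso_inverse:
  assumes "\<gamma> \<in> ring_iso k k"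
  shows "\<exists>\<delta>\<in>ring_iso k k. (\<forall>c\<in>carrier k. \<delta> (\<gamma> c) = c \<and> \<gamma> (\<delta> c) = c)"
proof
  show "inv_into (carrier k) \<gamma> \<in> ring_iso k k" using ring_iso_set_sym[OF ring_axioms assms] .
  have "bij_betw \<gamma> (carrier k) (carrier k)" using assms by (rule ring_iso_memE(5))
  then show "\<forall>c\<in>carrier k. inv_into (carrier k) \<gamma> (\<gamma> c) = c \<and> \<gamma> (inv_into (carrier k) \<gamma> c) = c"
    by (simp add: bij_betw_inv_into_left bij_betw_inv_into_right)
qed

lemma twist_apply: "g \<in> carrier G \<Longrightarrow> twist \<gamma> x a g = \<gamma> (a (grp.cj (inv\<^bsub>G\<^esub> x) g))"
  by (simp add: twist_def)

lemma twist_off: "g \<notin> carrier G \<Longrightarrow> twist \<gamma> x a g = \<zero>"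
  by (simp add: twist_def)

lemma twist_closed [simp]: "\<gamma> \<in> ring_iso k k \<Longrightarrow> x \<in> carrier G \<Longrightarrow> a \<in> AC \<Longrightarrow> twist \<gamma> x a \<in> AC"
  by (intro AC_I) (auto simp: twist_def isoD)

lemma twist_cong:
  "(\<And>c. c \<in> carrier k \<Longrightarrow> \<gamma> c = \<delta> c) \<Longrightarrow> a \<in> AC \<Longrightarrow> twist \<gamma> x a = twist \<delta> x a"
  by (auto simp: twist_def)

lemma twist_twist:
  assumes "x \<in> carrier G" "y \<in> carrier G"
  shows "twist \<gamma> x (twist \<delta> y a) = twist (\<lambda>c. \<gamma> (\<delta> c)) (x \<cdot> y) a"
  using assms by (auto simp: twist_def grp.inv_mult_group grp.cj_mult)

lemma twist_one: "a \<in> AC \<Longrightarrow> twist (\<lambda>c. c) \<one>\<^bsub>G\<^esub> a = a"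
  by (auto simp: twist_def AC_off)

lemma twist_inverse:
  assumes "\<gamma> \<in> ring_iso k k" "x \<in> carrier G"
  obtains \<delta> where "\<delta> \<in> ring_iso k k" "\<And>a. a \<in> AC \<Longrightarrow> twist \<delta> (inv\<^bsub>G\<^esub> x) (twist \<gamma> x a) = a"
    "\<And>a. a \<in> AC \<Longrightarrow> twist \<gamma> x (twist \<delta> (inv\<^bsub>G\<^esub> x) a) = a"
proof -
  obtain \<delta> where d: "\<delta> \<in> ring_iso k k" "\<And>c. c \<in> carrier k \<Longrightarrow> \<delta> (\<gamma> c) = c \<and> \<gamma> (\<delta> c) = c"
    using iso_inverse[OF assms(1)] by auto
  have "twist \<delta> (inv\<^bsub>G\<^esub> x) (twist \<gamma> x a) = a" "twist \<gamma> x (twist \<delta> (inv\<^bsub>G\<^esub> x) a) = a" if a: "a \<in> AC" for a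
    using assms d a twist_cong[of "\<lambda>c. \<delta> (\<gamma> c)" "\<lambda>c. c" a] twist_cong[of "\<lambda>c. \<gamma> (\<delta> c)" "\<lambda>c. c" a]
    by (simp_all add: twist_twist twist_one)
  then show ?thesis using that d by blast
qed

lemma twist_zero: "\<gamma> \<in> ring_iso k k \<Longrightarrow> twist \<gamma> x \<zero>\<^sub>A = \<zero>\<^sub>A"
  by (auto simp: twist_def zero_eq isoD)

lemma twist_add: "\<gamma> \<in> ring_iso k k \<Longrightarrow> a \<in> AC \<Longrightarrow> b \<in> AC \<Longrightarrow> twist \<gamma> x (a \<boxplus> b) = twist \<gamma> x a \<boxplus> twist \<gamma> x b"
  by (auto simp: twist_def add_fun isoD)

lemma twist_mult:
  assumes \<gamma>: "\<gamma> \<in> ring_iso k k" and x: "x \<in> carrier G" and a: "a \<in> AC" and b: "b \<in> AC"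
  shows "twist \<gamma> x (a \<star> b) = twist \<gamma> x a \<star> twist \<gamma> x b"
proof
  fix g
  show "twist \<gamma> x (a \<star> b) g = (twist \<gamma> x a \<star> twist \<gamma> x b) g"
  proof (cases "g \<in> carrier G")
    case g: True
    let ?c = "grp.cj (inv\<^bsub>G\<^esub> x)"
    have "twist \<gamma> x (a \<star> b) g = \<gamma> (\<Oplus>h\<in>carrier G. a h \<otimes> b (inv\<^bsub>G\<^esub> h \<cdot> ?c g))"
      using g x by (simp add: twist_apply mult_apply)
    also have "\<dots> = (\<Oplus>h\<in>carrier G. \<gamma> (a h \<otimes> b (inv\<^bsub>G\<^esub> h \<cdot> ?c g)))"
      using a b by (intro isoD(6)[OF \<gamma>]) auto
    also have "\<dots> = (\<Oplus>h\<in>carrier G. \<gamma> (a (?c h) \<otimes> b (inv\<^bsub>G\<^esub> (?c h) \<cdot> ?c g)))"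
      using \<gamma> a b x by (intro finsum_bij bij_cj) (auto simp: isoD)
    also have "\<dots> = (\<Oplus>h\<in>carrier G. twist \<gamma> x a h \<otimes> twist \<gamma> x b (inv\<^bsub>G\<^esub> h \<cdot> g))"
    proof (rule finsum_cong')
      fix h assume h: "h \<in> carrier G"
      have "inv\<^bsub>G\<^esub> (?c h) \<cdot> ?c g = ?c (inv\<^bsub>G\<^esub> h \<cdot> g)" using h g x by (simp add: grp.cj_hom grp.cj_inv)
      then show "\<gamma> (a (?c h) \<otimes> b (inv\<^bsub>G\<^esub> (?c h) \<cdot> ?c g)) = twist \<gamma> x a h \<otimes> twist \<gamma> x b (inv\<^bsub>G\<^esub> h \<cdot> g)"
        using \<gamma> a b x g h by (simp add: isoD twist_apply)
    qed (use \<gamma> x a b in auto)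
    finally show ?thesis using g by (simp add: mult_apply)
  qed (simp add: twist_off mult_off)
qed

lemma twist_inj: "\<gamma> \<in> ring_iso k k \<Longrightarrow> x \<in> carrier G \<Longrightarrow> a \<in> AC \<Longrightarrow> b \<in> AC \<Longrightarrow>
    twist \<gamma> x a = twist \<gamma> x b \<Longrightarrow> a = b"
  by (metis twist_inverse)

lemma twist_eq_zero: "\<gamma> \<in> ring_iso k k \<Longrightarrow> x \<in> carrier G \<Longrightarrow> a \<in> AC \<Longrightarrow> twist \<gamma> x a = \<zero>\<^sub>A \<longleftrightarrow> a = \<zero>\<^sub>A"
  using twist_inj[of \<gamma> x a "\<zero>\<^sub>A"] by (auto simp: twist_zero)

lemma twist_kH:
  assumes "\<gamma> \<in> ring_iso k k" "x \<in> carrier G" "H \<subseteq> carrier G" "a \<in> kH H"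
  shows "twist \<gamma> x a \<in> kH (grp.cj x ` H)"
proof -
  have a: "a \<in> AC" "\<And>g. g \<notin> H \<Longrightarrow> a g = \<zero>" using assms by (auto simp: kH_iff)
  have "twist \<gamma> x a g = \<zero>" if "g \<notin> grp.cj x ` H" for g
  proof (cases "g \<in> carrier G")
    case True
    then have "grp.cj (inv\<^bsub>G\<^esub> x) g \<notin> H" using that assms grp.cj_cancel(1) by (metis imageI)
    then show ?thesis using True a assms(1) by (simp add: twist_apply isoD)
  qed (simp add: twist_off)
  moreover have "grp.cj x ` H \<subseteq> carrier G" using assms by auto
  ultimately show ?thesis using a assms by (auto simp: kH_iff)
qed

lemma group_elem_closed: "x \<in> H \<Longrightarrow> H \<subseteq> carrier G \<Longrightarrow> group_elem k x \<in> kH H"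
  by (auto simp: kH_iff group_elem_def intro!: AC_I)

lemma group_elem_mult:
  assumes x: "x \<in> carrier G" and a: "a \<in> AC" and g: "g \<in> carrier G"
  shows "(group_elem k x \<star> a) g = a (inv\<^bsub>G\<^esub> x \<cdot> g)" "(a \<star> group_elem k x) g = a (g \<cdot> inv\<^bsub>G\<^esub> x)"
proof -
  have "(group_elem k x \<star> a) g = group_elem k x x \<otimes> a (inv\<^bsub>G\<^esub> x \<cdot> g)"
    unfolding mult_apply[OF g] using a x fin by (intro finsum_delta) (auto simp: group_elem_def)
  then show "(group_elem k x \<star> a) g = a (inv\<^bsub>G\<^esub> x \<cdot> g)" using a by (simp add: group_elem_def)
  have *: "inv\<^bsub>G\<^esub> h \<cdot> g = x \<longleftrightarrow> h = g \<cdot> inv\<^bsub>G\<^esub> x" if "h \<in> carrier G" for h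
    using that g x by (metis grp.inv_solve_left grp.inv_solve_right grp.m_closed)
  have "(a \<star> group_elem k x) g = a (g \<cdot> inv\<^bsub>G\<^esub> x) \<otimes> group_elem k x (inv\<^bsub>G\<^esub> (g \<cdot> inv\<^bsub>G\<^esub> x) \<cdot> g)"
    unfolding mult_apply[OF g] using a x g fin *
    by (intro finsum_delta) (auto simp: group_elem_def)
  then show "(a \<star> group_elem k x) g = a (g \<cdot> inv\<^bsub>G\<^esub> x)"
    using a x g *[of "g \<cdot> inv\<^bsub>G\<^esub> x"] by (simp add: group_elem_def)
qed

lemma conj_elem_eq: "x \<in> carrier G \<Longrightarrow> a \<in> AC \<Longrightarrow> conj_elem k G x a = twist (\<lambda>c. c) x a"
proof
  fix g assume x: "x \<in> carrier G" "a \<in> AC"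
  have "group_elem k x \<in> AC" using group_elem_closed[of x "carrier G"] x by simp
  then have "group_elem k x \<star> a \<in> AC" using x by simp
  then show "conj_elem k G x a g = twist (\<lambda>c. c) x a g"
    using x by (cases "g \<in> carrier G")
      (auto simp: conj_elem_def twist_def mult_off group_elem_mult grp.cj_def grp.m_assoc)
qed


subsection \<open>Fixed points and the Brauer map\<close>

text \<open>
  A non-trivial orbit contributes its size, which is divisible by \<open>p\<close>, times a common value.
\<close>

lemma sum_fixed_points:
  assumes "grp.p_subgroup p H" "grp.acts H f X" "finite X" "\<And>x. x \<in> X \<Longrightarrow> \<phi> x \<in> carrier k"
    "\<And>h x. h \<in> H \<Longrightarrow> x \<in> X \<Longrightarrow> \<phi> (f h x) = \<phi> x"
  shows "(\<Oplus>x\<in>X. \<phi> x) = (\<Oplus>x\<in>{x \<in> X. \<forall>h\<in>H. f h x = x}. \<phi> x)"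
  using prime_p assms(1-3)
proof (induction rule: grp.p_group_action_induct)
  case (fixed Y)
  then have "{x \<in> Y. \<forall>h\<in>H. f h x = x} = Y" by auto
  then show ?case by simp
next
  case (orbit Y x)
  let ?O = "(\<lambda>h. f h x) ` H"
  have OX: "?O \<subseteq> X" using assms(2) orbit.hyps(2) by (auto simp: grp.acts_def)
  have f: "finite ?O" "finite Y" using OX orbit.hyps(1) assms(3) finite_subset by blast+
  have "(\<Oplus>x\<in>Y \<union> ?O. \<phi> x) = (\<Oplus>x\<in>Y. \<phi> x) \<oplus> (\<Oplus>x\<in>?O. \<phi> x)"
    using f orbit.hyps(1,3) OX assms(4) by (intro finsum_Un_disjoint) auto
  also have "(\<Oplus>y\<in>?O. \<phi> y) = (\<Oplus>y\<in>?O. \<phi> x)"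
    using assms(4,5) orbit.hyps(2) by (intro finsum_cong') auto
  also have "\<dots> = \<zero>"
    using orbit.hyps(2,4) assms(4) ring_char by (intro finsum_const_char_dvd) auto
  also have "(\<Oplus>x\<in>Y. \<phi> x) \<oplus> \<zero> = (\<Oplus>x\<in>Y. \<phi> x)"
    using orbit.hyps(1) assms(4) by (auto intro!: r_zero finsum_closed)
  finally show ?case
  proof -
    assume s: "(\<Oplus>x\<in>Y \<union> ?O. \<phi> x) = (\<Oplus>x\<in>Y. \<phi> x)"
    have "{y \<in> Y \<union> ?O. \<forall>h\<in>H. f h y = y} = {y \<in> Y. \<forall>h\<in>H. f h y = y}"
      using orbit.hyps(5) by fastforce
    then show ?thesis using s orbit.IH by simp
  qed
qed

text \<open>
  The carrier of \<open>(kG)\<^sup>P\<close>, in terms of coefficients.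
\<close>

definition fixA :: "'g set \<Rightarrow> ('g \<Rightarrow> 'l) set"
  where "fixA P = {a \<in> AC. \<forall>x\<in>P. \<forall>g\<in>carrier G. a (grp.cj x g) = a g}"

abbreviation Br where "Br \<equiv> brauer_hom k G"
abbreviation C where "C \<equiv> centralizer G"

lemma fixA_D: "a \<in> fixA P \<Longrightarrow> a \<in> AC" "a \<in> fixA P \<Longrightarrow> x \<in> P \<Longrightarrow> g \<in> carrier G \<Longrightarrow> a (grp.cj x g) = a g"
  by (auto simp: fixA_def)

lemma fixA_mono: "Q \<subseteq> P \<Longrightarrow> fixA P \<subseteq> fixA Q"
  by (auto simp: fixA_def)

lemma twist_id_eq_iff:
  assumes "x \<in> carrier G" "a \<in> AC"
  shows "twist (\<lambda>c. c) x a = a \<longleftrightarrow> (\<forall>g\<in>carrier G. a (grp.cj x g) = a g)"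
proof
  assume *: "twist (\<lambda>c. c) x a = a"
  show "\<forall>g\<in>carrier G. a (grp.cj x g) = a g"
  proof
    fix g assume g: "g \<in> carrier G"
    then show "a (grp.cj x g) = a g"
      using fun_cong[OF *, of "grp.cj x g"] assms by (simp add: twist_apply)
  qed
next
  assume *: "\<forall>g\<in>carrier G. a (grp.cj x g) = a g"
  show "twist (\<lambda>c. c) x a = a"
  proof
    fix g
    show "twist (\<lambda>c. c) x a g = a g"
      using assms *[rule_format, of "grp.cj (inv\<^bsub>G\<^esub> x) g"]
      by (cases "g \<in> carrier G") (auto simp: twist_def AC_off)
  qed
qed

lemma fixA_twist: "P \<subseteq> carrier G \<Longrightarrow> fixA P = {a \<in> AC. \<forall>x\<in>P. twist (\<lambda>c. c) x a = a}"
  using twist_id_eq_iff by (auto simp: fixA_def)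

lemma fixed_algebra_eq: "P \<subseteq> carrier G \<Longrightarrow> fixed_algebra k G P = A\<lparr>carrier := fixA P\<rparr>"
  unfolding fixed_algebra_def fixA_twist
  by (rule arg_cong[where f = "\<lambda>B. A\<lparr>carrier := B\<rparr>"]) (auto simp: conj_elem_eq subset_iff)

lemma subalg_fixA:
  assumes "P \<subseteq> carrier G"
  shows "subalg (fixA P)"
proof -
  have "a \<star> b \<in> fixA P" if "a \<in> fixA P" "b \<in> fixA P" for a b
    using that assms unfolding fixA_twist[OF assms] by (auto simp: twist_mult id_iso)
  then show ?thesis
    by (auto simp: subalg_def fixA_def add_apply zero_apply) (auto simp: smul_def)
qed

lemma cj_in_centralizer:
  assumes "x \<in> carrier G" "P \<subseteq> carrier G" "grp.cj x ` P = P" "g \<in> carrier G"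
  shows "grp.cj x g \<in> C P \<longleftrightarrow> g \<in> C P"
  using grp.cj_centralizer_iff[of x P g] assms by simp

lemma centralizer_carrier: "C P \<subseteq> carrier G"
  by (auto simp: centralizer_def)

lemma in_kC: "P \<subseteq> carrier G \<Longrightarrow> a \<in> kH (C P) \<longleftrightarrow> a \<in> AC \<and> (\<forall>g. g \<notin> C P \<longrightarrow> a g = \<zero>)"
  using kH_iff[OF centralizer_carrier] by simp

lemma kC_AC: "a \<in> kH (C P) \<Longrightarrow> a \<in> AC"
  using kH_iff[OF centralizer_carrier] by simp

lemma kC_fixA:
  assumes P: "subgroup P G"
  shows "kH (C P) \<subseteq> fixA P"
proof
  fix a assume a: "a \<in> kH (C P)"
  have PG: "P \<subseteq> carrier G" using P by (rule subgroup.subset)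
  have "a (grp.cj x g) = a g" if x: "x \<in> P" "g \<in> carrier G" for x g
  proof (cases "g \<in> C P")
    case True
    then show ?thesis using x PG by (simp add: grp.in_centralizer_iff_cj(1))
  next
    case False
    then have "grp.cj x g \<notin> C P"
      using cj_in_centralizer[of x P g] grp.cj_image_self[OF P] x PG by auto
    then show ?thesis using a False PG by (auto simp: in_kC)
  qed
  then show "a \<in> fixA P" using a by (auto simp: fixA_def kC_AC)
qed

lemma subgroup_C: "P \<subseteq> carrier G \<Longrightarrow> subgroup (C P) G"
  by (rule grp.centralizer_subgroup)

lemma kC_mono: "Q \<subseteq> P \<Longrightarrow> kH (C P) \<subseteq> kH (C Q)"
  by (intro kH_mono grp.centralizer_mono centralizer_carrier)

lemma Br_apply: "Br Q a g = (if g \<in> C Q then a g else \<zero>)"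
  by (simp add: brauer_hom_def)

lemma Br_in_kC: "a \<in> AC \<Longrightarrow> Br Q a \<in> kH (C Q)"
  unfolding kH_iff[OF centralizer_carrier]
  by (auto simp: Br_apply AC_off intro!: AC_I)

lemma Br_AC [simp]: "a \<in> AC \<Longrightarrow> Br Q a \<in> AC"
  using Br_in_kC kC_AC by blast

lemma Br_kC: "a \<in> kH (C Q) \<Longrightarrow> Br Q a = a"
  unfolding kH_iff[OF centralizer_carrier] by (auto simp: Br_apply)

lemma Br_Br: "Q \<subseteq> P \<Longrightarrow> Br P (Br Q a) = Br P a"
  using grp.centralizer_mono[of Q P] by (auto simp: Br_apply fun_eq_iff)

lemma Br_add: "Br Q (a \<boxplus> b) = Br Q a \<boxplus> Br Q b"
  by (auto simp: Br_apply add_fun fun_eq_iff)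

lemma Br_zero: "Br Q \<zero>\<^sub>A = \<zero>\<^sub>A"
  by (auto simp: Br_apply zero_eq fun_eq_iff)

lemma Br_minus: "a \<in> AC \<Longrightarrow> b \<in> AC \<Longrightarrow> Br Q (a \<boxminus> b) = Br Q a \<boxminus> Br Q b"
  by (auto simp: Br_apply minus_apply fun_eq_iff) (simp add: a_minus_def)

lemma Br_fixA:
  assumes "Q \<subseteq> carrier G" "P \<subseteq> carrier G" "a \<in> fixA P"
  shows "Br Q a \<in> fixA (grp.normalizer P Q)"
proof -
  have "Br Q a (grp.cj x g) = Br Q a g" if "x \<in> P" "grp.cj x ` Q = Q" "g \<in> carrier G" for x g
    using cj_in_centralizer[of x Q g] that assms fixA_D(2)[OF assms(3)] by (auto simp: Br_apply)
  then show ?thesis using fixA_D(1)[OF assms(3)] by (auto simp: fixA_def grp.normalizer_def)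
qed

lemma Br_twist:
  assumes "\<gamma> \<in> ring_iso k k" "x \<in> carrier G" "Q \<subseteq> carrier G" "a \<in> AC"
  shows "twist \<gamma> x (Br Q a) = Br (grp.cj x ` Q) (twist \<gamma> x a)"
proof
  fix g
  show "twist \<gamma> x (Br Q a) g = Br (grp.cj x ` Q) (twist \<gamma> x a) g"
  proof (cases "g \<in> carrier G")
    case True
    have "g \<in> C (grp.cj x ` Q) \<longleftrightarrow> grp.cj (inv\<^bsub>G\<^esub> x) g \<in> C Q"
      using grp.cj_centralizer_iff[of x Q "grp.cj (inv\<^bsub>G\<^esub> x) g"] True assms by simp
    then show ?thesis using True assms by (simp add: Br_apply twist_apply isoD)
  next
    case False
    then have "g \<notin> C (grp.cj x ` Q)" by (simp add: centralizer_def)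
    then show ?thesis using False by (simp add: Br_apply twist_off)
  qed
qed

text \<open>
  The coefficient of \<open>a \<star> b\<close> at \<open>g\<close> is a sum over the factorizations of \<open>g\<close>; those not fixed by
  \<open>Q\<close> cancel.
\<close>

lemma Br_mult:
  assumes Q: "grp.p_subgroup p Q" and a: "a \<in> fixA Q" and b: "b \<in> fixA Q"
  shows "Br Q (a \<star> b) = Br Q a \<star> Br Q b"
proof
  fix g
  have Qs: "subgroup Q G" using Q by (simp add: grp.p_subgroup_def)
  have QG: "Q \<subseteq> carrier G" using Qs by (rule subgroup.subset)
  have ab: "a \<in> AC" "b \<in> AC" using a b by (auto simp: fixA_D)
  show "Br Q (a \<star> b) g = (Br Q a \<star> Br Q b) g"
  proof (cases "g \<in> C Q")
    case g: True
    then have gG: "g \<in> carrier G" using centralizer_carrier by auto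
    have act: "grp.acts Q grp.cj (carrier G)"
      using QG by (auto simp: grp.acts_def grp.cj_mult subset_iff)
    let ?t = "\<lambda>h. a h \<otimes> b (inv\<^bsub>G\<^esub> h \<cdot> g)"
    have "(a \<star> b) g = (\<Oplus>h\<in>carrier G. ?t h)" using gG by (simp add: mult_apply)
    also have "\<dots> = (\<Oplus>h\<in>{h \<in> carrier G. \<forall>q\<in>Q. grp.cj q h = h}. ?t h)"
    proof (rule sum_fixed_points[OF Q act fin])
      fix q h assume q: "q \<in> Q" and h: "h \<in> carrier G"
      have qG: "q \<in> carrier G" using q QG by auto
      have "inv\<^bsub>G\<^esub> (grp.cj q h) \<cdot> g = grp.cj q (inv\<^bsub>G\<^esub> h \<cdot> g)"
        using g q h qG gG QG by (simp add: grp.cj_hom grp.cj_inv grp.in_centralizer_iff_cj(1))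
      then show "?t (grp.cj q h) = ?t h"
        using fixA_D(2)[OF a q] fixA_D(2)[OF b q] h gG by simp
    qed (use ab in auto)
    also have "{h \<in> carrier G. \<forall>q\<in>Q. grp.cj q h = h} = C Q"
      using grp.in_centralizer_iff_cj(1)[OF QG] centralizer_carrier by blast
    also have "(\<Oplus>h\<in>C Q. ?t h) = (\<Oplus>h\<in>C Q. Br Q a h \<otimes> Br Q b (inv\<^bsub>G\<^esub> h \<cdot> g))"
    proof (rule finsum_cong')
      fix h assume h: "h \<in> C Q"
      then have "inv\<^bsub>G\<^esub> h \<cdot> g \<in> C Q"
        using g subgroup_C[OF QG] by (simp add: subgroup.m_closed subgroup.m_inv_closed)
      then show "?t h = Br Q a h \<otimes> Br Q b (inv\<^bsub>G\<^esub> h \<cdot> g)" using h by (simp add: Br_apply)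
    qed (use ab in auto)
    also have "\<dots> = (\<Oplus>h\<in>carrier G. Br Q a h \<otimes> Br Q b (inv\<^bsub>G\<^esub> h \<cdot> g))"
      using ab centralizer_carrier fin
      by (intro finsum_mono_neutral[symmetric]) (auto simp: Br_apply[of Q a])
    also have "\<dots> = (Br Q a \<star> Br Q b) g" using gG by (simp add: mult_apply)
    finally show ?thesis using g by (simp add: Br_apply)
  next
    case False
    have "Br Q a \<star> Br Q b \<in> kH (C Q)"
      using ab by (intro kH_mult_closed subgroup_C QG Br_in_kC)
    then show ?thesis using False QG by (auto simp: Br_apply in_kC)
  qed
qed


subsection \<open>Centres\<close>

definition Zc :: "'g set \<Rightarrow> ('g \<Rightarrow> 'l) set"
  where "Zc H = {z \<in> kH H. \<forall>a\<in>kH H. z \<star> a = a \<star> z}"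

lemma Zc_D: "z \<in> Zc H \<Longrightarrow> z \<in> kH H" "z \<in> Zc H \<Longrightarrow> a \<in> kH H \<Longrightarrow> z \<star> a = a \<star> z"
  by (auto simp: Zc_def)

lemma subalg_Zc:
  assumes H: "subgroup H G"
  shows "subalg (Zc H)"
proof -
  note B = subalg_kH[OF H]
  have AC: "a \<in> AC" if "a \<in> kH H" for a using subalgD(1)[OF B that] .
  show ?thesis unfolding subalg_def
  proof (intro conjI ballI)
    show "Zc H \<subseteq> AC" using AC by (auto simp: Zc_def)
    show "\<zero>\<^sub>A \<in> Zc H" using AC subalgD(2)[OF B] by (simp add: Zc_def)
    fix y z assume y: "y \<in> Zc H" and z: "z \<in> Zc H"
    have yz: "y \<in> kH H" "z \<in> kH H" using y z by (auto simp: Zc_def)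
    have "(y \<boxplus> z) \<star> a = a \<star> (y \<boxplus> z)" if "a \<in> kH H" for a
      using AC[OF that] AC yz Zc_D(2)[OF y that] Zc_D(2)[OF z that] by (simp add: A.l_distr A.r_distr)
    then show "y \<boxplus> z \<in> Zc H" using yz subalgD(3)[OF B] by (simp add: Zc_def)
    have "(y \<star> z) \<star> a = a \<star> (y \<star> z)" if "a \<in> kH H" for a
      using AC[OF that] AC yz Zc_D(2)[OF y that] Zc_D(2)[OF z that]
      by (metis A.m_assoc)
    then show "y \<star> z \<in> Zc H" using yz subalgD(4)[OF B] by (simp add: Zc_def)
  next
    fix c z assume c: "c \<in> carrier k" and z: "z \<in> Zc H"
    have zH: "z \<in> kH H" using z by (auto simp: Zc_def)
    have "smul c z \<star> a = a \<star> smul c z" if "a \<in> kH H" for a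
      using c AC[OF that] AC[OF zH] Zc_D(2)[OF z that] by (simp add: smul_mult)
    then show "smul c z \<in> Zc H" using c zH subalgD(5)[OF B] by (simp add: Zc_def)
  qed
qed

lemma one_Zc: "subgroup H G \<Longrightarrow> \<one>\<^sub>A \<in> Zc H"
  using subalgD(1)[OF subalg_kH] by (simp add: Zc_def one_kH)

lemma Zc_twist_self:
  assumes "subgroup H G" "x \<in> H" "z \<in> Zc H"
  shows "twist (\<lambda>c. c) x z = z"
proof -
  have HG: "H \<subseteq> carrier G" using assms by (simp add: subgroup.subset)
  have xG: "x \<in> carrier G" using assms HG by auto
  have e: "group_elem k x \<in> kH H" "group_elem k (inv\<^bsub>G\<^esub> x) \<in> kH H"
    using assms HG by (auto intro!: group_elem_closed subgroup.m_inv_closed)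
  have z: "z \<in> AC" "group_elem k x \<in> AC" "group_elem k (inv\<^bsub>G\<^esub> x) \<in> AC"
    using assms e by (auto simp: Zc_def intro: subalgD(1)[OF subalg_kH])
  have inverse: "group_elem k x \<star> group_elem k (inv\<^bsub>G\<^esub> x) = \<one>\<^sub>A"
  proof
    fix g
    show "(group_elem k x \<star> group_elem k (inv\<^bsub>G\<^esub> x)) g = \<one>\<^sub>A g"
    proof (cases "g \<in> carrier G")
      case True
      have "(group_elem k x \<star> group_elem k (inv\<^bsub>G\<^esub> x)) g = group_elem k (inv\<^bsub>G\<^esub> x) (inv\<^bsub>G\<^esub> x \<cdot> g)"
        using group_elem_mult(1) xG z True by blast
      then show ?thesis using True xG by (simp add: group_elem_def one_apply)
    next
      case False
      then show ?thesis using grp.one_closed by (auto simp: mult_off one_apply)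
    qed
  qed
  have "twist (\<lambda>c. c) x z = z \<star> group_elem k x \<star> group_elem k (inv\<^bsub>G\<^esub> x)"
    using conj_elem_eq[OF xG z(1)] Zc_D(2)[OF assms(3) e(1)] by (simp add: conj_elem_def)
  also have "\<dots> = z" using z inverse by (simp add: A.m_assoc)
  finally show ?thesis .
qed

text \<open>
  The centre of \<open>kH\<close> consists of the class functions: a central element commutes with the elements of
  \<open>H\<close>; conversely, conjugation by \<open>h\<close> carries \<open>h\<inverse> g\<close> to \<open>g h\<inverse>\<close>, which matches the terms of the two
  convolutions.
\<close>

lemma Zc_eq:
  assumes H: "subgroup H G"
  shows "Zc H = kH H \<inter> fixA H"
proof
  have HG: "H \<subseteq> carrier G" using H by (rule subgroup.subset)
  show "Zc H \<subseteq> kH H \<inter> fixA H"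
    using Zc_twist_self[OF H] fixA_twist[OF HG] subalgD(1)[OF subalg_kH[OF H]] by (auto dest: Zc_D)
  show "kH H \<inter> fixA H \<subseteq> Zc H"
  proof
    fix z assume z: "z \<in> kH H \<inter> fixA H"
    then have zA: "z \<in> AC" by (auto dest: fixA_D)
    have "z \<star> a = a \<star> z" if aH: "a \<in> kH H" for a
    proof
      have a: "a \<in> AC" "\<And>h. h \<notin> H \<Longrightarrow> a h = \<zero>" using aH HG by (auto simp: kH_iff)
      fix g
      show "(z \<star> a) g = (a \<star> z) g"
      proof (cases "g \<in> carrier G")
        case g: True
        have "(z \<star> a) g = (\<Oplus>h\<in>carrier G. z h \<otimes> a (inv\<^bsub>G\<^esub> h \<cdot> g))" using g by (simp add: mult_apply)
        also have "\<dots> = (\<Oplus>h\<in>carrier G. z (g \<cdot> inv\<^bsub>G\<^esub> h) \<otimes> a (inv\<^bsub>G\<^esub> (g \<cdot> inv\<^bsub>G\<^esub> h) \<cdot> g))"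
          using g zA a(1) by (intro finsum_bij bij_inv_mult) auto
        also have "\<dots> = (\<Oplus>h\<in>carrier G. a h \<otimes> z (inv\<^bsub>G\<^esub> h \<cdot> g))"
        proof (rule finsum_cong')
          fix h assume h: "h \<in> carrier G"
          have e: "inv\<^bsub>G\<^esub> (g \<cdot> inv\<^bsub>G\<^esub> h) \<cdot> g = h" using h g by (simp add: grp.inv_mult_group grp.m_assoc)
          show "z (g \<cdot> inv\<^bsub>G\<^esub> h) \<otimes> a (inv\<^bsub>G\<^esub> (g \<cdot> inv\<^bsub>G\<^esub> h) \<cdot> g) = a h \<otimes> z (inv\<^bsub>G\<^esub> h \<cdot> g)"
          proof (cases "h \<in> H")
            case True
            have "grp.cj h (inv\<^bsub>G\<^esub> h \<cdot> g) = g \<cdot> inv\<^bsub>G\<^esub> h" using h g by (simp add: grp.cj_def)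
            then have "z (g \<cdot> inv\<^bsub>G\<^esub> h) = z (inv\<^bsub>G\<^esub> h \<cdot> g)"
              using fixA_D(2)[of z H h "inv\<^bsub>G\<^esub> h \<cdot> g"] z True h g by simp
            then show ?thesis using e zA a(1) by (simp add: m_comm)
          next
            case False
            then show ?thesis using e zA a by simp
          qed
        qed (use zA a in auto)
        finally show ?thesis using g by (simp add: mult_apply)
      qed (simp add: mult_off)
    qed
    then show "z \<in> Zc H" using z by (simp add: Zc_def)
  qed
qed

lemma Zc_carrier: "Zc (carrier G) = fixA (carrier G)"
  using Zc_eq[OF grp.subgroup_self] by (auto simp: fixA_def)

lemma twist_Zc:
  assumes "\<gamma> \<in> ring_iso k k" "x \<in> carrier G" "H \<subseteq> carrier G" "z \<in> Zc H"
  shows "twist \<gamma> x z \<in> Zc (grp.cj x ` H)"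
proof -
  have z: "z \<in> kH H" "z \<in> AC" using assms by (auto simp: Zc_def kH_iff)
  obtain \<delta> where d: "\<delta> \<in> ring_iso k k" "\<And>a. a \<in> AC \<Longrightarrow> twist \<gamma> x (twist \<delta> (inv\<^bsub>G\<^esub> x) a) = a"
    using twist_inverse[OF assms(1,2)] by metis
  have "twist \<gamma> x z \<star> a = a \<star> twist \<gamma> x z" if a: "a \<in> kH (grp.cj x ` H)" for a
  proof -
    have xH: "grp.cj x ` H \<subseteq> carrier G" using assms by auto
    then have aA: "a \<in> AC" using a by (simp add: kH_iff)
    define a' where "a' = twist \<delta> (inv\<^bsub>G\<^esub> x) a"
    have "a' \<in> kH H" unfolding a'_def using twist_kH[OF d(1) _ xH a, of "inv\<^bsub>G\<^esub> x"] assms by simp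
    moreover have "a' \<in> AC" using d aA assms by (simp add: a'_def)
    moreover have "a = twist \<gamma> x a'" using d aA by (simp add: a'_def)
    ultimately show ?thesis using assms z Zc_D(2)[OF assms(4)] by (simp flip: twist_mult)
  qed
  then show ?thesis using twist_kH[OF assms(1-3) z(1)] by (auto simp: Zc_def)
qed

section \<open>Idempotents in subalgebras\<close>


abbreviation prim :: "('g \<Rightarrow> 'l) set \<Rightarrow> ('g \<Rightarrow> 'l) \<Rightarrow> bool"
  where "prim B i \<equiv> primitive_idempotent (A\<lparr>carrier := B\<rparr>) i"

lemma primitive_idempotent_cong:
  assumes c: "carrier R = carrier S" "\<zero>\<^bsub>R\<^esub> = \<zero>\<^bsub>S\<^esub>"
    "\<And>a b. a \<in> carrier S \<Longrightarrow> b \<in> carrier S \<Longrightarrow> a \<otimes>\<^bsub>R\<^esub> b = a \<otimes>\<^bsub>S\<^esub> b"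
    "\<And>a b. a \<in> carrier S \<Longrightarrow> b \<in> carrier S \<Longrightarrow> a \<oplus>\<^bsub>R\<^esub> b = a \<oplus>\<^bsub>S\<^esub> b"
  shows "primitive_idempotent R e \<longleftrightarrow> primitive_idempotent S e"
proof -
  have i: "idempotent_elem R j \<longleftrightarrow> idempotent_elem S j" for j
    using c by (auto simp: idempotent_elem_def)
  have d: "j \<otimes>\<^bsub>R\<^esub> j' = j \<otimes>\<^bsub>S\<^esub> j'" "j \<oplus>\<^bsub>R\<^esub> j' = j \<oplus>\<^bsub>S\<^esub> j'"
    if "idempotent_elem S j" "idempotent_elem S j'" for j j'
    using c that by (auto simp: idempotent_elem_def)
  show ?thesis unfolding primitive_idempotent_def i c(2) using d by metis
qed

lemma prim_iff:
  "prim B i \<longleftrightarrow> i \<in> B \<and> i \<star> i = i \<and> i \<noteq> \<zero>\<^sub>A \<and>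
    (\<forall>j\<in>B. \<forall>j'\<in>B. j \<star> j = j \<longrightarrow> j' \<star> j' = j' \<longrightarrow> j \<star> j' = \<zero>\<^sub>A \<longrightarrow> j' \<star> j = \<zero>\<^sub>A \<longrightarrow> i = j \<boxplus> j' \<longrightarrow>
      j = \<zero>\<^sub>A \<or> j' = \<zero>\<^sub>A)"
  unfolding primitive_idempotent_def idempotent_elem_def by auto

lemma primD: "prim B i \<Longrightarrow> i \<in> B" "prim B i \<Longrightarrow> i \<star> i = i" "prim B i \<Longrightarrow> i \<noteq> \<zero>\<^sub>A"
  by (auto simp: prim_iff)

lemma mult_minus:
  assumes "a \<in> AC" "b \<in> AC" "c \<in> AC"
  shows "(a \<boxminus> b) \<star> c = a \<star> c \<boxminus> b \<star> c" "c \<star> (a \<boxminus> b) = c \<star> a \<boxminus> c \<star> b"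
  using assms by (simp_all add: A.minus_eq A.l_distr A.r_distr A.l_minus A.r_minus)

lemma minus_self [simp]: "a \<in> AC \<Longrightarrow> a \<boxminus> a = \<zero>\<^sub>A"
  and minus_zero [simp]: "a \<in> AC \<Longrightarrow> a \<boxminus> \<zero>\<^sub>A = a"
  by (simp_all add: A.minus_eq A.r_neg)

lemma minus_eq_zero: "a \<in> AC \<Longrightarrow> b \<in> AC \<Longrightarrow> a \<boxminus> b = \<zero>\<^sub>A \<longleftrightarrow> a = b"
  using A.r_right_minus_eq by simp

lemma idem_complement:
  assumes "i \<in> AC" "j \<in> AC" "i \<star> i = i" "j \<star> j = j" "i \<star> j = j" "j \<star> i = j"
  shows "(i \<boxminus> j) \<star> (i \<boxminus> j) = i \<boxminus> j" "j \<star> (i \<boxminus> j) = \<zero>\<^sub>A" "(i \<boxminus> j) \<star> j = \<zero>\<^sub>A"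
    "i = j \<boxplus> (i \<boxminus> j)" "i \<star> (i \<boxminus> j) = i \<boxminus> j" "(i \<boxminus> j) \<star> i = i \<boxminus> j"
  using assms by (simp_all add: mult_minus) (simp add: A.minus_eq A.a_lcomm A.r_neg)

lemma prim_dichotomy:
  assumes B: "subalg B" and i: "prim B i" and j: "j \<in> B" "j \<star> j = j" "i \<star> j = j" "j \<star> i = j"
  shows "j = \<zero>\<^sub>A \<or> j = i"
proof -
  have ac: "i \<in> AC" "j \<in> AC" using subalgD(1)[OF B] primD(1)[OF i] j by auto
  note c = idem_complement[OF ac primD(2)[OF i] j(2-4)]
  have "i \<boxminus> j \<in> B" using subalgD(6)[OF B] primD(1)[OF i] j by simp
  then have "j = \<zero>\<^sub>A \<or> i \<boxminus> j = \<zero>\<^sub>A" using i j c unfolding prim_iff by blast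
  then show ?thesis using ac by (auto simp: minus_eq_zero)
qed

lemma corner_monoid:
  assumes B: "subalg B" and i: "i \<in> B" "i \<star> i = i"
  shows "monoid (A\<lparr>carrier := {a \<in> B. i \<star> a = a \<and> a \<star> i = a}, one := i\<rparr>)"
proof -
  have ac: "a \<in> AC" if "a \<in> B" for a using subalgD(1)[OF B that] .
  show ?thesis
  proof (rule monoidI)
    fix a b
    assume "a \<in> carrier (A\<lparr>carrier := {a \<in> B. i \<star> a = a \<and> a \<star> i = a}, one := i\<rparr>)"
      "b \<in> carrier (A\<lparr>carrier := {a \<in> B. i \<star> a = a \<and> a \<star> i = a}, one := i\<rparr>)"
    then have ab: "a \<in> B" "i \<star> a = a" "b \<in> B" "b \<star> i = b" by auto
    then show "a \<otimes>\<^bsub>A\<lparr>carrier := {a \<in> B. i \<star> a = a \<and> a \<star> i = a}, one := i\<rparr>\<^esub> b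
        \<in> carrier (A\<lparr>carrier := {a \<in> B. i \<star> a = a \<and> a \<star> i = a}, one := i\<rparr>)"
      using subalgD(4)[OF B] mult_assoc[of i a b] mult_assoc[of a b i] ac i by simp
  qed (use i ac in \<open>simp_all add: mult_assoc\<close>)
qed

text \<open>
  For a primitive idempotent \<open>i\<close> the algebra \<open>i B i\<close> is local. The powers of \<open>x\<close> are linearly
  dependent; from the lowest term of a dependence one reads off \<open>x\<^sup>m = x\<^sup>m\<^sup>+\<^sup>1 u\<close> for a polynomial \<open>u\<close> in
  \<open>x\<close>, and \<open>(x u)\<^sup>m\<close> is an idempotent. If it is \<open>i\<close>, then \<open>x\<close> is invertible; if it is zero, then
  \<open>x\<close> is nilpotent, so its image under \<open>\<phi>\<close> is a nilpotent idempotent and vanishes.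
\<close>

lemma primitive_corner_local:
  assumes B: "subalg B" and i: "prim B i" and x: "x \<in> B" "i \<star> x = x" "x \<star> i = x"
    and \<phi>: "\<And>a b. a \<in> B \<Longrightarrow> b \<in> B \<Longrightarrow> \<phi> (a \<star> b) = \<phi> a \<star> \<phi> b" "\<phi> \<zero>\<^sub>A = \<zero>\<^sub>A" "\<phi> x \<star> \<phi> x = \<phi> x"
  shows "\<phi> x = \<zero>\<^sub>A \<or> (\<exists>z\<in>B. x \<star> z = i)"
proof -
  define R where "R = A\<lparr>carrier := {a \<in> B. i \<star> a = a \<and> a \<star> i = a}, one := i\<rparr>"
  have iB: "i \<in> B" "i \<star> i = i" "i \<noteq> \<zero>\<^sub>A" using i by (simp_all add: primD)
  interpret M: monoid R unfolding R_def by (rule corner_monoid[OF B iB(1,2)])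
  have RC: "a \<in> carrier R \<longleftrightarrow> a \<in> B \<and> i \<star> a = a \<and> a \<star> i = a" for a by (simp add: R_def)
  have Rm: "a \<otimes>\<^bsub>R\<^esub> b = a \<star> b" for a b by (simp add: R_def)
  have R1: "\<one>\<^bsub>R\<^esub> = i" by (simp add: R_def)
  have ac: "a \<in> AC" if "a \<in> carrier R" for a using that subalgD(1)[OF B] by (simp add: RC)
  have xR: "x \<in> carrier R" using x by (simp add: RC)
  define X where "X n = x [^]\<^bsub>R\<^esub> (n::nat)" for n
  have XR: "X n \<in> carrier R" for n using xR by (simp add: X_def)
  have XA: "X n \<in> AC" for n using XR ac by blast
  have X_add: "X a \<star> X b = X (a + b)" for a b using M.nat_pow_mult[OF xR] by (simp add: X_def Rm)
  let ?n = "card (carrier G)"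
  obtain c where c: "\<And>j. j \<in> {..?n} \<Longrightarrow> c j \<in> carrier k" "\<exists>j\<in>{..?n}. c j \<noteq> \<zero>"
      "\<And>s. s \<in> carrier G \<Longrightarrow> (\<Oplus>j\<in>{..?n}. c j \<otimes> X j s) = \<zero>"
    using linear_dependence[OF fin, of "{..?n}" X] XA by auto
  (* m is the lowest power of x that occurs in the dependence; the rest is divisible by the next power *)
  define m where "m = (LEAST j. j \<in> {..?n} \<and> c j \<noteq> \<zero>)"
  have m: "m \<in> {..?n}" "c m \<noteq> \<zero>" using c(2) LeastI_ex[of "\<lambda>j. j \<in> {..?n} \<and> c j \<noteq> \<zero>"] by (auto simp: m_def)
  have less_m: "c j = \<zero>" if "j < m" for j
    using that not_less_Least[of j "\<lambda>j. j \<in> {..?n} \<and> c j \<noteq> \<zero>"] m by (auto simp: m_def)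
  have cmU: "c m \<in> Units k" using c(1) m by (simp add: field_Units)
  define J where "J = {Suc m..?n}"
  define d where "d j = \<ominus> (inv (c m) \<otimes> c j)" for j
  have J: "finite J" "j \<in> J \<Longrightarrow> c j \<in> carrier k" "j \<in> J \<Longrightarrow> d j \<in> carrier k" for j
    using c(1) cmU by (auto simp: J_def d_def)
  define u where "u = (\<Oplus>\<^bsub>A\<^esub>j\<in>J. smul (d j) (X (j - Suc m)))"
  have uA: "smul (d j) (X n) \<in> AC" if "j \<in> J" for j n using J that XA by simp
  have uR: "u \<in> carrier R"
  proof -
    have "u \<in> B" unfolding u_def
      using J XR by (intro subalg_finsum[OF B] subalgD(5)[OF B]) (auto simp: RC)
    moreover have "i \<star> u = u" unfolding u_def
      using J uA XR XA ac iB B by (subst A.finsum_rdistr)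
        (auto simp: subalgD(1) smul_mult RC intro!: A.finsum_cong')
    moreover have "u \<star> i = u" unfolding u_def
      using J uA XR XA ac iB B by (subst A.finsum_ldistr)
        (auto simp: subalgD(1) smul_mult RC intro!: A.finsum_cong')
    ultimately show ?thesis by (simp add: RC)
  qed
  have X_u: "X n \<star> u = (\<Oplus>\<^bsub>A\<^esub>j\<in>J. smul (d j) (X (n + (j - Suc m))))" for n
    unfolding u_def using J uA XA
    by (subst A.finsum_rdistr) (auto simp: smul_mult X_add intro!: A.finsum_cong')
  have u_X: "u \<star> X n = (\<Oplus>\<^bsub>A\<^esub>j\<in>J. smul (d j) (X (n + (j - Suc m))))" for n
    unfolding u_def using J uA XA
    by (subst A.finsum_ldistr) (auto simp: smul_mult X_add add.commute intro!: A.finsum_cong')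
  have X_rec: "X m = X (Suc m) \<star> u"
  proof
    fix s
    show "X m s = (X (Suc m) \<star> u) s"
    proof (cases "s \<in> carrier G")
      case s: True
      have cl: "(\<Oplus>j\<in>J. c j \<otimes> X j s) \<in> carrier k" using J XA by (intro finsum_closed) auto
      have cm: "c m \<in> carrier k" "inv (c m) \<in> carrier k" "X m s \<in> carrier k" using cmU XA by auto
      have "\<zero> = (\<Oplus>j\<in>{..?n}. c j \<otimes> X j s)" using c(3) s by simp
      also have "\<dots> = (\<Oplus>j\<in>insert m J. c j \<otimes> X j s)"
      proof (rule finsum_mono_neutral)
        fix j assume "j \<in> {..?n} - insert m J"
        then have "j < m" by (auto simp: J_def)
        then show "c j \<otimes> X j s = \<zero>" using less_m XA by simp
      qed (use m J c XA in \<open>auto simp: J_def\<close>)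
      also have "\<dots> = c m \<otimes> X m s \<oplus> (\<Oplus>j\<in>J. c j \<otimes> X j s)"
        using J XA cm by (intro finsum_insert) (auto simp: J_def)
      finally have "c m \<otimes> X m s \<oplus> (\<Oplus>j\<in>J. c j \<otimes> X j s) = \<zero>" by simp
      then have e: "c m \<otimes> X m s = \<ominus> (\<Oplus>j\<in>J. c j \<otimes> X j s)"
        using cl cm by (intro minus_equality[symmetric]) auto
      have "(X (Suc m) \<star> u) s = (\<Oplus>j\<in>J. smul (d j) (X j) s)"
        unfolding X_u using J uA
        by (subst finsum_apply) (auto simp: J_def intro!: finsum_cong')
      also have "\<dots> = (\<Oplus>j\<in>J. \<ominus> (inv (c m)) \<otimes> (c j \<otimes> X j s))"
        using J XA cm by (intro finsum_cong') (auto simp: smul_def d_def l_minus m_assoc)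
      also have "\<dots> = \<ominus> (inv (c m)) \<otimes> (\<Oplus>j\<in>J. c j \<otimes> X j s)"
        using J XA cm by (subst finsum_rdistr) auto
      also have "\<dots> = inv (c m) \<otimes> (c m \<otimes> X m s)" unfolding e using cm cl by (simp add: l_minus r_minus)
      also have "\<dots> = X m s" using cm cmU by (simp flip: m_assoc)
      finally show ?thesis by simp
    next
      case False
      then show ?thesis using XA ac[OF uR] by (simp add: AC_off mult_off)
    qed
  qed
  (* x^m absorbs w, hence also w^m = x^m u^m; this makes w^m idempotent *)
  define w where "w = x \<otimes>\<^bsub>R\<^esub> u"
  have X1: "X 1 = x" using xR by (simp add: X_def)
  have comm: "x \<otimes>\<^bsub>R\<^esub> u = u \<otimes>\<^bsub>R\<^esub> x" using trans[OF X_u[of 1] u_X[of 1, symmetric]] unfolding X1 Rm .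
  have wR: "w \<in> carrier R" using xR uR by (simp add: w_def)
  have X_w: "X m \<otimes>\<^bsub>R\<^esub> w = X m"
  proof -
    have "X m \<otimes>\<^bsub>R\<^esub> w = X m \<otimes>\<^bsub>R\<^esub> x \<otimes>\<^bsub>R\<^esub> u" using XR xR uR by (simp add: w_def M.m_assoc)
    also have "\<dots> = X m" using X_add[of m 1] X_rec by (simp only: X1 Rm) simp
    finally show ?thesis .
  qed
  have X_wr: "X m \<otimes>\<^bsub>R\<^esub> (w [^]\<^bsub>R\<^esub> (r::nat)) = X m" for r
  proof (induction r)
    case 0
    then show ?case using XR by simp
  next
    case (Suc r)
    then show ?case using XR wR X_w by (simp flip: M.m_assoc)
  qed
  define \<epsilon> where "\<epsilon> = w [^]\<^bsub>R\<^esub> m"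
  have e_split: "\<epsilon> = X m \<otimes>\<^bsub>R\<^esub> (u [^]\<^bsub>R\<^esub> m)"
    unfolding \<epsilon>_def w_def X_def by (rule M.pow_mult_distrib[OF comm xR uR])
  have uw: "u \<otimes>\<^bsub>R\<^esub> w = w \<otimes>\<^bsub>R\<^esub> u" using comm xR uR by (simp add: w_def M.m_assoc)
  have ew: "u [^]\<^bsub>R\<^esub> m \<otimes>\<^bsub>R\<^esub> \<epsilon> = \<epsilon> \<otimes>\<^bsub>R\<^esub> u [^]\<^bsub>R\<^esub> m"
    unfolding \<epsilon>_def using uw uR wR
    by (metis M.group_commutes_pow M.nat_pow_closed)
  have eR: "\<epsilon> \<in> carrier R" using wR by (simp add: \<epsilon>_def)
  have "\<epsilon> \<otimes>\<^bsub>R\<^esub> \<epsilon> = X m \<otimes>\<^bsub>R\<^esub> (\<epsilon> \<otimes>\<^bsub>R\<^esub> u [^]\<^bsub>R\<^esub> m)"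
    using e_split ew eR XR uR by (metis M.m_assoc M.nat_pow_closed)
  also have "\<dots> = X m \<otimes>\<^bsub>R\<^esub> u [^]\<^bsub>R\<^esub> m"
    using X_wr[of m] eR XR uR by (simp add: \<epsilon>_def flip: M.m_assoc)
  finally have "\<epsilon> \<star> \<epsilon> = \<epsilon>" using e_split by (simp add: Rm)
  then have "\<epsilon> = \<zero>\<^sub>A \<or> \<epsilon> = i" using prim_dichotomy[OF B i, of \<epsilon>] eR by (auto simp: RC)
  then show ?thesis
  proof
    assume e: "\<epsilon> = \<zero>\<^sub>A"
    have X0: "X m = \<zero>\<^sub>A" using X_wr[of m] e XA by (simp add: Rm flip: \<epsilon>_def)
    have "X 0 = i" by (simp add: X_def R1)
    then have "m \<noteq> 0" using X0 iB by (metis)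
    then obtain r where r: "m = Suc r" by (cases m) auto
    have "\<phi> (X (Suc r)) = \<phi> x" for r
    proof (induction r)
      case 0
      then show ?case by (simp add: X1[simplified])
    next
      case (Suc r)
      have "X (Suc (Suc r)) = X (Suc r) \<star> x" by (simp add: X_def Rm)
      then show ?case using Suc \<phi>(1)[of "X (Suc r)" x] XR x \<phi>(3) by (simp add: RC)
    qed
    then show ?thesis using X0 r \<phi>(2) by metis
  next
    assume e: "\<epsilon> = i"
    show ?thesis
    proof (cases m)
      case 0
      then have "X 0 = i" by (simp add: X_def R1)
      then have "i = i \<star> w" using X_w 0 by (simp add: Rm)
      then have "x \<star> u = i" using wR by (simp add: RC w_def Rm)
      then show ?thesis using uR by (auto simp: RC)
    next
      case (Suc r)
      have "X m = x \<otimes>\<^bsub>R\<^esub> X r" unfolding Suc X_def by (rule M.nat_pow_Suc2[OF xR])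
      then have "x \<otimes>\<^bsub>R\<^esub> (X r \<otimes>\<^bsub>R\<^esub> u [^]\<^bsub>R\<^esub> m) = i"
        using e e_split xR XR uR by (simp add: M.m_assoc)
      moreover have "X r \<otimes>\<^bsub>R\<^esub> u [^]\<^bsub>R\<^esub> m \<in> carrier R" using XR uR by simp
      ultimately show ?thesis by (auto simp: RC Rm)
    qed
  qed
qed

definition orth_family :: "('g \<Rightarrow> 'l) set \<Rightarrow> ('g \<Rightarrow> 'l) \<Rightarrow> ('g \<Rightarrow> 'l) set \<Rightarrow> bool"
  where "orth_family B u J \<longleftrightarrow> finite J \<and> J \<subseteq> B \<and>
    (\<forall>e\<in>J. e \<star> e = e \<and> e \<noteq> \<zero>\<^sub>A \<and> u \<star> e = e \<and> e \<star> u = e) \<and> (\<forall>e\<in>J. \<forall>f\<in>J. e \<noteq> f \<longrightarrow> e \<star> f = \<zero>\<^sub>A)"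

text \<open>
  Orthogonal idempotents are linearly independent: multiplying a relation by one of them isolates its
  coefficient.
\<close>

lemma card_orthogonal_idempotents:
  assumes J: "finite J" "J \<subseteq> AC" "\<And>e. e \<in> J \<Longrightarrow> e \<star> e = e \<and> e \<noteq> \<zero>\<^sub>A"
    "\<And>e f. e \<in> J \<Longrightarrow> f \<in> J \<Longrightarrow> e \<noteq> f \<Longrightarrow> e \<star> f = \<zero>\<^sub>A"
  shows "card J \<le> card (carrier G)"
proof (rule ccontr)
  assume "\<not> ?thesis"
  then have "card (carrier G) < card J" by simp
  moreover have "j s \<in> carrier k" if "j \<in> J" for j s using that J by auto
  ultimately have "\<exists>c. (\<forall>j\<in>J. c j \<in> carrier k) \<and> (\<exists>j\<in>J. c j \<noteq> \<zero>) \<and>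
      (\<forall>s\<in>carrier G. (\<Oplus>j\<in>J. c j \<otimes> j s) = \<zero>)"
    by (intro linear_dependence[OF fin J(1)])
  then obtain c where c: "\<And>j. j \<in> J \<Longrightarrow> c j \<in> carrier k" "\<exists>j\<in>J. c j \<noteq> \<zero>"
      "\<And>s. s \<in> carrier G \<Longrightarrow> (\<Oplus>j\<in>J. c j \<otimes> j s) = \<zero>"
    by blast
  have A0: "(\<Oplus>\<^bsub>A\<^esub>j\<in>J. smul (c j) j) = \<zero>\<^sub>A"
  proof
    fix s
    have cl: "(\<Oplus>\<^bsub>A\<^esub>j\<in>J. smul (c j) j) \<in> AC" using c J by (intro A.finsum_closed) auto
    show "(\<Oplus>\<^bsub>A\<^esub>j\<in>J. smul (c j) j) s = \<zero>\<^sub>A s"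
    proof (cases "s \<in> carrier G")
      case True
      have "(\<Oplus>\<^bsub>A\<^esub>j\<in>J. smul (c j) j) s = (\<Oplus>j\<in>J. smul (c j) j s)"
        using c J by (intro finsum_apply) auto
      then show ?thesis using c(3)[OF True] by (simp add: smul_def zero_apply)
    next
      case False
      then show ?thesis using cl by (simp add: AC_off zero_apply)
    qed
  qed
  obtain e where e: "e \<in> J" "c e \<noteq> \<zero>" using c(2) by auto
  have eA: "e \<in> AC" using e J by auto
  have "\<zero>\<^sub>A = (\<Oplus>\<^bsub>A\<^esub>j\<in>J. smul (c j) j) \<star> e" using A0 eA by simp
  also have "\<dots> = (\<Oplus>\<^bsub>A\<^esub>j\<in>J. smul (c j) j \<star> e)" using c J eA by (intro A.finsum_ldistr) auto
  also have "\<dots> = smul (c e) e \<star> e"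
  proof (rule A.finsum_delta)
    fix j assume j: "j \<in> J" "j \<noteq> e"
    then have "smul (c j) j \<star> e = smul (c j) \<zero>\<^sub>A" using c e J by (auto simp: smul_mult subset_iff)
    then show "smul (c j) j \<star> e = \<zero>\<^sub>A" using c j by (simp add: smul_def zero_eq)
  qed (use c e J eA in auto)
  also have "\<dots> = smul (c e) e" using c e J eA by (simp add: smul_mult)
  finally have "smul (c e) e = \<zero>\<^sub>A" by simp
  then have "c e = \<zero>" using smul_eq_zero[of "c e" e] c e J eA by auto
  then show False using e by simp
qed

text \<open>
  A property of idempotents that passes to one of the two parts of every orthogonal decomposition
  is inherited by a primitive idempotent: the size of the largest orthogonal family below an
  idempotent decreases along decompositions.
\<close>

lemma primitive_below:
  assumes B: "subalg B" and u: "u \<in> B" "u \<star> u = u" "\<Phi> u"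
    and \<Phi>: "\<And>j j'. j \<in> B \<Longrightarrow> j' \<in> B \<Longrightarrow> \<Phi> (j \<boxplus> j') \<Longrightarrow> \<Phi> j \<or> \<Phi> j'" "\<not> \<Phi> \<zero>\<^sub>A"
  obtains i where "prim B i" "u \<star> i = i" "i \<star> u = i" "\<Phi> i"
proof -
  define N where "N v = Max (card ` {J. orth_family B v J})" for v
  have ac: "a \<in> AC" if "a \<in> B" for a using subalgD(1)[OF B that] .
  have bound: "card J \<le> card (carrier G)" if "orth_family B v J" for v J
    using that ac by (intro card_orthogonal_idempotents) (auto simp: orth_family_def)
  have finN: "finite (card ` {J. orth_family B v J})" for v
  proof (rule finite_subset[of _ "{..card (carrier G)}"])
    show "card ` {J. orth_family B v J} \<subseteq> {..card (carrier G)}" using bound by blast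
  qed simp
  have emp: "orth_family B v {}" for v by (simp add: orth_family_def)
  have below: "N j < N v"
    if v: "v \<in> B" "v \<star> v = v" and j: "j \<in> B" "j \<star> j = j" "j' \<in> B" "j' \<star> j' = j'"
      "j \<star> j' = \<zero>\<^sub>A" "j' \<star> j = \<zero>\<^sub>A" "v = j \<boxplus> j'" "j' \<noteq> \<zero>\<^sub>A" for v j j'
  proof -
    have jA: "j \<in> AC" "j' \<in> AC" using j ac by auto
    have "N j \<in> card ` {J. orth_family B j J}" unfolding N_def using emp by (intro Max_in finN) auto
    then obtain J where J: "orth_family B j J" "N j = card J" by auto
    have vj: "v \<star> j = j" "j \<star> v = j" "v \<star> j' = j'" "j' \<star> v = j'"
      using jA j by (simp_all add: A.l_distr A.r_distr)
    have JA: "e \<in> AC" "j \<star> e = e" "e \<star> j = e" if "e \<in> J" for e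
      using J that ac by (auto simp: orth_family_def)
    have ej: "e \<star> j' = \<zero>\<^sub>A" "j' \<star> e = \<zero>\<^sub>A" if "e \<in> J" for e
    proof -
      have "e \<star> j' = e \<star> (j \<star> j')" using JA[OF that] jA by (simp flip: mult_assoc)
      then show "e \<star> j' = \<zero>\<^sub>A" using j JA[OF that] by simp
      have "j' \<star> e = (j' \<star> j) \<star> e" using JA[OF that] jA by (simp add: mult_assoc)
      then show "j' \<star> e = \<zero>\<^sub>A" using j JA[OF that] by simp
    qed
    have ve: "v \<star> e = e" "e \<star> v = e" if "e \<in> J" for e
    proof -
      have vA: "v \<in> AC" using v ac by auto
      show "v \<star> e = e" using mult_assoc[of v j e] vj JA[OF that] jA vA by simp
      show "e \<star> v = e" using mult_assoc[of e j v] vj JA[OF that] jA vA by simp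
    qed
    have "j' \<notin> J" using ej j by (metis)
    moreover have "orth_family B v (insert j' J)"
      using J vj ve ej j v by (auto simp: orth_family_def)
    moreover have "finite J" using J by (simp add: orth_family_def)
    ultimately have "Suc (N j) \<in> card ` {J. orth_family B v J}"
      using J(2) by (intro image_eqI[of _ _ "insert j' J"]) auto
    then have "Suc (N j) \<le> N v" unfolding N_def[of v] by (intro Max_ge finN)
    then show ?thesis by simp
  qed
  have "\<exists>i. prim B i \<and> u \<star> i = i \<and> i \<star> u = i \<and> \<Phi> i"
    using u
  proof (induction "N u" arbitrary: u rule: less_induct)
    case less
    show ?case
    proof (cases "prim B u")
      case True
      then show ?thesis using less.prems by auto
    next
      case False
      have "u \<noteq> \<zero>\<^sub>A" using less.prems \<Phi> by auto
      with False less.prems obtain j j' where j: "j \<in> B" "j' \<in> B" "j \<star> j = j" "j' \<star> j' = j'"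
          "j \<star> j' = \<zero>\<^sub>A" "j' \<star> j = \<zero>\<^sub>A" "u = j \<boxplus> j'" "j \<noteq> \<zero>\<^sub>A" "j' \<noteq> \<zero>\<^sub>A"
        unfolding prim_iff by blast
      have jA: "j \<in> AC" "j' \<in> AC" using j ac by auto
      have uA: "u \<in> AC" using less.prems ac by auto
      have u': "u = j' \<boxplus> j" using j jA A.a_comm by simp
      have uj: "u \<star> j = j" "j \<star> u = j" "u \<star> j' = j'" "j' \<star> u = j'"
        using jA j by (simp_all add: A.l_distr A.r_distr)
      have fin: "\<exists>i. prim B i \<and> u \<star> i = i \<and> i \<star> u = i \<and> \<Phi> i"
        if h: "h \<in> B" "h \<star> h = h" "u \<star> h = h" "h \<star> u = h" "\<Phi> h" "N h < N u" for h
      proof -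
        obtain i where i: "prim B i" "h \<star> i = i" "i \<star> h = i" "\<Phi> i"
          using less.hyps[OF h(6)] h by auto
        have A: "i \<in> AC" "h \<in> AC" using i h ac primD by auto
        have "u \<star> (h \<star> i) = i" "i \<star> h \<star> u = i"
          using A uA h i mult_assoc[of u h i] mult_assoc[of i h u] by simp_all
        then show ?thesis using i by auto
      qed
      have "\<Phi> j \<or> \<Phi> j'" using \<Phi>(1)[OF j(1,2)] less.prems j by simp
      then show ?thesis
        using fin[of j] fin[of j'] uj j below[OF less.prems(1,2) j(1,3,2,4,5,6,7,9)]
          below[OF less.prems(1,2) j(2,4,1,3,6,5) u' j(8)] by blast
    qed
  qed
  then show ?thesis using that by auto
qed


section \<open>Blocks\<close>

abbreviation block :: "'g set \<Rightarrow> ('g \<Rightarrow> 'l) \<Rightarrow> bool"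
  where "block H e \<equiv> prim (Zc H) e"

lemma block_idempotent_iff:
  assumes H: "subgroup H G"
  shows "block_idempotent k (G\<lparr>carrier := H\<rparr>) e \<longleftrightarrow> block H e"
proof -
  let ?R = "group_algebra k (G\<lparr>carrier := H\<rparr>)"
  have z: "\<zero>\<^bsub>?R\<^esub> = \<zero>\<^sub>A" "a \<oplus>\<^bsub>?R\<^esub> b = a \<boxplus> b" for a b
    by (simp_all add: group_algebra_def del: AC_coeff)
  have m: "a \<otimes>\<^bsub>?R\<^esub> b = a \<star> b" if "a \<in> kH H" "b \<in> kH H" for a b using mult_subgroup[OF H that] .
  have c: "{z \<in> carrier ?R. \<forall>a\<in>carrier ?R. z \<otimes>\<^bsub>?R\<^esub> a = a \<otimes>\<^bsub>?R\<^esub> z} = Zc H"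
    unfolding Zc_def kH_def[symmetric] by (intro Collect_cong conj_cong ball_cong refl) (simp only: m)
  have m': "a \<otimes>\<^bsub>?R\<^esub> b = a \<star> b" if "a \<in> Zc H" "b \<in> Zc H" for a b
    using m[OF Zc_D(1) Zc_D(1)] that .
  show ?thesis
    unfolding block_idempotent_def ring_center_def c
    by (rule primitive_idempotent_cong) (simp_all add: z m')
qed

lemma block_idempotent_carrier: "block_idempotent k G b \<longleftrightarrow> block (carrier G) b"
  unfolding block_idempotent_def ring_center_def Zc_def kH_carrier ..

lemma blockD:
  assumes "subgroup H G" "block H e"
  shows "e \<in> AC" "e \<in> kH H" "e \<in> Zc H" "e \<star> e = e" "e \<noteq> \<zero>\<^sub>A" "a \<in> kH H \<Longrightarrow> e \<star> a = a \<star> e"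
  using primD[OF assms(2)] Zc_D subalgD(1)[OF subalg_Zc[OF assms(1)]] by blast+

lemma kH_AC: "subgroup H G \<Longrightarrow> a \<in> kH H \<Longrightarrow> a \<in> AC"
  using subalgD(1)[OF subalg_kH] by blast

lemma block_central_idempotent:
  assumes H: "subgroup H G" and e: "block H e" and z: "z \<in> Zc H" "z \<star> z = z"
  shows "z \<star> e = \<zero>\<^sub>A \<or> z \<star> e = e"
proof (rule prim_dichotomy[OF subalg_Zc[OF H] e])
  note eD = blockD[OF H e]
  have zA: "z \<in> AC" "z \<in> kH H" using z Zc_D kH_AC[OF H] by auto
  have ze: "e \<star> z = z \<star> e" by (rule eD(6)[OF zA(2)])
  show "z \<star> e \<in> Zc H" using subalgD(4)[OF subalg_Zc[OF H] z(1) eD(3)] .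
  show ze_e: "z \<star> e \<star> e = z \<star> e" using zA(1) eD(1,4) by (simp add: mult_assoc)
  show e_ze: "e \<star> (z \<star> e) = z \<star> e"
    using zA(1) eD(1) ze ze_e by (simp flip: mult_assoc)
  have "z \<star> e \<star> (z \<star> e) = z \<star> (e \<star> (z \<star> e))" using zA(1) eD(1) by (simp add: mult_assoc)
  also have "\<dots> = z \<star> z \<star> e" using zA(1) eD(1) by (simp add: e_ze mult_assoc)
  finally show "z \<star> e \<star> (z \<star> e) = z \<star> e" using z by simp
qed

lemma blocks_orthogonal:
  assumes H: "subgroup H G" and e: "block H e" and f: "block H f" and ne: "e \<noteq> f"
  shows "e \<star> f = \<zero>\<^sub>A"
proof -
  note eD = blockD[OF H e] and fD = blockD[OF H f]
  have "e \<star> f = \<zero>\<^sub>A \<or> e \<star> f = f" "f \<star> e = \<zero>\<^sub>A \<or> f \<star> e = e"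
    using block_central_idempotent[OF H f eD(3,4)] block_central_idempotent[OF H e fD(3,4)] .
  moreover have "e \<star> f = f \<star> e" by (rule eD(6)[OF fD(2)])
  ultimately show ?thesis using ne by auto
qed

lemma finite_blocks:
  assumes H: "subgroup H G"
  shows "finite {e. block H e}"
proof (rule ccontr)
  assume "infinite {e. block H e}"
  then obtain J where J: "J \<subseteq> {e. block H e}" "finite J" "card J = Suc (card (carrier G))"
    using infinite_arbitrarily_large by blast
  have "card J \<le> card (carrier G)"
  proof (rule card_orthogonal_idempotents[OF J(2)])
    show "J \<subseteq> AC" using J(1) blockD(1)[OF H] by blast
    show "e \<star> e = e \<and> e \<noteq> \<zero>\<^sub>A" if "e \<in> J" for e using that J(1) blockD(4,5)[OF H] by blast
    show "e \<star> f = \<zero>\<^sub>A" if "e \<in> J" "f \<in> J" "e \<noteq> f" for e f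
      using that J(1) blocks_orthogonal[OF H] by blast
  qed
  then show False using J by simp
qed

text \<open>
  The blocks are orthogonal, so the complement of their sum is an idempotent. If it were nonzero, it
  would contain a further block.
\<close>

lemma sum_blocks:
  assumes H: "subgroup H G"
  shows "(\<Oplus>\<^bsub>A\<^esub>e\<in>{e. block H e}. e) = \<one>\<^sub>A"
proof -
  let ?X = "{e. block H e}"
  define s where "s = (\<Oplus>\<^bsub>A\<^esub>e\<in>?X. e)"
  note B = subalg_Zc[OF H]
  have XA: "e \<in> AC" if "e \<in> ?X" for e using that blockD(1)[OF H] by auto
  have sZ: "s \<in> Zc H" unfolding s_def using finite_blocks[OF H] blockD(3)[OF H] by (intro subalg_finsum[OF B]) auto
  then have sA: "s \<in> AC" using subalgD(1)[OF B] by auto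
  have se: "s \<star> e = e" if e: "e \<in> ?X" for e
  proof -
    have "s \<star> e = (\<Oplus>\<^bsub>A\<^esub>f\<in>?X. f \<star> e)"
      unfolding s_def using finite_blocks[OF H] XA e by (intro A.finsum_ldistr) auto
    also have "\<dots> = e \<star> e"
      using finite_blocks[OF H] XA e blocks_orthogonal[OF H] by (intro A.finsum_delta) auto
    finally show ?thesis using blockD(4)[OF H] e by simp
  qed
  have "s \<star> s = (\<Oplus>\<^bsub>A\<^esub>e\<in>?X. s \<star> e)"
    using finite_blocks[OF H] XA sA unfolding s_def by (intro A.finsum_rdistr) auto
  also have "\<dots> = s" unfolding s_def[symmetric] using se XA s_def by (metis (no_types, lifting) A.finsum_cong' Pi_I)
  finally have ss: "s \<star> s = s" .
  note c = idem_complement[of "\<one>\<^sub>A" s, OF _ sA _ ss]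
  have "\<one>\<^sub>A \<boxminus> s = \<zero>\<^sub>A"
  proof (rule ccontr)
    assume n: "\<one>\<^sub>A \<boxminus> s \<noteq> \<zero>\<^sub>A"
    have mem: "\<one>\<^sub>A \<boxminus> s \<in> Zc H" using subalgD(6)[OF B] one_Zc[OF H] sZ by simp
    have idem: "(\<one>\<^sub>A \<boxminus> s) \<star> (\<one>\<^sub>A \<boxminus> s) = \<one>\<^sub>A \<boxminus> s" using c sA by simp
    obtain e where e: "block H e" "(\<one>\<^sub>A \<boxminus> s) \<star> e = e"
      by (rule primitive_below[OF B mem idem, of "\<lambda>v. v \<noteq> \<zero>\<^sub>A"]) (use n in auto)
    have "e \<in> AC" using e XA by auto
    then have "(\<one>\<^sub>A \<boxminus> s) \<star> e = e \<boxminus> s \<star> e" using sA by (simp add: mult_minus)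
    also have "\<dots> = \<zero>\<^sub>A" using se e \<open>e \<in> AC\<close> by simp
    finally show False using e blockD(5)[OF H e(1)] by simp
  qed
  then show ?thesis using sA by (simp add: minus_eq_zero s_def)
qed

lemma prim_twist:
  assumes g: "\<gamma> \<in> ring_iso k k" "x \<in> carrier G" and B: "B \<subseteq> AC" and i: "prim B i"
    and to: "\<And>a. a \<in> B \<Longrightarrow> twist \<gamma> x a \<in> B'" and onto: "\<And>b. b \<in> B' \<Longrightarrow> \<exists>a\<in>B. b = twist \<gamma> x a"
  shows "prim B' (twist \<gamma> x i)"
  unfolding prim_iff
proof (intro conjI ballI impI)
  have iA: "i \<in> AC" using primD[OF i] B by auto
  show "twist \<gamma> x i \<in> B'" using to primD[OF i] by auto
  show "twist \<gamma> x i \<star> twist \<gamma> x i = twist \<gamma> x i"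
    using primD(2)[OF i] iA g by (simp flip: twist_mult)
  show "twist \<gamma> x i \<noteq> \<zero>\<^sub>A" using primD(3)[OF i] iA g by (simp add: twist_eq_zero)
  fix j j' assume j: "j \<in> B'" "j' \<in> B'" "j \<star> j = j" "j' \<star> j' = j'" "j \<star> j' = \<zero>\<^sub>A" "j' \<star> j = \<zero>\<^sub>A"
    "twist \<gamma> x i = j \<boxplus> j'"
  obtain a a' where a: "a \<in> B" "j = twist \<gamma> x a" "a' \<in> B" "j' = twist \<gamma> x a'" using onto j by meson
  have aA: "a \<in> AC" "a' \<in> AC" using a B by auto
  have inj: "u = v" if "twist \<gamma> x u = twist \<gamma> x v" "u \<in> AC" "v \<in> AC" for u v
    using twist_inj[OF g] that by auto
  have "a \<star> a = a" "a' \<star> a' = a'" "a \<star> a' = \<zero>\<^sub>A" "a' \<star> a = \<zero>\<^sub>A" "i = a \<boxplus> a'"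
    using j a aA iA g
    by - (rule inj; simp add: twist_mult twist_add twist_zero)+
  then have "a = \<zero>\<^sub>A \<or> a' = \<zero>\<^sub>A" using i a unfolding prim_iff by blast
  then show "j = \<zero>\<^sub>A \<or> j' = \<zero>\<^sub>A" using a g by (auto simp: twist_zero)
qed

lemma block_twist:
  assumes g: "\<gamma> \<in> ring_iso k k" "x \<in> carrier G" and H: "subgroup H G" and e: "block H e"
  shows "block (grp.cj x ` H) (twist \<gamma> x e)"
proof (rule prim_twist[OF g _ e])
  have HG: "H \<subseteq> carrier G" using H by (rule subgroup.subset)
  show "Zc H \<subseteq> AC" using subalgD(1)[OF subalg_Zc[OF H]] by auto
  show "twist \<gamma> x a \<in> Zc (grp.cj x ` H)" if "a \<in> Zc H" for a by (rule twist_Zc[OF g HG that])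
  fix b assume b: "b \<in> Zc (grp.cj x ` H)"
  have xH: "subgroup (grp.cj x ` H) G" using grp.subgroup_cj_image[OF g(2) H] .
  have bA: "b \<in> AC" using b subalgD(1)[OF subalg_Zc[OF xH]] by auto
  obtain \<delta> where d: "\<delta> \<in> ring_iso k k" "\<And>a. a \<in> AC \<Longrightarrow> twist \<gamma> x (twist \<delta> (inv\<^bsub>G\<^esub> x) a) = a"
    using twist_inverse[OF g] by metis
  have "twist \<delta> (inv\<^bsub>G\<^esub> x) b \<in> Zc (grp.cj (inv\<^bsub>G\<^esub> x) ` grp.cj x ` H)"
    using twist_Zc[OF d(1) _ subgroup.subset[OF xH] b] g by simp
  then have "twist \<delta> (inv\<^bsub>G\<^esub> x) b \<in> Zc H" using HG g by simp
  then show "\<exists>a\<in>Zc H. b = twist \<gamma> x a" using d bA by metis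
qed

lemma fixA_twist_mem:
  assumes g: "\<gamma> \<in> ring_iso k k" "x \<in> carrier G" and P: "P \<subseteq> carrier G" and a: "a \<in> fixA P"
  shows "twist \<gamma> x a \<in> fixA (grp.cj x ` P)"
proof -
  have "twist \<gamma> x a (grp.cj (grp.cj x u) g) = twist \<gamma> x a g" if u: "u \<in> P" "g \<in> carrier G" for u g
  proof -
    have uG: "u \<in> carrier G" using u P by auto
    have "grp.cj (inv\<^bsub>G\<^esub> x) (grp.cj (grp.cj x u) g) = grp.cj u (grp.cj (inv\<^bsub>G\<^esub> x) g)"
      using g(2) uG u(2) by (simp add: grp.cj_def grp.inv_mult_group grp.m_assoc)
    then show ?thesis using fixA_D(2)[OF a u(1), of "grp.cj (inv\<^bsub>G\<^esub> x) g"] g uG u by (simp add: twist_apply)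
  qed
  then show ?thesis using fixA_D(1)[OF a] g by (auto simp: fixA_def)
qed

lemma prim_fixA_twist:
  assumes g: "\<gamma> \<in> ring_iso k k" "x \<in> carrier G" and P: "P \<subseteq> carrier G" and i: "prim (fixA P) i"
  shows "prim (fixA (grp.cj x ` P)) (twist \<gamma> x i)"
proof (rule prim_twist[OF g _ i])
  show "fixA P \<subseteq> AC" by (auto simp: fixA_def)
  show "twist \<gamma> x a \<in> fixA (grp.cj x ` P)" if "a \<in> fixA P" for a by (rule fixA_twist_mem[OF g P that])
  fix b assume b: "b \<in> fixA (grp.cj x ` P)"
  have xP: "grp.cj x ` P \<subseteq> carrier G" using g P by auto
  obtain \<delta> where d: "\<delta> \<in> ring_iso k k" "\<And>a. a \<in> AC \<Longrightarrow> twist \<gamma> x (twist \<delta> (inv\<^bsub>G\<^esub> x) a) = a"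
    using twist_inverse[OF g] by metis
  have "twist \<delta> (inv\<^bsub>G\<^esub> x) b \<in> fixA (grp.cj (inv\<^bsub>G\<^esub> x) ` grp.cj x ` P)"
    using fixA_twist_mem[OF d(1) _ xP b] g by simp
  then have "twist \<delta> (inv\<^bsub>G\<^esub> x) b \<in> fixA P" using P g by simp
  then show "\<exists>a\<in>fixA P. b = twist \<gamma> x a" using d fixA_D(1)[OF b] by metis
qed


section \<open>Extending fixed points along the Brauer map\<close>

text \<open>
  The extension is constant on \<open>H\<close>-classes and vanishes off the classes of the support of \<open>j\<close>. It is
  well defined because \<open>Q\<close> is a Sylow subgroup of the centralizer in \<open>H\<close> of each \<open>h\<close> in that support:
  if \<open>h\<close> and its conjugate by \<open>x\<close> both centralize \<open>Q\<close>, then \<open>x\<close> can be changed by an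
  element centralizing \<open>h\<close> so as to normalize \<open>Q\<close>.
\<close>

lemma extend_from_centralizer:
  assumes H: "subgroup H G" and Q: "grp.p_subgroup p Q" "Q \<subseteq> H"
    and j: "j \<in> kH (C Q)" "j \<in> fixA (grp.normalizer H Q)"
    and vanish: "\<And>S h. grp.p_subgroup p S \<Longrightarrow> Q \<subset> S \<Longrightarrow> S \<subseteq> grp.normalizer H Q \<Longrightarrow> h \<in> C S \<Longrightarrow> j h = \<zero>"
  obtains y where "y \<in> fixA H" "Br Q y = j" "\<And>g. y g \<noteq> \<zero> \<Longrightarrow> \<exists>t\<in>H. j (grp.cj t g) \<noteq> \<zero>"
proof -
  have HG: "H \<subseteq> carrier G" using H by (rule subgroup.subset)
  have Qs: "subgroup Q G" using Q by (simp add: grp.p_subgroup_def)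
  have QG: "Q \<subseteq> carrier G" using Qs by (rule subgroup.subset)
  have jA: "j \<in> AC" using j by (auto simp: kC_AC)
  have supp: "g \<in> C Q" if "j g \<noteq> \<zero>" for g using that j QG by (auto simp: in_kC)
  (* conjugates of h under H that both centralize Q are conjugate under the normalizer of Q *)
  have wd: "j (grp.cj x h) = j h" if x: "x \<in> H" and h: "j h \<noteq> \<zero>" and h': "grp.cj x h \<in> C Q" for x h
  proof -
    have xG: "x \<in> carrier G" "inv\<^bsub>G\<^esub> x \<in> H" "inv\<^bsub>G\<^esub> x \<in> carrier G"
      using x H HG by (auto simp: subgroup.m_inv_closed)
    have hQ: "h \<in> C Q" using supp h by simp
    then have hG: "h \<in> carrier G" using centralizer_carrier by auto
    define D where "D = H \<inter> C {h}"
    have Ch: "subgroup (C {h}) G" using hG by (intro subgroup_C) auto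
    have D: "subgroup D G" unfolding D_def by (rule grp.subgroups_Inter_pair[OF H Ch])
    have QD: "Q \<subseteq> D" using Q hQ QG grp.centralizer_sym[of Q "{h}"] hG by (auto simp: D_def)
    let ?Q' = "grp.cj (inv\<^bsub>G\<^esub> x) ` Q"
    have "h \<in> C ?Q'"
      using grp.cj_centralizer_iff[of "inv\<^bsub>G\<^esub> x" Q "grp.cj x h"] xG QG hG h' by simp
    moreover have "?Q' \<subseteq> carrier G" using QG xG by auto
    ultimately have "?Q' \<subseteq> C {h}" using grp.centralizer_sym[of ?Q' "{h}"] hG by simp
    moreover have "?Q' \<subseteq> H" using Q(2) xG H by (auto intro: grp.cj_in_subgroup)
    ultimately have Q'D: "?Q' \<subseteq> D" by (simp add: D_def)
    have "\<exists>c\<in>D. grp.cj c ` ?Q' = Q"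
    proof (rule grp.conjugate_if_maximal_in_normalizer[OF prime_p fin D Q(1) QD _ _ Q'D])
      fix S assume S: "grp.p_subgroup p S" "Q \<subset> S" "S \<subseteq> grp.normalizer D Q"
      have "S \<subseteq> grp.normalizer H Q" using S(3) by (auto simp: grp.normalizer_def D_def)
      moreover have "S \<subseteq> C {h}" using S(3) by (auto simp: grp.normalizer_def D_def)
      then have "h \<in> C S" using grp.centralizer_sym[of S "{h}"] hG centralizer_carrier[of "{h}"] by auto
      ultimately show False using vanish[OF S(1,2)] h by simp
    qed (use Q xG QG in \<open>auto intro: grp.p_subgroup_cj\<close>)
    then obtain c where c: "c \<in> D" "grp.cj c ` ?Q' = Q" by auto
    have cG: "c \<in> carrier G" "c \<in> H" "c \<in> C {h}" using c HG by (auto simp: D_def)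
    define n where "n = c \<cdot> inv\<^bsub>G\<^esub> x"
    have "n \<in> grp.normalizer H Q"
      using c cG xG QG H by (simp add: grp.normalizer_def n_def grp.cj_image_mult subgroup.m_closed)
    then have "j (grp.cj n (grp.cj x h)) = j (grp.cj x h)" using fixA_D(2)[OF j(2)] xG hG by simp
    moreover have "grp.cj n (grp.cj x h) = grp.cj c h"
      using cG xG hG by (simp add: n_def grp.cj_mult)
    moreover have "grp.cj c h = h" using cG hG grp.in_centralizer_iff_cj(2)[of "{h}" c] by simp
    ultimately show ?thesis by simp
  qed
  define y where "y g = (if \<exists>t\<in>H. g \<in> carrier G \<and> j (grp.cj t g) \<noteq> \<zero>
      then j (grp.cj (SOME t. t \<in> H \<and> j (grp.cj t g) \<noteq> \<zero>) g) else \<zero>)" for g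
  have y_eq: "y g = j (grp.cj t g)" if g: "g \<in> carrier G" and t: "t \<in> H" "j (grp.cj t g) \<noteq> \<zero>" for g t
  proof -
    define s where "s = (SOME t. t \<in> H \<and> j (grp.cj t g) \<noteq> \<zero>)"
    have s: "s \<in> H" "j (grp.cj s g) \<noteq> \<zero>"
      using someI[of "\<lambda>t. t \<in> H \<and> j (grp.cj t g) \<noteq> \<zero>" t] t by (auto simp: s_def)
    have sG: "s \<in> carrier G" "t \<in> carrier G" "inv\<^bsub>G\<^esub> t \<in> H" using s t H HG by (auto simp: subgroup.m_inv_closed)
    have "grp.cj (s \<cdot> inv\<^bsub>G\<^esub> t) (grp.cj t g) = grp.cj s g" using sG g by (simp add: grp.cj_mult)
    then have "j (grp.cj s g) = j (grp.cj t g)"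
      using wd[of "s \<cdot> inv\<^bsub>G\<^esub> t" "grp.cj t g"] supp s t sG H by (simp add: subgroup.m_closed)
    then show ?thesis using g t by (auto simp: y_def s_def)
  qed
  have y_0: "y g = \<zero>" if "\<And>t. t \<in> H \<Longrightarrow> j (grp.cj t g) = \<zero>" for g
    using that by (simp add: y_def)
  have yA: "y \<in> AC" using jA by (intro AC_I) (auto simp: y_def)
  have "y (grp.cj x g) = y g" if x: "x \<in> H" and g: "g \<in> carrier G" for x g
  proof (cases "\<exists>t\<in>H. j (grp.cj t g) \<noteq> \<zero>")
    case True
    then obtain t where t: "t \<in> H" "j (grp.cj t g) \<noteq> \<zero>" by auto
    have tG: "t \<in> carrier G" "x \<in> carrier G" "inv\<^bsub>G\<^esub> x \<in> H" using t x H HG by (auto simp: subgroup.m_inv_closed)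
    have e: "grp.cj (t \<cdot> inv\<^bsub>G\<^esub> x) (grp.cj x g) = grp.cj t g" using tG g by (simp add: grp.cj_mult)
    have "y (grp.cj x g) = j (grp.cj (t \<cdot> inv\<^bsub>G\<^esub> x) (grp.cj x g))"
      using t tG g H e by (intro y_eq) (auto simp: subgroup.m_closed)
    then show ?thesis using e y_eq[OF g t] by simp
  next
    case False
    have "j (grp.cj t (grp.cj x g)) = \<zero>" if t: "t \<in> H" for t
    proof -
      have "grp.cj t (grp.cj x g) = grp.cj (t \<cdot> x) g" using t x g HG by (simp add: grp.cj_mult subset_iff)
      then show ?thesis using False t x H by (auto simp: subgroup.m_closed)
    qed
    then show ?thesis using False y_0 by auto
  qed
  then have "y \<in> fixA H" using yA by (simp add: fixA_def)
  moreover have "Br Q y = j"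
  proof
    fix g
    show "Br Q y g = j g"
    proof (cases "g \<in> C Q")
      case True
      then have gG: "g \<in> carrier G" using centralizer_carrier by auto
      have "y g = j g"
      proof (cases "\<exists>t\<in>H. j (grp.cj t g) \<noteq> \<zero>")
        case nz: True
        then obtain t where t: "t \<in> H" "j (grp.cj t g) \<noteq> \<zero>" by auto
        have tG: "t \<in> carrier G" "inv\<^bsub>G\<^esub> t \<in> H" using t H HG by (auto simp: subgroup.m_inv_closed)
        have "j (grp.cj (inv\<^bsub>G\<^esub> t) (grp.cj t g)) = j (grp.cj t g)"
          using t tG gG True by (intro wd) auto
        then show ?thesis using y_eq[OF gG t] tG gG by simp
      next
        case False
        then have "j (grp.cj \<one>\<^bsub>G\<^esub> g) = \<zero>" using H by (auto simp: subgroup.one_closed)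
        then show ?thesis using False y_0 gG by auto
      qed
      then show ?thesis using True by (simp add: Br_apply)
    next
      case False
      then show ?thesis using supp by (metis Br_apply)
    qed
  qed
  moreover have "\<exists>t\<in>H. j (grp.cj t g) \<noteq> \<zero>" if "y g \<noteq> \<zero>" for g using that y_0 by blast
  ultimately show ?thesis using that by blast
qed


section \<open>Brauer pairs\<close>

text \<open>
  The pairs \<open>(P, e)\<close> satisfying \<^const>\<open>brauer_pair\<close>, with the block condition expressed inside \<open>kG\<close>.
\<close>

definition bpair :: "'g set \<Rightarrow> ('g \<Rightarrow> 'l) \<Rightarrow> bool"
  where "bpair P e \<longleftrightarrow> grp.p_subgroup p P \<and> block (C P) e"

text \<open>
  The primitive idempotents of \<open>(kG)\<^sup>P\<close> that are associated to \<open>(P, e)\<close>.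
\<close>

definition primitive_for :: "'g set \<Rightarrow> ('g \<Rightarrow> 'l) \<Rightarrow> ('g \<Rightarrow> 'l) \<Rightarrow> bool"
  where "primitive_for P e i \<longleftrightarrow> prim (fixA P) i \<and> e \<star> Br P i = Br P i \<and> Br P i \<noteq> \<zero>\<^sub>A"

lemma p_subgroup_carrier: "grp.p_subgroup p P \<Longrightarrow> P \<subseteq> carrier G"
  using subgroup.subset by (auto simp: grp.p_subgroup_def)

lemma p_subgroup_C: "grp.p_subgroup p P \<Longrightarrow> subgroup (C P) G"
  by (simp add: p_subgroup_carrier subgroup_C)

lemma bpairD:
  assumes "bpair P e"
  shows "grp.p_subgroup p P" "subgroup P G" "P \<subseteq> carrier G" "subgroup (C P) G" "block (C P) e"
  using assms p_subgroup_carrier p_subgroup_C by (auto simp: bpair_def grp.p_subgroup_def)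

lemma brauer_pair_iff: "brauer_pair k G (P, e) \<longleftrightarrow> bpair P e"
proof (cases "subgroup P G")
  case True
  then show ?thesis
    using block_idempotent_iff[OF subgroup_C[OF subgroup.subset[OF True]]]
    by (simp add: bpair_def grp.p_subgroup_def ring_char)
qed (simp add: bpair_def grp.p_subgroup_def)

lemma centralizer_algebra_mult:
  "P \<subseteq> carrier G \<Longrightarrow> a \<in> kH (C P) \<Longrightarrow> b \<in> kH (C P) \<Longrightarrow> a \<otimes>\<^bsub>centralizer_algebra k G P\<^esub> b = a \<star> b"
  unfolding centralizer_algebra_def by (rule mult_subgroup[OF subgroup_C])

lemma centralizer_algebra_zero: "\<zero>\<^bsub>centralizer_algebra k G P\<^esub> = \<zero>\<^sub>A"
  unfolding centralizer_algebra_def by (simp add: group_algebra_def del: AC_coeff)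

lemma associated_iff:
  assumes "bpair P e"
  shows "associated k G i (P, e) \<longleftrightarrow> i \<in> fixA P \<and> i \<star> i = i \<and> e \<star> Br P i = Br P i \<and> Br P i \<noteq> \<zero>\<^sub>A"
proof -
  note bp = bpairD[OF assms]
  have "e \<in> kH (C P)" using blockD(2)[OF bp(4,5)] .
  then have "e \<otimes>\<^bsub>centralizer_algebra k G P\<^esub> Br P i = e \<star> Br P i" if "i \<in> fixA P"
    using that by (intro centralizer_algebra_mult bp Br_in_kC fixA_D)
  then show ?thesis
    by (auto simp: fixed_algebra_eq[OF bp(3)] idempotent_elem_def centralizer_algebra_zero)
qed

lemma brauer_le_iff:
  "brauer_le k G (Q, f) (P, e) \<longleftrightarrow> bpair Q f \<and> bpair P e \<and> Q \<subseteq> P \<and>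
    (\<forall>i. primitive_for P e i \<longrightarrow> f \<star> Br Q i = Br Q i \<and> Br Q i \<noteq> \<zero>\<^sub>A)"
proof (cases "bpair Q f \<and> bpair P e \<and> Q \<subseteq> P")
  case True
  then have bp: "bpair Q f" "bpair P e" and QP: "Q \<subseteq> P" by auto
  have "primitive_idempotent (fixed_algebra k G P) i \<and> associated k G i (P, e) \<longleftrightarrow> primitive_for P e i" for i
    using associated_iff[OF bp(2)] bpairD(3)[OF bp(2)]
    by (auto simp: primitive_for_def fixed_algebra_eq dest: primD)
  moreover have "associated k G i (Q, f) \<longleftrightarrow> f \<star> Br Q i = Br Q i \<and> Br Q i \<noteq> \<zero>\<^sub>A" if "primitive_for P e i" for i
    using that fixA_mono[OF QP] primD associated_iff[OF bp(1)] by (auto simp: primitive_for_def)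
  ultimately show ?thesis using bp QP unfolding brauer_le.simps brauer_pair_iff by blast
next
  case False
  then show ?thesis unfolding brauer_le.simps brauer_pair_iff by blast
qed

lemma Br_Br_zero: "Q \<subseteq> P \<Longrightarrow> Br Q a = \<zero>\<^sub>A \<Longrightarrow> Br P a = \<zero>\<^sub>A"
  by (metis Br_Br Br_zero)

text \<open>
  The element \<open>i e i\<close> of the local algebra of \<open>i\<close> maps to the idempotent \<open>e Br\<^sub>P(i)\<close>. As this is nonzero,
  \<open>i e i\<close> is invertible in that algebra, and then \<open>e\<close> acts as the identity on \<open>Br\<^sub>P(i)\<close>.
\<close>

lemma primitive_Br_block:
  assumes P: "grp.p_subgroup p P" and i: "prim (fixA P) i" and e: "block (C P) e"
    and ne: "e \<star> Br P i \<noteq> \<zero>\<^sub>A"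
  shows "e \<star> Br P i = Br P i"
proof -
  have Ps: "subgroup P G" "P \<subseteq> carrier G" using P p_subgroup_carrier by (auto simp: grp.p_subgroup_def)
  note CP = subgroup_C[OF Ps(2)]
  note B = subalg_fixA[OF Ps(2)]
  note eD = blockD[OF CP e]
  have ef: "e \<in> fixA P" using kC_fixA[OF Ps(1)] eD(2) by auto
  have i': "i \<in> fixA P" "i \<star> i = i" "i \<in> AC" using primD[OF i] fixA_D by auto
  have Bi: "Br P i \<in> kH (C P)" "Br P i \<in> AC" using Br_in_kC i' by auto
  have ei: "Br P i \<star> e = e \<star> Br P i" using eD(6)[OF Bi(1)] by simp
  have Bii: "Br P i \<star> Br P i = Br P i" using Br_mult[OF P i'(1) i'(1)] i' by simp
  let ?x = "i \<star> e \<star> i"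
  have xB: "i \<star> e \<in> fixA P" "?x \<in> fixA P" using subalgD(4)[OF B] i' ef by auto
  have "Br P ?x = Br P i \<star> e \<star> Br P i"
    using Br_mult[OF P xB(1) i'(1)] Br_mult[OF P i'(1) ef] Br_kC[OF eD(2)] by simp
  also have "\<dots> = e \<star> Br P i" unfolding ei using Bi eD(1) Bii by (simp add: mult_assoc)
  finally have Bx: "Br P ?x = e \<star> Br P i" .
  have idem: "e \<star> Br P i \<star> (e \<star> Br P i) = e \<star> Br P i"
  proof -
    have "e \<star> Br P i \<star> (e \<star> Br P i) = e \<star> (Br P i \<star> e) \<star> Br P i" using Bi eD(1) by (simp add: mult_assoc)
    also have "\<dots> = (e \<star> e) \<star> (Br P i \<star> Br P i)" unfolding ei using Bi eD(1) by (simp add: mult_assoc)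
    finally show ?thesis using Bii eD(4) by simp
  qed
  have "i \<star> ?x = ?x" "?x \<star> i = ?x"
    using i' eD(1) mult_assoc[of i i "e \<star> i"] by (simp_all add: mult_assoc)
  then have "Br P ?x = \<zero>\<^sub>A \<or> (\<exists>z\<in>fixA P. ?x \<star> z = i)"
    using primitive_corner_local[OF B i xB(2), of "Br P"] Br_mult[OF P] Br_zero idem Bx by metis
  then obtain z where z: "z \<in> fixA P" "?x \<star> z = i" using Bx ne by auto
  then have "Br P i = e \<star> Br P i \<star> Br P z" using Br_mult[OF P xB(2) z(1)] Bx by simp
  then have "e \<star> Br P i = e \<star> (e \<star> Br P i \<star> Br P z)" by simp
  also have "\<dots> = e \<star> e \<star> Br P i \<star> Br P z" using eD(1) Bi fixA_D(1)[OF z(1)] by (simp add: mult_assoc)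
  also have "\<dots> = Br P i" using eD(4) \<open>Br P i = e \<star> Br P i \<star> Br P z\<close> by simp
  finally show ?thesis .
qed

text \<open>
  In a decomposition of \<open>u\<close> into primitive idempotents, one of them is not killed by \<open>e\<close> after the Brauer
  map; by the preceding lemma it is associated to \<open>(P, e)\<close>.
\<close>

lemma primitive_for_below:
  assumes bp: "bpair P e" and u: "u \<in> fixA P" "u \<star> u = u" "e \<star> Br P u \<noteq> \<zero>\<^sub>A"
  obtains i where "primitive_for P e i" "u \<star> i = i" "i \<star> u = i"
proof -
  note bpD = bpairD[OF bp]
  have eA: "e \<in> AC" using blockD(1)[OF bpD(4,5)] .
  obtain i where i: "prim (fixA P) i" "u \<star> i = i" "i \<star> u = i" "e \<star> Br P i \<noteq> \<zero>\<^sub>A"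
  proof (rule primitive_below[OF subalg_fixA[OF bpD(3)] u(1,2), of "\<lambda>v. e \<star> Br P v \<noteq> \<zero>\<^sub>A"])
    fix j j' assume "j \<in> fixA P" "j' \<in> fixA P" "e \<star> Br P (j \<boxplus> j') \<noteq> \<zero>\<^sub>A"
    then show "e \<star> Br P j \<noteq> \<zero>\<^sub>A \<or> e \<star> Br P j' \<noteq> \<zero>\<^sub>A"
      using eA fixA_D(1)[of j] fixA_D(1)[of j'] by (auto simp: Br_add A.r_distr)
  qed (use u eA Br_zero in auto)
  then have "e \<star> Br P i = Br P i" using primitive_Br_block[OF bpD(1) i(1) bpD(5)] by simp
  then show ?thesis using that i by (auto simp: primitive_for_def)
qed

text \<open>
  The block \<open>e\<close> itself is an idempotent of \<open>(kG)\<^sup>P\<close> that the Brauer map fixes.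
\<close>

lemma primitive_for_exists:
  assumes bp: "bpair P e"
  obtains i where "primitive_for P e i"
proof -
  note bpD = bpairD[OF bp]
  note eD = blockD[OF bpD(4,5)]
  have "e \<in> fixA P" using kC_fixA[OF bpD(2)] eD(2) by auto
  moreover have "e \<star> Br P e \<noteq> \<zero>\<^sub>A" using Br_kC[OF eD(2)] eD(4,5) by simp
  ultimately show ?thesis using primitive_for_below[OF bp, of e] eD(4) that by blast
qed

text \<open>
  A central idempotent stays central under the Brauer map, since the group algebra of the smaller
  centralizer consists of fixed points.
\<close>

lemma Br_central:
  assumes R: "grp.p_subgroup p R" and QR: "Q \<subseteq> R" and f: "f \<in> Zc (C Q)" "f \<in> fixA R"
  shows "Br R f \<in> Zc (C R)"
proof -
  have Rs: "subgroup R G" using R by (simp add: grp.p_subgroup_def)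
  have fA: "f \<in> AC" using f by (simp add: fixA_D)
  have "Br R f \<star> a = a \<star> Br R f" if a: "a \<in> kH (C R)" for a
  proof -
    have aR: "a \<in> fixA R" using kC_fixA[OF Rs] a by auto
    have "f \<star> a = a \<star> f" using Zc_D(2)[OF f(1)] kC_mono[OF QR] a by auto
    then have "Br R f \<star> Br R a = Br R a \<star> Br R f"
      using Br_mult[OF R f(2) aR] Br_mult[OF R aR f(2)] by simp
    then show ?thesis using Br_kC[OF a] by simp
  qed
  then show ?thesis using Br_in_kC[OF fA] by (auto simp: Zc_def)
qed

text \<open>
  \<open>R\<close> permutes the blocks of \<open>C Q\<close>, whose sum is \<open>\<one>\<close>; on \<open>C R\<close> only the fixed ones contribute.
\<close>

lemma stable_block_exists:
  assumes R: "bpair R eR" and Q: "grp.p_subgroup p Q" "Q \<subseteq> R" "\<And>x. x \<in> R \<Longrightarrow> grp.cj x ` Q = Q"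
  obtains f where "block (C Q) f" "f \<in> fixA R" "Br R f \<star> eR = eR"
proof -
  note RD = bpairD[OF R]
  note eD = blockD[OF RD(4,5)]
  note CQ = p_subgroup_C[OF Q(1)]
  have QG: "Q \<subseteq> carrier G" using Q by (simp add: p_subgroup_carrier)
  let ?X = "{f. block (C Q) f}"
  let ?act = "\<lambda>x. twist (\<lambda>c. c) x"
  let ?F = "{f \<in> ?X. \<forall>x\<in>R. ?act x f = f}"
  have XA: "f \<in> AC" if "f \<in> ?X" for f using that blockD(1)[OF CQ] by auto
  have finX: "finite ?X" by (rule finite_blocks[OF CQ])
  have xQ: "grp.cj x ` C Q = C Q" if "x \<in> R" for x
    using that RD(3) Q(3) QG grp.centralizer_cj_image[of x Q] by (metis subsetD)
  have act: "grp.acts R ?act ?X"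
    unfolding grp.acts_def
  proof (intro conjI ballI)
    fix x f assume "x \<in> R" "f \<in> ?X"
    then show "?act x f \<in> ?X" using block_twist[OF id_iso _ CQ, of x f] RD(3) xQ by auto
  next
    fix f assume "f \<in> ?X"
    then show "?act \<one>\<^bsub>G\<^esub> f = f" using XA by (simp add: twist_one)
  next
    fix x y f assume "x \<in> R" "y \<in> R" "f \<in> ?X"
    then show "?act (x \<cdot> y) f = ?act x (?act y f)" using RD(3) by (simp add: twist_twist subset_iff)
  qed
  have FR: "f \<in> fixA R" if "f \<in> ?F" for f using that XA by (auto simp: fixA_twist[OF RD(3)])
  have "Br R (\<Oplus>\<^bsub>A\<^esub>f\<in>?F. f) = \<one>\<^sub>A"
  proof
    fix g
    show "Br R (\<Oplus>\<^bsub>A\<^esub>f\<in>?F. f) g = \<one>\<^sub>A g"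
    proof (cases "g \<in> C R")
      case True
      then have gG: "g \<in> carrier G" using centralizer_carrier by auto
      have "\<one>\<^sub>A g = (\<Oplus>f\<in>?X. f g)"
        using finsum_apply[OF finX, of "\<lambda>f. f" g] XA sum_blocks[OF CQ] by simp
      also have "\<dots> = (\<Oplus>f\<in>?F. f g)"
      proof (rule sum_fixed_points[OF RD(1) act finX])
        fix x f assume x: "x \<in> R" and f: "f \<in> ?X"
        have "grp.cj (inv\<^bsub>G\<^esub> x) g = g"
          using True x RD(2,3) gG grp.in_centralizer_iff_cj(1)[of R g] by (simp add: subgroup.m_inv_closed)
        then show "?act x f g = f g" using gG by (simp add: twist_apply)
      qed (use XA in auto)
      also have "\<dots> = (\<Oplus>\<^bsub>A\<^esub>f\<in>?F. f) g"
        using finX XA by (intro finsum_apply[symmetric]) auto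
      finally show ?thesis using True by (simp add: Br_apply)
    next
      case False
      then have "\<one>\<^sub>A g = \<zero>" using one_kH[OF RD(4)] RD(3) by (auto simp: in_kC)
      then show ?thesis using False by (simp add: Br_apply)
    qed
  qed
  moreover have "Br R (\<Oplus>\<^bsub>A\<^esub>f\<in>?F. f) = (\<Oplus>\<^bsub>A\<^esub>f\<in>?F. Br R f)"
  proof
    fix g
    have "(\<Oplus>\<^bsub>A\<^esub>f\<in>?F. Br R f) g = (\<Oplus>f\<in>?F. Br R f g)"
      using finX XA by (intro finsum_apply) auto
    moreover have "(\<Oplus>\<^bsub>A\<^esub>f\<in>?F. f) g = (\<Oplus>f\<in>?F. f g)"
      using finX XA by (intro finsum_apply) auto
    ultimately show "Br R (\<Oplus>\<^bsub>A\<^esub>f\<in>?F. f) g = (\<Oplus>\<^bsub>A\<^esub>f\<in>?F. Br R f) g"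
      by (simp add: Br_apply)
  qed
  ultimately have "eR = (\<Oplus>\<^bsub>A\<^esub>f\<in>?F. Br R f) \<star> eR" using A.l_one[OF eD(1)] by metis
  also have "\<dots> = (\<Oplus>\<^bsub>A\<^esub>f\<in>?F. Br R f \<star> eR)"
    using finX XA eD(1) by (intro A.finsum_ldistr) auto
  finally have sum: "eR = (\<Oplus>\<^bsub>A\<^esub>f\<in>?F. Br R f \<star> eR)" .
  have "\<exists>f\<in>?F. Br R f \<star> eR \<noteq> \<zero>\<^sub>A"
  proof (rule ccontr)
    assume "\<not> ?thesis"
    then have "(\<Oplus>\<^bsub>A\<^esub>f\<in>?F. Br R f \<star> eR) = \<zero>\<^sub>A" by (intro A.add.finprod_one_eqI) blast
    then show False using sum eD(5) by simp
  qed
  then obtain f where f: "f \<in> ?F" "Br R f \<star> eR \<noteq> \<zero>\<^sub>A" by blast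
  note fD = blockD[OF CQ, of f]
  have "Br R f \<in> Zc (C R)" using Br_central[OF RD(1) Q(2) _ FR[OF f(1)]] fD(3) f by auto
  moreover have "Br R f \<star> Br R f = Br R f"
    using Br_mult[OF RD(1) FR[OF f(1)] FR[OF f(1)]] fD(4) f by simp
  ultimately have "Br R f \<star> eR = eR" using block_central_idempotent[OF RD(4,5)] f by blast
  then show ?thesis using that f FR by blast
qed

text \<open>
  The step from the normalizer \<open>R\<close> of \<open>Q\<close> in \<open>P\<close> down to \<open>Q\<close>. The part \<open>j\<close> of \<open>Br Q i\<close> outside the
  \<open>R\<close>-stable block \<open>f\<close> dies under the Brauer maps of all larger \<open>p\<close>-subgroups of \<open>R\<close>. Hence it is
  the image of some \<open>y\<close> with \<open>Br P y = \<zero>\<close>; then \<open>i y i\<close> is not invertible in the local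
  algebra of \<open>i\<close>, and its idempotent image \<open>j\<close> vanishes.
\<close>

lemma subpair_exists:
  assumes bp: "bpair P e" and Q: "subgroup Q G" "Q \<subseteq> P"
  shows "\<exists>f. block (C Q) f \<and> (\<forall>i. primitive_for P e i \<longrightarrow> f \<star> Br Q i = Br Q i)"
  using Q
proof (induction "card P - card Q" arbitrary: Q rule: less_induct)
  case less
  note PD = bpairD[OF bp]
  have finP: "finite P" using PD(3) fin finite_subset by blast
  have Qp: "grp.p_subgroup p Q" using grp.p_subgroup_subgroup[OF prime_p fin PD(1)] less.prems by auto
  have QG: "Q \<subseteq> carrier G" using p_subgroup_carrier[OF Qp] .
  note CQ = subgroup_C[OF QG]
  show ?case
  proof (cases "Q = P")
    case True
    then show ?thesis using PD(5) by (auto simp: primitive_for_def)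
  next
    case False
    then have QP: "Q \<subset> P" using less.prems by auto
    define R where "R = grp.normalizer P Q"
    have RP: "R \<subseteq> P" by (auto simp: R_def grp.normalizer_def)
    have QR: "Q \<subset> R" unfolding R_def
      by (rule grp.p_group_normalizer_grows[OF prime_p fin PD(1) less.prems(1) QP])
    have Rs: "subgroup R G" unfolding R_def by (rule grp.normalizer_subgroup[OF PD(2) QG])
    have Rp: "grp.p_subgroup p R" using grp.p_subgroup_subgroup[OF prime_p fin PD(1) Rs RP] .
    have RG: "R \<subseteq> carrier G" using p_subgroup_carrier[OF Rp] .
    have bigger: "\<exists>f. block (C S) f \<and> (\<forall>i. primitive_for P e i \<longrightarrow> f \<star> Br S i = Br S i)"
      if S: "subgroup S G" "S \<subseteq> P" "Q \<subset> S" for S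
    proof -
      have "card Q < card S" "card S \<le> card P"
        using S finP by (auto intro: psubset_card_mono card_mono finite_subset)
      then show ?thesis using less.hyps[of S] S by simp
    qed
    obtain eR where eR: "block (C R) eR" "\<And>i. primitive_for P e i \<Longrightarrow> eR \<star> Br R i = Br R i"
      using bigger[OF Rs RP QR] by auto
    have bR: "bpair R eR" using Rp eR by (simp add: bpair_def)
    obtain f where f: "block (C Q) f" "f \<in> fixA R" "Br R f \<star> eR = eR"
    proof (rule stable_block_exists[OF bR Qp])
      show "Q \<subseteq> R" using QR by auto
      show "grp.cj x ` Q = Q" if "x \<in> R" for x using that by (simp add: R_def grp.normalizer_def)
    qed
    note fD = blockD[OF CQ f(1)]
    have "f \<star> Br Q i = Br Q i" if i: "primitive_for P e i" for i
    proof -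
      have ip: "prim (fixA P) i" and Bi: "Br P i \<noteq> \<zero>\<^sub>A" using i by (auto simp: primitive_for_def)
      have iD: "i \<in> fixA P" "i \<star> i = i" "i \<in> AC" using primD[OF ip] fixA_D by auto
      have iS: "i \<in> fixA S" if "S \<subseteq> P" for S using fixA_mono[OF that] iD by auto
      define i' where "i' = Br Q i"
      have i': "i' \<in> kH (C Q)" "i' \<in> fixA R" "i' \<in> AC"
        using Br_in_kC iD Br_fixA[OF QG PD(3) iD(1)] by (auto simp: i'_def R_def)
      have ii': "i' \<star> i' = i'" using Br_mult[OF Qp iS iS] QP iD by (auto simp: i'_def)
      have fi: "f \<star> i' = i' \<star> f" by (rule fD(6)[OF i'(1)])
      have fi_idem: "f \<star> i' \<star> (f \<star> i') = f \<star> i'" "i' \<star> (f \<star> i') = f \<star> i'" "f \<star> i' \<star> i' = f \<star> i'"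
      proof -
        show b: "f \<star> i' \<star> i' = f \<star> i'" using fD(1) i'(3) ii' by (simp add: mult_assoc)
        show c: "i' \<star> (f \<star> i') = f \<star> i'"
          using mult_assoc[of i' f i'] fD(1) i'(3) fi b by simp
        have "f \<star> i' \<star> (f \<star> i') = f \<star> (f \<star> i')"
          using mult_assoc[of f i' "f \<star> i'"] fD(1) i'(3) c by simp
        then show "f \<star> i' \<star> (f \<star> i') = f \<star> i'"
          using mult_assoc[of f f i'] fD(1,4) i'(3) by simp
      qed
      define j where "j = i' \<boxminus> f \<star> i'"
      have fiA: "f \<star> i' \<in> AC" using fD(1) i'(3) by simp
      note jc = idem_complement[OF i'(3) fiA ii' fi_idem(1,2,3), folded j_def]
      have j: "j \<in> kH (C Q)" "j \<in> fixA R"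
        unfolding j_def
        using subalgD(4,6)[OF subalg_kH[OF CQ]] subalgD(4,6)[OF subalg_fixA[OF RG]] i' fD(2) f(2) by auto
      (* by induction Br S i lies in one block eS; the idempotent Br S f contains eS, for otherwise f Br Q i
         would vanish under Br S and a fortiori under Br R *)
      have dead: "Br S j = \<zero>\<^sub>A" if S: "grp.p_subgroup p S" "Q \<subset> S" "S \<subseteq> R" for S
      proof -
        have Ss: "subgroup S G" "S \<subseteq> carrier G" using S p_subgroup_carrier by (auto simp: grp.p_subgroup_def)
        note CS = subgroup_C[OF Ss(2)]
        obtain eS where eS: "block (C S) eS" "\<And>i. primitive_for P e i \<Longrightarrow> eS \<star> Br S i = Br S i"
          using bigger[OF Ss(1) _ S(2)] S(3) RP by auto
        note eSD = blockD[OF CS eS(1)]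
        have fS: "f \<in> fixA S" "i' \<in> fixA S" using fixA_mono[OF S(3)] f i' by auto
        have Bi': "Br S i' = Br S i" unfolding i'_def using S(2) by (intro Br_Br) auto
        have Bfi: "Br S (f \<star> i') = Br S f \<star> Br S i" using Br_mult[OF S(1) fS] Bi' by simp
        have BA: "Br S f \<in> AC" "Br S i \<in> AC" using fD(1) iD by auto
        have Bfi2: "Br S f \<star> Br S i = Br S f \<star> eS \<star> Br S i"
          using mult_assoc[of "Br S f" eS "Br S i"] BA eSD(1) eS(2)[OF i] by simp
        have Z: "Br S f \<in> Zc (C S)" using Br_central[OF S(1) _ fD(3) fS(1)] S(2) by auto
        have "Br S f \<star> Br S f = Br S f" using Br_mult[OF S(1) fS(1) fS(1)] fD(4) by simp
        then consider "Br S f \<star> eS = \<zero>\<^sub>A" | "Br S f \<star> eS = eS"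
          using block_central_idempotent[OF CS eS(1) Z] by auto
        then show ?thesis
        proof cases
          case 1
          then have "Br S (f \<star> i') = \<zero>\<^sub>A" using Bfi Bfi2 BA by simp
          then have "Br R (f \<star> i') = \<zero>\<^sub>A" using Br_Br_zero[OF S(3)] by simp
          moreover have "Br R i' = Br R i" unfolding i'_def using QR by (intro Br_Br) auto
          moreover have "Br R f \<star> Br R i = Br R f \<star> eR \<star> Br R i"
            using mult_assoc[of "Br R f" eR "Br R i"] fD(1) iD(3) eR(2)[OF i] blockD(1)[OF subgroup_C[OF RG] eR(1)]
            by simp
          ultimately have "Br R i = \<zero>\<^sub>A" using Br_mult[OF Rp f(2) i'(2)] f(3) eR(2)[OF i] by simp
          then show ?thesis using Bi Br_Br_zero[OF RP] by auto
        next
          case 2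
          then have "Br S (f \<star> i') = Br S i'" using Bfi Bfi2 Bi' eS(2)[OF i] by simp
          then show ?thesis using i'(3) fiA by (simp add: j_def Br_minus)
        qed
      qed
      obtain y where y: "y \<in> fixA P" "Br Q y = j" "\<And>g. y g \<noteq> \<zero> \<Longrightarrow> \<exists>t\<in>P. j (grp.cj t g) \<noteq> \<zero>"
      proof (rule extend_from_centralizer[OF PD(2) Qp less.prems(2) j(1) j(2)[unfolded R_def]])
        fix S h assume "grp.p_subgroup p S" "Q \<subset> S" "S \<subseteq> grp.normalizer P Q" "h \<in> C S"
        then have "Br S j = \<zero>\<^sub>A" "h \<in> C S" using dead[of S] by (simp_all add: R_def)
        then show "j h = \<zero>" by (metis Br_apply zero_apply)
      qed blast
      (* y is supported on conjugates of the support of j, and j vanishes on the centralizer of R *)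
      have ByP: "Br P y = \<zero>\<^sub>A"
      proof
        fix g
        have "y g = \<zero>" if g: "g \<in> C P"
        proof (rule ccontr)
          assume "y g \<noteq> \<zero>"
          then obtain t where t: "t \<in> P" "j (grp.cj t g) \<noteq> \<zero>" using y(3) by auto
          have gG: "g \<in> carrier G" using g centralizer_carrier by auto
          have "grp.cj t g = g" using g t gG PD(3) grp.in_centralizer_iff_cj(1)[of P g] by auto
          moreover have "g \<in> C R" using g grp.centralizer_mono[OF RP] by auto
          ultimately have "Br R j g \<noteq> \<zero>" using t by (simp add: Br_apply)
          then show False using dead[OF Rp QR] by (simp add: zero_eq)
        qed
        then show "Br P y g = \<zero>\<^sub>A g" by (simp add: Br_apply zero_eq)
      qed
      let ?x = "i \<star> y \<star> i"
      have yA: "y \<in> AC" using y by (simp add: fixA_D)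
      note B = subalg_fixA[OF PD(3)]
      have xB: "i \<star> y \<in> fixA P" "?x \<in> fixA P" using subalgD(4)[OF B] iD y by auto
      have multS: "Br S (a \<star> b) = Br S a \<star> Br S b"
        if "S = P \<or> S = Q" "a \<in> fixA P" "b \<in> fixA P" for S a b
        using that(1)
      proof
        assume "S = Q"
        then show ?thesis using Br_mult[OF Qp] fixA_mono[OF less.prems(2)] that(2,3) by blast
      qed (use Br_mult[OF PD(1)] that in auto)
      have "Br Q ?x = i' \<star> j \<star> i'" using multS[of Q] xB iD y by (simp add: i'_def)
      also have "\<dots> = j" using jc by simp
      finally have BxQ: "Br Q ?x = j" .
      have "Br P ?x = Br P i \<star> \<zero>\<^sub>A \<star> Br P i" using multS[of P] xB iD y ByP by simp
      then have BxP: "Br P ?x = \<zero>\<^sub>A" using iD by simp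
      have "i \<star> ?x = ?x" "?x \<star> i = ?x"
        using iD yA mult_assoc[of i i "y \<star> i"] by (simp_all add: mult_assoc)
      then have "Br Q ?x = \<zero>\<^sub>A \<or> (\<exists>z\<in>fixA P. ?x \<star> z = i)"
        by (intro primitive_corner_local[OF B ip xB(2)]) (use multS[of Q] Br_zero BxQ jc in auto)
      moreover have "\<not> (\<exists>z\<in>fixA P. ?x \<star> z = i)"
      proof
        assume "\<exists>z\<in>fixA P. ?x \<star> z = i"
        then obtain z where z: "z \<in> fixA P" "?x \<star> z = i" by auto
        then have "Br P i = Br P ?x \<star> Br P z" using multS[of P ?x z] xB by simp
        then show False using BxP Bi fixA_D(1)[OF z(1)] by simp
      qed
      ultimately have "j = \<zero>\<^sub>A" using BxQ by auto
      then show ?thesis using minus_eq_zero[OF i'(3) fiA] by (simp add: j_def i'_def)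
    qed
    then show ?thesis using f(1) by auto
  qed
qed

end

declare brauer_le.simps [simp del] brauer_pair.simps [simp del] associated.simps [simp del]
  block_brauer_pair.simps [simp del]

context modular_group_algebra
begin

section \<open>The order on Brauer pairs\<close>

lemma block_eqI:
  assumes Q: "Q \<subseteq> carrier G" and f: "block (C Q) f" "block (C Q) f'"
    and a: "a \<in> AC" "f \<star> a \<noteq> \<zero>\<^sub>A" "f' \<star> a = a"
  shows "f = f'"
proof (rule ccontr)
  assume "f \<noteq> f'"
  then have "f \<star> f' = \<zero>\<^sub>A" by (rule blocks_orthogonal[OF subgroup_C[OF Q] f])
  moreover have "f \<star> f' \<star> a = f \<star> a"
    using mult_assoc[of f f' a] a blockD(1)[OF subgroup_C[OF Q]] f by simp
  ultimately show False using a by simp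
qed

lemma primitive_forD:
  assumes "bpair P e" "primitive_for P e i"
  shows "i \<in> fixA P" "i \<in> AC" "i \<star> i = i" "Br P i \<noteq> \<zero>\<^sub>A" "e \<star> Br P i = Br P i"
  using assms primD[of "fixA P" i] fixA_D by (auto simp: primitive_for_def)

lemma brauer_leD:
  assumes "brauer_le k G (Q, f) (P, e)"
  shows "bpair Q f" "bpair P e" "Q \<subseteq> P"
    "primitive_for P e i \<Longrightarrow> f \<star> Br Q i = Br Q i" "primitive_for P e i \<Longrightarrow> Br Q i \<noteq> \<zero>\<^sub>A"
  using assms by (auto simp: brauer_le_iff)

lemma brauer_le_exists:
  assumes bp: "bpair P e" and Q: "subgroup Q G" "Q \<subseteq> P"
  obtains f where "brauer_le k G (Q, f) (P, e)"
proof -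
  note PD = bpairD[OF bp]
  obtain f where f: "block (C Q) f" "\<And>i. primitive_for P e i \<Longrightarrow> f \<star> Br Q i = Br Q i"
    using subpair_exists[OF bp Q] by auto
  have "bpair Q f" using f grp.p_subgroup_subgroup[OF prime_p fin PD(1) Q] by (simp add: bpair_def)
  moreover have "Br Q i \<noteq> \<zero>\<^sub>A" if "primitive_for P e i" for i
    using Br_Br_zero[OF Q(2)] primitive_forD(4)[OF bp that] by auto
  ultimately show ?thesis using that bp Q f by (auto simp: brauer_le_iff)
qed

text \<open>
  A single primitive idempotent decides the order: some block of \<open>C Q\<close> contains \<open>Br\<^sub>Q(i)\<close> for all
  associated \<open>i\<close>, and a block that does not kill one of these must be that block.
\<close>

lemma brauer_leI:
  assumes bp: "bpair P e" "bpair Q f" "Q \<subseteq> P" and i: "primitive_for P e i" and ne: "f \<star> Br Q i \<noteq> \<zero>\<^sub>A"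
  shows "brauer_le k G (Q, f) (P, e)"
proof -
  note QD = bpairD[OF bp(2)]
  obtain f' where f': "brauer_le k G (Q, f') (P, e)" using brauer_le_exists[OF bp(1) QD(2) bp(3)] .
  note QD' = bpairD[OF brauer_leD(1)[OF f']]
  have "f = f'"
    using block_eqI[OF QD(3,5) QD'(5) _ ne] brauer_leD(4)[OF f' i] primitive_forD(2)[OF bp(1) i] by simp
  then show ?thesis using f' by simp
qed

lemma brauer_le_unique:
  assumes "brauer_le k G (Q, f) (P, e)" "brauer_le k G (Q, f') (P, e)"
  shows "f = f'"
proof -
  note D = brauer_leD[OF assms(1)] and D' = brauer_leD[OF assms(2)]
  note QD = bpairD[OF D(1)]
  obtain i where i: "primitive_for P e i" using primitive_for_exists[OF D(2)] .
  have "f \<star> Br Q i \<noteq> \<zero>\<^sub>A" using D(4,5)[OF i] by simp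
  then show ?thesis
    using block_eqI[OF QD(3,5) bpairD(5)[OF D'(1)] _ _ D'(4)[OF i]] primitive_forD(2)[OF D(2) i] by simp
qed

text \<open>
  Choose a primitive idempotent \<open>j\<close> of \<open>(kG)\<^sup>Q\<close> associated to \<open>(Q, f)\<close> below some \<open>i\<close> associated to
  \<open>(P, e)\<close>. As \<open>g\<close> does not kill \<open>Br\<^sub>S(j)\<close>, it does not kill \<open>Br\<^sub>S(i)\<close>.
\<close>

lemma brauer_le_trans:
  assumes "brauer_le k G (S, g) (Q, f)" "brauer_le k G (Q, f) (P, e)"
  shows "brauer_le k G (S, g) (P, e)"
proof -
  note D = brauer_leD[OF assms(1)] and D' = brauer_leD[OF assms(2)]
  note SD = bpairD[OF D(1)]
  obtain i where i: "primitive_for P e i" using primitive_for_exists[OF D'(2)] .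
  note iD = primitive_forD[OF D'(2) i]
  have iQ: "i \<in> fixA Q" using fixA_mono[OF D'(3)] iD by auto
  obtain j where j: "primitive_for Q f j" "i \<star> j = j"
    using primitive_for_below[OF D(2) iQ iD(3)] D'(4,5)[OF i] by metis
  note jD = primitive_forD[OF D(2) j(1)]
  have S: "i \<in> fixA S" "j \<in> fixA S" using fixA_mono[OF D(3)] iQ jD by auto
  have gA: "g \<in> AC" using blockD(1)[OF SD(4,5)] .
  have "Br S i \<star> Br S j = Br S j" using Br_mult[OF SD(1) S] j by simp
  then have "g \<star> Br S i \<star> Br S j = Br S j"
    using mult_assoc[of g "Br S i" "Br S j"] gA iD(2) jD(2) D(4)[OF j(1)] by simp
  then have "g \<star> Br S i \<noteq> \<zero>\<^sub>A" using D(5)[OF j(1)] jD(2) by auto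
  then show ?thesis using brauer_leI[OF D'(2) D(1) _ i] D(3) D'(3) by auto
qed

lemma brauer_le_subpair:
  assumes "brauer_le k G (Q, f) (P, e)" "brauer_le k G (R, r) (P, e)" "Q \<subseteq> R"
  shows "brauer_le k G (Q, f) (R, r)"
proof -
  obtain f' where f': "brauer_le k G (Q, f') (R, r)"
    using brauer_le_exists[OF brauer_leD(1)[OF assms(2)] bpairD(2)[OF brauer_leD(1)[OF assms(1)]] assms(3)] .
  then show ?thesis
    using brauer_le_unique[OF assms(1) brauer_le_trans[OF f' assms(2)]] by simp
qed

text \<open>
  When \<open>P\<close> normalizes \<open>Q\<close>, the order has a description without idempotents of \<open>(kG)\<^sup>P\<close>: if \<open>f\<close> killed
  \<open>Br\<^sub>Q(i)\<close>, then \<open>Br\<^sub>P(f)\<close> and hence \<open>e\<close> would kill \<open>Br\<^sub>P(i)\<close>.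
\<close>

lemma brauer_le_of_stable:
  assumes bp: "bpair P e" "bpair Q f" and Q: "Q \<subseteq> P" "\<And>x. x \<in> P \<Longrightarrow> grp.cj x ` Q = Q"
    and f: "f \<in> fixA P" "Br P f \<star> e = e"
  shows "brauer_le k G (Q, f) (P, e)"
proof -
  note PD = bpairD[OF bp(1)] and QD = bpairD[OF bp(2)]
  obtain i where i: "primitive_for P e i" using primitive_for_exists[OF bp(1)] .
  note iD = primitive_forD[OF bp(1) i]
  have "grp.normalizer P Q = P" using Q(2) by (auto simp: grp.normalizer_def)
  then have BQ: "Br Q i \<in> fixA P" using Br_fixA[OF QD(3) PD(3) iD(1)] by simp
  have "Br P (f \<star> Br Q i) = Br P f \<star> Br P i"
    using Br_mult[OF PD(1) f(1) BQ] Br_Br[OF Q(1)] by simp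
  also have "\<dots> = Br P f \<star> e \<star> Br P i"
    using mult_assoc[of "Br P f" e "Br P i"] iD fixA_D(1)[OF f(1)] blockD(1)[OF PD(4,5)] by simp
  also have "\<dots> = Br P i" using f iD by simp
  finally have "f \<star> Br Q i \<noteq> \<zero>\<^sub>A" using iD(4) Br_zero by metis
  then show ?thesis by (rule brauer_leI[OF bp Q(1) i])
qed

lemma bpair_twist:
  assumes g: "\<gamma> \<in> ring_iso k k" "x \<in> carrier G" and bp: "bpair P e"
  shows "bpair (grp.cj x ` P) (twist \<gamma> x e)"
proof -
  note PD = bpairD[OF bp]
  show ?thesis
    using block_twist[OF g PD(4,5)] grp.p_subgroup_cj[OF PD(1) g(2)] grp.centralizer_cj_image[OF g(2) PD(3)]
    by (simp add: bpair_def)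
qed

lemma brauer_le_twist:
  assumes g: "\<gamma> \<in> ring_iso k k" "x \<in> carrier G" and le: "brauer_le k G (Q, f) (P, e)"
  shows "brauer_le k G (grp.cj x ` Q, twist \<gamma> x f) (grp.cj x ` P, twist \<gamma> x e)"
proof -
  note D = brauer_leD[OF le]
  note PD = bpairD[OF D(2)] and QD = bpairD[OF D(1)]
  obtain i where i: "primitive_for P e i" using primitive_for_exists[OF D(2)] .
  note iD = primitive_forD[OF D(2) i]
  have eA: "e \<in> AC" "f \<in> AC" using blockD(1)[OF PD(4,5)] blockD(1)[OF QD(4,5)] .
  have "primitive_for (grp.cj x ` P) (twist \<gamma> x e) (twist \<gamma> x i)"
    unfolding primitive_for_def
  proof (intro conjI)
    show "prim (fixA (grp.cj x ` P)) (twist \<gamma> x i)"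
      using prim_fixA_twist[OF g PD(3)] i by (simp add: primitive_for_def)
    show "twist \<gamma> x e \<star> Br (grp.cj x ` P) (twist \<gamma> x i) = Br (grp.cj x ` P) (twist \<gamma> x i)"
      using g PD(3) iD eA by (simp flip: Br_twist twist_mult)
    show "Br (grp.cj x ` P) (twist \<gamma> x i) \<noteq> \<zero>\<^sub>A"
      using g PD(3) iD by (simp add: twist_eq_zero flip: Br_twist)
  qed
  moreover have "twist \<gamma> x f \<star> Br (grp.cj x ` Q) (twist \<gamma> x i) \<noteq> \<zero>\<^sub>A"
    using g QD(3) iD eA D(4,5)[OF i] by (simp add: twist_eq_zero flip: Br_twist twist_mult)
  ultimately show ?thesis
    using D(3) by (intro brauer_leI[OF bpair_twist[OF g D(2)] bpair_twist[OF g D(1)]]) auto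
qed

abbreviation cg :: "'g \<Rightarrow> ('g \<Rightarrow> 'l) \<Rightarrow> ('g \<Rightarrow> 'l)" where "cg \<equiv> twist (\<lambda>c. c)"

abbreviation stab :: "'g set \<Rightarrow> ('g \<Rightarrow> 'l) \<Rightarrow> 'g set"
  where "stab P a \<equiv> {h \<in> carrier G. grp.cj h ` P = P \<and> cg h a = a}"

lemma cg_mult: "x \<in> carrier G \<Longrightarrow> y \<in> carrier G \<Longrightarrow> cg (x \<cdot> y) a = cg x (cg y a)"
  by (simp add: twist_twist)

lemma cg_cancel [simp]:
  assumes "x \<in> carrier G" "a \<in> AC"
  shows "cg (inv\<^bsub>G\<^esub> x) (cg x a) = a" "cg x (cg (inv\<^bsub>G\<^esub> x) a) = a"
  using assms by (simp_all add: twist_one flip: cg_mult)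

lemmas brauer_le_cg = brauer_le_twist[OF id_iso]

lemma bpair_AC: "bpair P e \<Longrightarrow> e \<in> AC"
  using blockD(1)[OF bpairD(4,5)] .

lemma bpair_fixA: "bpair P e \<Longrightarrow> e \<in> fixA P"
  using kC_fixA[OF bpairD(2)] blockD(2)[OF bpairD(4,5)] by blast

lemma bpair_cg_self: "bpair P e \<Longrightarrow> x \<in> P \<Longrightarrow> cg x e = e"
  using bpair_fixA[of P e] bpairD(3)[of P e] by (simp add: fixA_twist)

lemma brauer_le_cg_self:
  assumes "brauer_le k G (Q, f) (P, e)" "x \<in> P"
  shows "brauer_le k G (grp.cj x ` Q, cg x f) (P, e)"
proof -
  note PD = bpairD[OF brauer_leD(2)[OF assms(1)]]
  have "x \<in> carrier G" using assms PD by auto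
  from brauer_le_cg[OF this assms(1)] show ?thesis
    using grp.cj_image_self[OF PD(2) assms(2)] bpair_cg_self[OF brauer_leD(2)[OF assms(1)] assms(2)] by simp
qed


subsection \<open>Brauer pairs of a block\<close>

lemma C_one: "C {\<one>\<^bsub>G\<^esub>} = carrier G"
  by (auto simp: centralizer_def)

lemma bpair_one: "block (carrier G) b \<Longrightarrow> bpair {\<one>\<^bsub>G\<^esub>} b"
  using grp.triv_subgroup by (auto simp: bpair_def C_one grp.p_subgroup_def intro: exI[of _ 0])

lemma block_fixA: "block (carrier G) b \<Longrightarrow> P \<subseteq> carrier G \<Longrightarrow> b \<in> fixA P"
  using primD(1)[of "Zc (carrier G)" b] fixA_mono[of P "carrier G"] Zc_carrier by auto

lemma block_cg: "block (carrier G) b \<Longrightarrow> x \<in> carrier G \<Longrightarrow> cg x b = b"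
  using block_fixA[of b "carrier G"] by (simp add: fixA_twist)

text \<open>
  A block \<open>b\<close> of \<open>kG\<close> is the Brauer pair \<open>(1, b)\<close>, and the Brauer pairs of \<open>b\<close> are those above it. So
  membership in \<open>b\<close> passes up and down the order by transitivity and uniqueness.
\<close>

lemma block_brauer_pair_iff:
  assumes b: "block (carrier G) b"
  shows "block_brauer_pair k G b (P, e) \<longleftrightarrow> brauer_le k G ({\<one>\<^bsub>G\<^esub>}, b) (P, e)"
proof (cases "bpair P e")
  case True
  note PD = bpairD[OF True]
  note eD = blockD[OF PD(4,5)]
  have bP: "b \<in> fixA P" using block_fixA[OF b PD(3)] .
  have bA: "b \<in> AC" using bP by (rule fixA_D)
  have one: "\<one>\<^bsub>G\<^esub> \<in> P" using PD(2) by (rule subgroup.one_closed)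
  have "block_brauer_pair k G b (P, e) \<longleftrightarrow> Br P b \<star> e = e"
    using True centralizer_algebra_mult[OF PD(3) Br_in_kC[OF bA] eD(2)]
    unfolding block_brauer_pair.simps brauer_pair_iff by simp
  also have "\<dots> \<longleftrightarrow> brauer_le k G ({\<one>\<^bsub>G\<^esub>}, b) (P, e)"
  proof
    assume "Br P b \<star> e = e"
    then show "brauer_le k G ({\<one>\<^bsub>G\<^esub>}, b) (P, e)"
      using one PD(3) by (intro brauer_le_of_stable[OF True bpair_one[OF b] _ _ bP]) auto
  next
    assume le: "brauer_le k G ({\<one>\<^bsub>G\<^esub>}, b) (P, e)"
    obtain i where i: "primitive_for P e i" using primitive_for_exists[OF True] .
    note iD = primitive_forD[OF True i]
    have "Br {\<one>\<^bsub>G\<^esub>} i = i" using iD(2) C_one Br_kC[of i "{\<one>\<^bsub>G\<^esub>}"] by simp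
    then have "b \<star> i = i" using brauer_leD(4)[OF le i] by simp
    then have "Br P b \<star> Br P i = Br P i" using Br_mult[OF PD(1) bP iD(1)] by simp
    then have "Br P b \<star> e \<star> Br P i = Br P i"
      using mult_assoc[of "Br P b" e "Br P i"] bA eD(1) iD by simp
    then have "Br P b \<star> e \<noteq> \<zero>\<^sub>A" using iD by auto
    moreover have "Br P b \<in> Zc (C P)"
      using Br_central[OF PD(1) _ _ bP, of "{\<one>\<^bsub>G\<^esub>}"] one b by (simp add: C_one primD)
    moreover have "Br P b \<star> Br P b = Br P b" using Br_mult[OF PD(1) bP bP] b primD(2) by simp
    ultimately show "Br P b \<star> e = e" using block_central_idempotent[OF PD(4,5)] by blast
  qed
  finally show ?thesis .
next
  case False
  then show ?thesis
    using brauer_leD(2)[of "{\<one>\<^bsub>G\<^esub>}" b P e] unfolding block_brauer_pair.simps brauer_pair_iff by blast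
qed

lemma maximalD:
  assumes b: "block (carrier G) b" and max: "maximal_brauer_pair k G b (P, e)"
  shows "brauer_le k G ({\<one>\<^bsub>G\<^esub>}, b) (P, e)" "brauer_le k G (P, e) (S, g) \<Longrightarrow> S = P"
proof -
  show le: "brauer_le k G ({\<one>\<^bsub>G\<^esub>}, b) (P, e)"
    using max block_brauer_pair_iff[OF b] unfolding maximal_brauer_pair_def by blast
  assume "brauer_le k G (P, e) (S, g)"
  moreover from this have "block_brauer_pair k G b (S, g)"
    using brauer_le_trans[OF le] block_brauer_pair_iff[OF b] by blast
  ultimately show "S = P" using max unfolding maximal_brauer_pair_def by blast
qed

text \<open>
  Let \<open>\<Omega>\<close> be the set of \<open>N\<^sub>G(P)\<close>-conjugates of \<open>e\<close>. If the Brauer map of a larger \<open>p\<close>-subgroup did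
  not kill a fixed element of \<open>\<Omega>\<close>, it would give a larger Brauer pair. So the sum of \<open>\<Omega>\<close> is the
  image of a central element \<open>y\<close> of the group algebra. Since \<open>Z(kG) b\<close> is local and \<open>b y\<close> is not
  nilpotent, \<open>b y\<close> divides \<open>b\<close>, and \<open>Br P b\<close> is a multiple of the sum of \<open>\<Omega>\<close>.
\<close>

lemma maximal_pairs_conjugate:
  assumes b: "block (carrier G) b" and max: "maximal_brauer_pair k G b (P, e)"
    and e': "brauer_le k G ({\<one>\<^bsub>G\<^esub>}, b) (P, e')"
  obtains n where "n \<in> carrier G" "grp.cj n ` P = P" "cg n e = e'"
proof -
  note maxD = maximalD[OF b max]
  have bpe: "bpair P e" using brauer_leD[OF maxD(1)] by simp
  have bpe': "bpair P e'" using brauer_leD[OF e'] by simp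
  note PD = bpairD[OF bpe]
  note eD = blockD[OF PD(4,5)] and eD' = blockD[OF PD(4) bpairD(5)[OF bpe']]
  define N where "N = grp.normalizer (carrier G) P"
  have NG: "N \<subseteq> carrier G" by (auto simp: N_def grp.normalizer_def)
  have Ns: "subgroup N G" unfolding N_def by (rule grp.normalizer_subgroup[OF grp.subgroup_self PD(3)])
  have NP: "grp.cj n ` P = P" if "n \<in> N" for n using that by (simp add: N_def grp.normalizer_def)
  define \<Omega> where "\<Omega> = (\<lambda>n. cg n e) ` N"
  have leO: "brauer_le k G ({\<one>\<^bsub>G\<^esub>}, b) (P, f)" if f: "f \<in> \<Omega>" for f
  proof -
    obtain n where n: "n \<in> N" "f = cg n e" using f by (auto simp: \<Omega>_def)
    then show ?thesis using brauer_le_cg[OF _ maxD(1), of n] NG NP block_cg[OF b] by auto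
  qed
  have bpO: "bpair P f" if "f \<in> \<Omega>" for f using leO[OF that] by (rule brauer_leD)
  have blO: "block (C P) f" if "f \<in> \<Omega>" for f using bpairD(5)[OF bpO[OF that]] .
  have OA: "f \<in> AC" if "f \<in> \<Omega>" for f using bpair_AC bpO that by blast
  have finO: "finite \<Omega>" using blO finite_blocks[OF PD(4)] by (intro finite_subset[of \<Omega>]) auto
  have eO: "e \<in> \<Omega>" unfolding \<Omega>_def
    using subgroup.one_closed[OF Ns] twist_one[OF eD(1)] by (metis imageI)
  have actO: "cg n f \<in> \<Omega>" if n: "n \<in> N" and f: "f \<in> \<Omega>" for n f
  proof -
    obtain m where m: "m \<in> N" "f = cg m e" using f by (auto simp: \<Omega>_def)
    then have "cg n f = cg (n \<cdot> m) e" using n NG by (simp add: cg_mult subset_iff)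
    then show ?thesis using n m Ns by (auto simp: \<Omega>_def subgroup.m_closed)
  qed
  define s where "s = (\<Oplus>\<^bsub>A\<^esub>f\<in>\<Omega>. f)"
  have s_apply: "s g = (\<Oplus>f\<in>\<Omega>. f g)" for g unfolding s_def using finO OA by (intro finsum_apply) auto
  have skC: "s \<in> kH (C P)"
    unfolding s_def using finO blockD(2)[OF PD(4) blO] by (intro subalg_finsum subalg_kH PD(4)) auto
  have sA: "s \<in> AC" using skC kC_AC by auto
  have sf: "s \<star> f = f" if f: "f \<in> \<Omega>" for f
  proof -
    have "s \<star> f = (\<Oplus>\<^bsub>A\<^esub>h\<in>\<Omega>. h \<star> f)" unfolding s_def using finO OA f by (intro A.finsum_ldistr) auto
    also have "\<dots> = f \<star> f"
      using finO OA f blocks_orthogonal[OF PD(4) blO blO[OF f]] by (intro A.finsum_delta) auto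
    finally show ?thesis using blockD(4)[OF PD(4) blO[OF f]] by simp
  qed
  have ss: "s \<star> s = s"
  proof -
    have "s \<star> s = (\<Oplus>\<^bsub>A\<^esub>f\<in>\<Omega>. s \<star> f)"
      using A.finsum_rdistr[OF finO sA, of "\<lambda>f. f"] OA by (simp add: s_def[symmetric])
    also have "\<dots> = s" unfolding s_def using sf OA by (intro A.finsum_cong') (auto simp: s_def)
    finally show ?thesis .
  qed
  have sfix: "s \<in> fixA N"
  proof -
    have "s (grp.cj x g) = s g" if x: "x \<in> N" and g: "g \<in> carrier G" for x g
    proof -
      have xG: "x \<in> carrier G" "inv\<^bsub>G\<^esub> x \<in> N" using x NG Ns by (auto simp: subgroup.m_inv_closed)
      have bij: "bij_betw (cg (inv\<^bsub>G\<^esub> x)) \<Omega> \<Omega>"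
        by (rule bij_betwI[where g = "cg x"]) (use actO xG x OA in auto)
      have "s (grp.cj x g) = (\<Oplus>f\<in>\<Omega>. cg (inv\<^bsub>G\<^esub> x) f g)"
        unfolding s_apply using xG g OA by (intro finsum_cong') (auto simp: twist_apply)
      also have "\<dots> = s g" unfolding s_apply using OA by (intro finsum_bij[symmetric] bij) auto
      finally show ?thesis .
    qed
    then show ?thesis using sA by (simp add: fixA_def)
  qed
  (* a block of C S under Br S f would give a pair above (P, f), a conjugate of the maximal pair (P, e) *)
  have Br_dead: "Br S f = \<zero>\<^sub>A"
    if S: "grp.p_subgroup p S" "P \<subset> S" "S \<subseteq> N" and f: "f \<in> \<Omega>" "f \<in> fixA S" for S f
  proof (rule ccontr)
    assume ne: "Br S f \<noteq> \<zero>\<^sub>A"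
    have SG: "S \<subseteq> carrier G" using S NG by auto
    note CS = subgroup_C[OF SG]
    note fD = blockD[OF PD(4) blO[OF f(1)]]
    have Z: "Br S f \<in> Zc (C S)" using Br_central[OF S(1) _ fD(3) f(2)] S(2) by auto
    have idem: "Br S f \<star> Br S f = Br S f" using Br_mult[OF S(1) f(2) f(2)] fD(4) by simp
    obtain g where g: "block (C S) g" "Br S f \<star> g = g"
      by (rule primitive_below[OF subalg_Zc[OF CS] Z idem, of "\<lambda>v. v \<noteq> \<zero>\<^sub>A"]) (use ne in auto)
    have bpg: "bpair S g" using S(1) g by (simp add: bpair_def)
    have le: "brauer_le k G (P, f) (S, g)"
      using S NP by (intro brauer_le_of_stable[OF bpg bpO[OF f(1)] _ _ f(2) g(2)]) auto
    obtain n where n: "n \<in> N" "f = cg n e" using f by (auto simp: \<Omega>_def)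
    have nG: "n \<in> carrier G" "inv\<^bsub>G\<^esub> n \<in> N" using n NG Ns by (auto simp: subgroup.m_inv_closed)
    have "brauer_le k G (P, e) (grp.cj (inv\<^bsub>G\<^esub> n) ` S, cg (inv\<^bsub>G\<^esub> n) g)"
      using brauer_le_cg[OF _ le, of "inv\<^bsub>G\<^esub> n"] nG NP[OF nG(2)] n eD(1) by simp
    then have "grp.cj (inv\<^bsub>G\<^esub> n) ` S = P" by (rule maxD(2))
    then have "card S = card P" using nG SG by (metis grp.card_cj_image grp.inv_closed)
    moreover have "card P < card S" using S(2) SG fin finite_subset by (intro psubset_card_mono) auto
    ultimately show False by simp
  qed
  obtain y where y: "y \<in> fixA (carrier G)" "Br P y = s"
  proof (rule extend_from_centralizer[OF grp.subgroup_self PD(1,3) skC sfix[unfolded N_def]])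
    fix S h assume S: "grp.p_subgroup p S" "P \<subset> S" "S \<subseteq> grp.normalizer (carrier G) P" and h: "h \<in> C S"
    have SN: "S \<subseteq> N" using S by (simp add: N_def)
    have SG: "S \<subseteq> carrier G" and Ss: "subgroup S G" using SN NG S by (auto simp: grp.p_subgroup_def)
    have hG: "h \<in> carrier G" using h centralizer_carrier by auto
    have act: "grp.acts S cg \<Omega>"
      using actO SN SG OA by (auto simp: grp.acts_def twist_one cg_mult subset_iff)
    have "s h = (\<Oplus>f\<in>{f \<in> \<Omega>. \<forall>x\<in>S. cg x f = f}. f h)"
      unfolding s_apply
    proof (rule sum_fixed_points[OF S(1) act finO])
      fix x f assume x: "x \<in> S"
      have "grp.cj (inv\<^bsub>G\<^esub> x) h = h"
        using h x hG SG Ss grp.in_centralizer_iff_cj(1)[of S h] by (simp add: subgroup.m_inv_closed)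
      then show "cg x f h = f h" using hG by (simp add: twist_apply)
    qed (use OA in auto)
    also have "\<dots> = \<zero>"
    proof (rule add.finprod_one_eqI)
      fix f assume f: "f \<in> {f \<in> \<Omega>. \<forall>x\<in>S. cg x f = f}"
      then have "f \<in> fixA S" using OA SG by (auto simp: fixA_twist)
      then have "Br S f = \<zero>\<^sub>A" using Br_dead[OF S(1,2) SN] f by auto
      then show "f h = \<zero>" using h by (metis Br_apply zero_apply)
    qed
    finally show "s h = \<zero>" .
  qed blast
  have B: "subalg (fixA (carrier G))" by (intro subalg_fixA) auto
  have bprim: "prim (fixA (carrier G)) b" using b by (simp add: Zc_carrier)
  have bfix: "b \<in> fixA (carrier G)" "b \<in> AC" "b \<star> b = b" using primD[OF bprim] fixA_D by auto
  have bc: "a \<star> b = b \<star> a" if "a \<in> AC" for a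
    using that Zc_D(2)[of b "carrier G" a] bfix Zc_carrier by simp
  have yA: "y \<in> AC" using y fixA_D by auto
  have multP: "Br P (a \<star> c) = Br P a \<star> Br P c" if "a \<in> fixA (carrier G)" "c \<in> fixA (carrier G)" for a c
    using that fixA_mono[OF PD(3)] Br_mult[OF PD(1)] by auto
  have bO: "Br P b \<star> f = f" if "f \<in> \<Omega> \<or> f = e'" for f
  proof -
    have le: "brauer_le k G ({\<one>\<^bsub>G\<^esub>}, b) (P, f)" using that leO e' by auto
    have "f \<in> kH (C P)" using that blockD(2)[OF PD(4) blO] eD'(2) by auto
    then show ?thesis
      using le block_brauer_pair_iff[OF b, of P f] centralizer_algebra_mult[OF PD(3) Br_in_kC[OF bfix(2)]]
      unfolding block_brauer_pair.simps by simp
  qed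
  have xB: "b \<star> y \<in> fixA (carrier G)" using subalgD(4)[OF B] bfix y by auto
  have Bx: "Br P (b \<star> y) = s"
  proof -
    have "Br P (b \<star> y) = Br P b \<star> s" using multP bfix y by simp
    also have "\<dots> = (\<Oplus>\<^bsub>A\<^esub>f\<in>\<Omega>. Br P b \<star> f)"
      unfolding s_def using finO OA bfix by (intro A.finsum_rdistr) auto
    also have "\<dots> = s" unfolding s_def using bO OA by (intro A.finsum_cong') auto
    finally show ?thesis .
  qed
  have "Br P (b \<star> y) = \<zero>\<^sub>A \<or> (\<exists>z\<in>fixA (carrier G). b \<star> y \<star> z = b)"
  proof (rule primitive_corner_local[OF B bprim xB])
    show "b \<star> (b \<star> y) = b \<star> y" using mult_assoc[of b b y] bfix yA by simp
    show "b \<star> y \<star> b = b \<star> y" using bc[of "b \<star> y"] mult_assoc[of b b y] bfix yA by simp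
  qed (use multP Br_zero Bx ss in auto)
  moreover have "s \<noteq> \<zero>\<^sub>A" using sf[OF eO] eD(1,5) by auto
  ultimately obtain z where z: "z \<in> fixA (carrier G)" "b \<star> y \<star> z = b" using Bx by auto
  then have Bb: "Br P b = s \<star> Br P z" using multP[OF xB z(1)] Bx by simp
  have "e' \<in> \<Omega>"
  proof (rule ccontr)
    assume n: "e' \<notin> \<Omega>"
    have "e' \<star> s = (\<Oplus>\<^bsub>A\<^esub>f\<in>\<Omega>. e' \<star> f)"
      unfolding s_def using finO OA eD'(1) by (intro A.finsum_rdistr) auto
    also have "\<dots> = \<zero>\<^sub>A"
      using n blO blocks_orthogonal[OF PD(4) bpairD(5)[OF bpe']] by (intro A.add.finprod_one_eqI) metis
    finally have "e' \<star> s = \<zero>\<^sub>A" .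
    then have "e' \<star> Br P b = \<zero>\<^sub>A"
      using mult_assoc[of e' s "Br P z"] eD'(1) sA fixA_D(1)[OF z(1)] by (simp add: Bb)
    moreover have "e' \<star> Br P b = e'" using eD'(6)[OF Br_in_kC[OF bfix(2)]] bO by simp
    ultimately show False using eD'(5) by simp
  qed
  then obtain n where "n \<in> N" "cg n e = e'" by (auto simp: \<Omega>_def)
  then show ?thesis using that NG NP by blast
qed

end

section \<open>Fusion systems of Brauer pairs\<close>

lemma (in group) subgroup_restrict_iff:
  "subgroup P G \<Longrightarrow> subgroup Q (G\<lparr>carrier := P\<rparr>) \<longleftrightarrow> subgroup Q G \<and> Q \<subseteq> P"
  using subgroup_incl[of Q P] incl_subgroup[of P Q] subgroup.subset[of Q "G\<lparr>carrier := P\<rparr>"] by auto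

lemma (in group) restrict_cj_in_group_homs:
  assumes x: "x \<in> carrier G" and Q: "subgroup Q G" and R: "cj x ` Q \<subseteq> R"
  shows "restrict (cj x) Q \<in> group_homs G Q R"
proof -
  have "Q \<subseteq> carrier G" using Q by (rule subgroup.subset)
  then show ?thesis
    using x R subgroup.m_closed[OF Q] by (auto simp: group_homs_def hom_def cj_hom subset_iff)
qed

lemma (in group) inverse_restrict_cj:
  assumes x: "x \<in> carrier G" and Q: "Q \<subseteq> carrier G"
  shows "restrict (inv_into Q (restrict (cj x) Q)) (cj x ` Q) = restrict (cj (inv x)) (cj x ` Q)"
proof (rule restrict_ext)
  fix v assume "v \<in> cj x ` Q"
  then obtain u where u: "u \<in> Q" "v = cj x u" by auto
  have "inj_on (restrict (cj x) Q) Q" using inj_on_cj[OF x Q] by (simp add: inj_on_restrict_eq)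
  from inv_into_f_f[OF this u(1)] have "inv_into Q (restrict (cj x) Q) v = u" using u by simp
  moreover have "cj (inv x) v = u" using u x Q by auto
  ultimately show "inv_into Q (restrict (cj x) Q) v = cj (inv x) v" by simp
qed

lemma (in group) compose_restrict_cj:
  assumes "x \<in> carrier G" "y \<in> carrier G" "Q \<subseteq> carrier G" "cj x ` Q \<subseteq> R"
  shows "compose Q (restrict (cj y) R) (restrict (cj x) Q) = restrict (cj (y \<otimes> x)) Q"
  using assms by (intro extensionalityI[of _ Q]) (auto simp: compose_def cj_mult subset_iff)

context modular_group_algebra
begin

lemma conj_pair_eq: "x \<in> carrier G \<Longrightarrow> a \<in> AC \<Longrightarrow> conj_pair k G x (Q, a) = (grp.cj x ` Q, cg x a)"
  by (simp add: grp.conj_set_eq conj_elem_eq)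

lemma subpair_eq:
  assumes "brauer_le k G (Q, f) (P, e)"
  shows "subpair k G (P, e) Q = (Q, f)"
proof -
  have "block_idempotent k (G\<lparr>carrier := C Q\<rparr>) f"
    using brauer_leD(1)[OF assms] unfolding brauer_pair_iff[symmetric] brauer_pair.simps by blast
  then have "(THE f. block_idempotent k (G\<lparr>carrier := C Q\<rparr>) f \<and> brauer_le k G (Q, f) (P, e)) = f"
    using assms brauer_le_unique[OF _ assms] by (intro the_equality) blast+
  then show ?thesis by (simp add: subpair_def)
qed

definition fuses :: "'g set \<Rightarrow> ('g \<Rightarrow> 'l) \<Rightarrow> 'g set \<Rightarrow> 'g \<Rightarrow> bool"
  where "fuses P e Q x \<longleftrightarrow>
    (\<exists>f. brauer_le k G (Q, f) (P, e) \<and> brauer_le k G (grp.cj x ` Q, cg x f) (P, e))"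

text \<open>
  As subpairs are unique, the pair \<open>(R, e\<^sub>R)\<close> lies above exactly those subpairs of \<open>(P, e)\<close> whose group is
  contained in \<open>R\<close>. This separates the condition on \<open>R\<close> from the condition on \<open>x\<close>.
\<close>

lemma mem_block_fusion_system:
  assumes bp: "bpair P e"
  shows "\<phi> \<in> block_fusion_system k G b (P, e) Q R \<longleftrightarrow>
    subgroup Q G \<and> Q \<subseteq> P \<and> subgroup R G \<and> R \<subseteq> P \<and>
    (\<exists>x\<in>carrier G. \<phi> = restrict (grp.cj x) Q \<and> grp.cj x ` Q \<subseteq> R \<and> fuses P e Q x)"
    (is "?L \<longleftrightarrow> ?R")
proof (cases "subgroup Q G \<and> Q \<subseteq> P \<and> subgroup R G \<and> R \<subseteq> P")
  case True
  note PD = bpairD[OF bp]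
  have sub: "subgroup Q G" "Q \<subseteq> P" "subgroup R G" "R \<subseteq> P" using True by auto
  obtain f where f: "brauer_le k G (Q, f) (P, e)" using brauer_le_exists[OF bp sub(1,2)] .
  obtain r where r: "brauer_le k G (R, r) (P, e)" using brauer_le_exists[OF bp sub(3,4)] .
  have fA: "f \<in> AC" using brauer_leD(1)[OF f] by (rule bpair_AC)
  have le: "brauer_le k G (grp.cj x ` Q, cg x f) (R, r) \<longleftrightarrow> grp.cj x ` Q \<subseteq> R \<and> fuses P e Q x"
    if x: "x \<in> carrier G" for x
  proof
    assume le: "brauer_le k G (grp.cj x ` Q, cg x f) (R, r)"
    then show "grp.cj x ` Q \<subseteq> R \<and> fuses P e Q x"
      using f brauer_leD(3)[OF le] brauer_le_trans[OF le r] by (auto simp: fuses_def)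
  next
    assume a: "grp.cj x ` Q \<subseteq> R \<and> fuses P e Q x"
    then obtain f' where "brauer_le k G (Q, f') (P, e)" "brauer_le k G (grp.cj x ` Q, cg x f') (P, e)"
      by (auto simp: fuses_def)
    then show "brauer_le k G (grp.cj x ` Q, cg x f) (R, r)"
      using a brauer_le_unique[OF f] brauer_le_subpair[OF _ r] by metis
  qed
  have "?L \<longleftrightarrow> \<phi> \<in> group_homs G Q R \<and> (\<exists>x\<in>carrier G. (\<forall>u\<in>Q. \<phi> u = grp.cj x u) \<and>
      brauer_le k G (grp.cj x ` Q, cg x f) (R, r))"
    using sub PD fA
    by (auto simp: grp.subgroup_restrict_iff subpair_eq[OF f] subpair_eq[OF r] conj_pair_eq grp.cj_def
        simp del: conj_pair.simps)
  also have "\<dots> \<longleftrightarrow> \<phi> \<in> group_homs G Q R \<and> (\<exists>x\<in>carrier G. (\<forall>u\<in>Q. \<phi> u = grp.cj x u) \<and>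
      grp.cj x ` Q \<subseteq> R \<and> fuses P e Q x)"
    using le by blast
  also have "\<dots> \<longleftrightarrow> (\<exists>x\<in>carrier G. \<phi> = restrict (grp.cj x) Q \<and> grp.cj x ` Q \<subseteq> R \<and> fuses P e Q x)"
  proof
    assume "\<phi> \<in> group_homs G Q R \<and> (\<exists>x\<in>carrier G. (\<forall>u\<in>Q. \<phi> u = grp.cj x u) \<and>
      grp.cj x ` Q \<subseteq> R \<and> fuses P e Q x)"
    then obtain x where x: "\<phi> \<in> extensional Q" "x \<in> carrier G" "\<forall>u\<in>Q. \<phi> u = grp.cj x u"
        "grp.cj x ` Q \<subseteq> R" "fuses P e Q x"
      by (auto simp: group_homs_def)
    then have "\<phi> = restrict (grp.cj x) Q" by (intro extensionalityI[of _ Q]) auto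
    then show "\<exists>x\<in>carrier G. \<phi> = restrict (grp.cj x) Q \<and> grp.cj x ` Q \<subseteq> R \<and> fuses P e Q x"
      using x by auto
  qed (use grp.restrict_cj_in_group_homs sub(1) in \<open>auto\<close>)
  finally show ?thesis using sub by simp
next
  case False
  then show ?thesis using bpairD(2)[OF bp] by (auto simp: grp.subgroup_restrict_iff)
qed

lemma fuses_carrier: "bpair P e \<Longrightarrow> subgroup Q G \<Longrightarrow> Q \<subseteq> P \<Longrightarrow> x \<in> P \<Longrightarrow> fuses P e Q x"
  using brauer_le_exists brauer_le_cg_self unfolding fuses_def by metis

lemma fuses_mult:
  assumes x: "x \<in> carrier G" "y \<in> carrier G" and R: "bpair P e" "subgroup R G" "R \<subseteq> P" "grp.cj x ` Q \<subseteq> R"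
    and f: "fuses P e Q x" "fuses P e R y"
  shows "fuses P e Q (y \<cdot> x)"
proof -
  obtain f where f: "brauer_le k G (Q, f) (P, e)" "brauer_le k G (grp.cj x ` Q, cg x f) (P, e)"
    using f(1) by (auto simp: fuses_def)
  obtain r where r: "brauer_le k G (R, r) (P, e)" "brauer_le k G (grp.cj y ` R, cg y r) (P, e)"
    using assms(8) by (auto simp: fuses_def)
  have "brauer_le k G (grp.cj x ` Q, cg x f) (R, r)" using brauer_le_subpair[OF f(2) r(1) R(4)] .
  from brauer_le_trans[OF brauer_le_cg[OF x(2) this] r(2)]
  have "brauer_le k G (grp.cj (y \<cdot> x) ` Q, cg (y \<cdot> x) f) (P, e)"
    using x bpairD(3)[OF brauer_leD(1)[OF f(1)]] by (simp add: cg_mult grp.cj_image_mult)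
  then show ?thesis using f by (auto simp: fuses_def)
qed

lemma fuses_inv:
  assumes x: "x \<in> carrier G" and f: "fuses P e Q x"
  shows "fuses P e (grp.cj x ` Q) (inv\<^bsub>G\<^esub> x)"
proof -
  obtain f where f: "brauer_le k G (Q, f) (P, e)" "brauer_le k G (grp.cj x ` Q, cg x f) (P, e)"
    using f by (auto simp: fuses_def)
  have "Q \<subseteq> carrier G" "f \<in> AC"
    using bpairD(3)[OF brauer_leD(1)[OF f(1)]] bpair_AC[OF brauer_leD(1)[OF f(1)]] .
  then show ?thesis using f x by (auto simp: fuses_def intro!: exI[of _ "cg x f"])
qed

lemma fuses_image: "fuses P e Q x \<Longrightarrow> grp.cj x ` Q \<subseteq> P"
  unfolding fuses_def by (blast dest: brauer_leD(3))

lemma fusion_system_block: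
  assumes bp: "bpair P e"
  shows "fusion_system (G\<lparr>carrier := P\<rparr>) (block_fusion_system k G b (P, e))"
  unfolding fusion_system_def
proof (intro conjI allI impI ballI)
  note PD = bpairD[OF bp]
  note mem = mem_block_fusion_system[OF bp]
  let ?P = "G\<lparr>carrier := P\<rparr>" and ?F = "block_fusion_system k G b (P, e)"
  show "?F Q R = {}" if "\<not> (subgroup Q ?P \<and> subgroup R ?P)" for Q R
  proof (rule equals0I)
    fix \<phi> assume "\<phi> \<in> ?F Q R"
    then show False using that unfolding mem by (simp add: grp.subgroup_restrict_iff[OF PD(2)])
  qed
  show "?F Q R \<subseteq> {\<phi> \<in> group_homs ?P Q R. inj_on \<phi> Q}" for Q R
  proof
    fix \<phi> assume "\<phi> \<in> ?F Q R"
    then obtain x where x: "x \<in> carrier G" "\<phi> = restrict (grp.cj x) Q" "grp.cj x ` Q \<subseteq> R" "subgroup Q G"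
      unfolding mem by blast
    have "Q \<subseteq> carrier G" using x by (simp add: subgroup.subset)
    then have "inj_on \<phi> Q" using grp.inj_on_cj x by (simp add: inj_on_restrict_eq)
    moreover have "\<phi> \<in> group_homs ?P Q R"
      using grp.restrict_cj_in_group_homs[OF x(1,4,3)] x(2) by (simp add: group_homs_def)
    ultimately show "\<phi> \<in> {\<phi> \<in> group_homs ?P Q R. inj_on \<phi> Q}" by simp
  qed
  show "compose Q \<psi> \<phi> \<in> ?F Q S" if ph: "\<phi> \<in> ?F Q R" and ps: "\<psi> \<in> ?F R S" for Q R S \<phi> \<psi>
  proof -
    obtain x where x: "x \<in> carrier G" "\<phi> = restrict (grp.cj x) Q" "grp.cj x ` Q \<subseteq> R" "fuses P e Q x"
        "subgroup Q G" "Q \<subseteq> P" "subgroup R G" "R \<subseteq> P"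
      using ph unfolding mem by blast
    obtain y where y: "y \<in> carrier G" "\<psi> = restrict (grp.cj y) R" "grp.cj y ` R \<subseteq> S" "fuses P e R y"
        "subgroup S G" "S \<subseteq> P"
      using ps unfolding mem by blast
    have QG: "Q \<subseteq> carrier G" using x by (simp add: subgroup.subset)
    have "grp.cj y ` grp.cj x ` Q \<subseteq> S" using x(3) y(3) by blast
    then have "grp.cj (y \<cdot> x) ` Q \<subseteq> S" using x(1) y(1) QG by (simp add: grp.cj_image_mult)
    moreover have "fuses P e Q (y \<cdot> x)" using fuses_mult[OF x(1) y(1) bp x(7,8,3,4) y(4)] .
    ultimately show ?thesis
      using x y QG unfolding mem by (auto simp: grp.compose_restrict_cj intro!: bexI[of _ "y \<cdot> x"])
  qed
  show "conj_map ?P x Q \<in> ?F Q R"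
    if s: "subgroup Q ?P \<and> subgroup R ?P" and x: "x \<in> carrier ?P" and im: "conj_map ?P x Q ` Q \<subseteq> R" for Q R x
  proof -
    have s': "subgroup Q G" "Q \<subseteq> P" "subgroup R G" "R \<subseteq> P"
      using s grp.subgroup_restrict_iff[OF PD(2)] by auto
    have xP: "x \<in> P" "x \<in> carrier G" using x PD(3) by auto
    have "conj_map ?P x Q = restrict (grp.cj x) Q"
      using xP PD(2) by (auto simp: conj_map_def grp.cj_def intro!: restrict_ext)
    then show ?thesis using im s' xP fuses_carrier[OF bp s'(1,2) xP(1)] unfolding mem by auto
  qed
  fix Q R \<phi> assume "\<phi> \<in> ?F Q R"
  then obtain x where x: "x \<in> carrier G" "\<phi> = restrict (grp.cj x) Q" "grp.cj x ` Q \<subseteq> R" "fuses P e Q x"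
      "subgroup Q G" "Q \<subseteq> P" "subgroup R G" "R \<subseteq> P"
    unfolding mem by blast
  have QG: "Q \<subseteq> carrier G" using x by (simp add: subgroup.subset)
  have im: "\<phi> ` Q = grp.cj x ` Q" using x by simp
  have xQ: "subgroup (grp.cj x ` Q) G" using grp.subgroup_cj_image[OF x(1,5)] .
  show "\<phi> \<in> ?F Q (\<phi> ` Q)" unfolding mem im using x xQ by auto
  have "restrict (inv_into Q \<phi>) (\<phi> ` Q) = restrict (grp.cj (inv\<^bsub>G\<^esub> x)) (grp.cj x ` Q)"
    unfolding im unfolding x(2) by (rule grp.inverse_restrict_cj[OF x(1) QG])
  then show "restrict (inv_into Q \<phi>) (\<phi> ` Q) \<in> ?F (\<phi> ` Q) Q"
    unfolding mem im using x xQ QG fuses_inv[OF x(1,4)] by (auto intro!: bexI[of _ "inv\<^bsub>G\<^esub> x"])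
qed

end

section \<open>Galois descent of blocks\<close>

lemma (in ring) finsum_subring:
  assumes K: "subring K R" and S: "finite S" "\<And>s. s \<in> S \<Longrightarrow> f s \<in> K"
  shows "finsum (R\<lparr>carrier := K\<rparr>) f S = finsum R f S"
proof -
  interpret K: ring "R\<lparr>carrier := K\<rparr>" using K by (rule subring_is_ring)
  have KR: "K \<subseteq> carrier R" using K by (rule subringE)
  show ?thesis
    using S
  proof (induction S rule: finite_induct)
    case empty
    then show ?case by simp
  next
    case (insert x F)
    have "finsum (R\<lparr>carrier := K\<rparr>) f (insert x F) = f x \<oplus> finsum (R\<lparr>carrier := K\<rparr>) f F"
      using insert by (subst K.finsum_insert) auto
    also have "\<dots> = finsum R f (insert x F)"
      using insert KR by (subst finsum_insert) (auto simp: subset_iff)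
    finally show ?case .
  qed
qed

lemma (in ring) ring_char_subring:
  assumes K: "subring K R"
  shows "ring_char (R\<lparr>carrier := K\<rparr>) = ring_char R"
proof -
  interpret K: ring "R\<lparr>carrier := K\<rparr>" using K by (rule subring_is_ring)
  show ?thesis
    unfolding ring_char_def group.ord_def[OF K.a_group] group.ord_def[OF a_group] nat_pow_def by simp
qed

locale galois_group_algebra = modular_group_algebra k G p
  for k :: "('l, 'm) ring_scheme" (structure) and G :: "('g, 'n) monoid_scheme" and p +
  fixes K :: "'l set"
  assumes galois: "finite_galois_extension k K"
begin

lemma subfield_K: "subfield K k" and fixed_field: "{x \<in> carrier k. \<forall>\<gamma>\<in>galois_group k K. \<gamma> x = x} = K"
  using galois by (auto simp: finite_galois_extension_def)

sublocale KG: modular_group_algebra "k\<lparr>carrier := K\<rparr>" G p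
proof -
  have "field (k\<lparr>carrier := K\<rparr>)" using subfield_iff(2)[OF subfield_K] .
  then show "modular_group_algebra (k\<lparr>carrier := K\<rparr>) G p"
    using fin ring_char p_pos grp.is_group ring_char_subring[OF subfieldE(1)[OF subfield_K]]
    by (intro modular_group_algebra.intro modular_group_algebra_axioms.intro) auto
qed

text \<open>From here on the infix symbols mean the operations over \<open>k\<close>; they agree with those over \<open>K\<close> on
  elements with coefficients in \<open>K\<close>.\<close>

no_notation KG.gmult (infixl "\<cdot>" 70) and KG.amult (infixl "\<star>" 70) and KG.aadd (infixl "\<boxplus>" 65)
  and KG.aminus (infixl "\<boxminus>" 65) and KG.azero ("\<zero>\<^sub>A") and KG.aone ("\<one>\<^sub>A")

abbreviation \<Gamma> where "\<Gamma> \<equiv> galois_group k K"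

abbreviation KA where "KA \<equiv> group_algebra (k\<lparr>carrier := K\<rparr>) G"

abbreviation KAC where "KAC \<equiv> carrier (KA)"

lemma K_subset: "K \<subseteq> carrier k"
  using subfield_K subfieldE(3) by auto

lemma K_subring: "subring K k"
  using subfield_K subfieldE(1) by auto

lemma zero_K: "\<zero> \<in> K"
  using subringE(2)[OF K_subring] .

lemma KAC_iff: "a \<in> KAC \<longleftrightarrow> a \<in> AC \<and> (\<forall>g. a g \<in> K)"
proof
  assume a: "a \<in> KAC"
  show "a \<in> AC \<and> (\<forall>g. a g \<in> K)"
  proof (intro conjI allI)
    show "a \<in> AC" using a K_subset KG.AC_coeff[OF a] KG.AC_off[OF a] by (intro AC_I) auto
    show "a g \<in> K" for g using KG.AC_coeff[OF a, of g] by simp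
  qed
next
  assume "a \<in> AC \<and> (\<forall>g. a g \<in> K)"
  then show "a \<in> KAC" using AC_off by (intro KG.AC_I) auto
qed

lemma KAC_AC: "a \<in> KAC \<Longrightarrow> a \<in> AC"
  by (simp add: KAC_iff)

lemma K_mult: "a \<in> KAC \<Longrightarrow> b \<in> KAC \<Longrightarrow> a \<otimes>\<^bsub>KA\<^esub> b = a \<star> b"
proof
  fix g assume a: "a \<in> KAC" "b \<in> KAC"
  show "(a \<otimes>\<^bsub>KA\<^esub> b) g = (a \<star> b) g"
  proof (cases "g \<in> carrier G")
    case True
    then show ?thesis
      using a fin by (simp add: KG.mult_apply mult_apply KAC_iff finsum_subring[OF K_subring]
        subringE(6)[OF K_subring])
  next
    case False
    then show ?thesis by (simp add: mult_off KG.mult_off)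
  qed
qed

lemma K_zero: "\<zero>\<^bsub>KA\<^esub> = \<zero>\<^sub>A"
  by (simp add: KG.zero_eq zero_eq)

lemma K_add: "a \<oplus>\<^bsub>KA\<^esub> b = a \<boxplus> b"
  by (simp add: KG.add_fun add_fun)

lemma K_Br: "KG.Br P a = Br P a"
  by (simp add: brauer_hom_def fun_eq_iff)

lemma K_fixA: "KG.fixA P = fixA P \<inter> KAC"
  by (auto simp: KG.fixA_def fixA_def KAC_AC)

lemma K_kH: "H \<subseteq> carrier G \<Longrightarrow> KG.kH H = kH H \<inter> KAC"
  by (auto simp: KG.kH_iff kH_iff KAC_AC)

lemma K_Zc: "subgroup H G \<Longrightarrow> KG.Zc H = Zc H \<inter> KAC"
  by (auto simp: KG.Zc_eq Zc_eq K_fixA K_kH subgroup.subset)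

lemma K_twist: "KG.twist \<gamma> x a = twist \<gamma> x a"
  by (simp add: KG.twist_def twist_def fun_eq_iff)


subsection \<open>The Galois action\<close>

abbreviation gal :: "('l \<Rightarrow> 'l) \<Rightarrow> ('g \<Rightarrow> 'l) \<Rightarrow> ('g \<Rightarrow> 'l)" where "gal \<gamma> \<equiv> twist \<gamma> \<one>\<^bsub>G\<^esub>"

lemma \<Gamma>_iso: "\<gamma> \<in> \<Gamma> \<Longrightarrow> \<gamma> \<in> ring_iso k k" and \<Gamma>_fix: "\<gamma> \<in> \<Gamma> \<Longrightarrow> c \<in> K \<Longrightarrow> \<gamma> c = c"
  by (auto simp: galois_group_def)

lemma \<Gamma>_I:
  assumes "\<gamma> \<in> ring_iso k k" "\<And>c. c \<in> K \<Longrightarrow> \<gamma> c = c"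
  shows "restrict \<gamma> (carrier k) \<in> \<Gamma>"
  using ring_iso_restrict[OF assms(1), of "restrict \<gamma> (carrier k)"] assms(2) K_subset
  by (auto simp: galois_group_def)

lemma \<Gamma>_id: "\<exists>\<gamma>\<in>\<Gamma>. \<forall>c\<in>carrier k. \<gamma> c = c"
  using \<Gamma>_I[OF id_iso] by (intro bexI[of _ "restrict (\<lambda>c. c) (carrier k)"]) auto

lemma \<Gamma>_comp:
  assumes "\<gamma> \<in> \<Gamma>" "\<delta> \<in> \<Gamma>"
  shows "\<exists>\<eta>\<in>\<Gamma>. \<forall>c\<in>carrier k. \<eta> c = \<gamma> (\<delta> c)"
proof -
  have "\<gamma> \<circ> \<delta> \<in> ring_iso k k" using assms \<Gamma>_iso ring_iso_set_trans by blast
  then have "restrict (\<gamma> \<circ> \<delta>) (carrier k) \<in> \<Gamma>" using assms by (intro \<Gamma>_I) (auto simp: \<Gamma>_fix)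
  then show ?thesis by (intro bexI[of _ "restrict (\<gamma> \<circ> \<delta>) (carrier k)"]) auto
qed

lemma \<Gamma>_inverse:
  assumes "\<gamma> \<in> \<Gamma>"
  shows "\<exists>\<delta>\<in>\<Gamma>. \<forall>c\<in>carrier k. \<delta> (\<gamma> c) = c \<and> \<gamma> (\<delta> c) = c"
proof -
  obtain \<delta> where d: "\<delta> \<in> ring_iso k k" "\<And>c. c \<in> carrier k \<Longrightarrow> \<delta> (\<gamma> c) = c \<and> \<gamma> (\<delta> c) = c"
    using iso_inverse[OF \<Gamma>_iso[OF assms]] by auto
  have "\<delta> c = c" if "c \<in> K" for c using d(2)[of c] \<Gamma>_fix[OF assms that] that K_subset by auto
  then have "restrict \<delta> (carrier k) \<in> \<Gamma>" using d by (intro \<Gamma>_I) auto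
  then show ?thesis
    using d isoD(1)[OF \<Gamma>_iso[OF assms]] by (intro bexI[of _ "restrict \<delta> (carrier k)"]) auto
qed

lemma gal_eq: "a \<in> AC \<Longrightarrow> \<gamma> \<in> ring_iso k k \<Longrightarrow> \<gamma> \<circ> a = gal \<gamma> a"
  by (auto simp: twist_def fun_eq_iff AC_off isoD)

lemma gal_fixed: "a \<in> KAC \<Longrightarrow> \<gamma> \<in> \<Gamma> \<Longrightarrow> gal \<gamma> a = a"
  using gal_eq[OF KAC_AC \<Gamma>_iso, symmetric] by (auto simp: KAC_iff \<Gamma>_fix fun_eq_iff)

lemma KAC_if_fixed:
  assumes "a \<in> AC" "\<And>\<gamma>. \<gamma> \<in> \<Gamma> \<Longrightarrow> gal \<gamma> a = a"
  shows "a \<in> KAC"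
proof -
  have "\<gamma> (a g) = a g" if "\<gamma> \<in> \<Gamma>" for \<gamma> g
    using assms(2)[OF that] gal_eq[OF assms(1) \<Gamma>_iso[OF that]] by (metis comp_apply)
  then show ?thesis using assms(1) fixed_field by (auto simp: KAC_iff)
qed

lemma gal_cg: "x \<in> carrier G \<Longrightarrow> gal \<gamma> (cg x a) = cg x (gal \<gamma> a)"
  by (simp add: twist_twist)

definition gorbit :: "('g \<Rightarrow> 'l) \<Rightarrow> ('g \<Rightarrow> 'l) set"
  where "gorbit e = (\<lambda>\<gamma>. gal \<gamma> e) ` \<Gamma>"

definition gsum :: "('g \<Rightarrow> 'l) \<Rightarrow> ('g \<Rightarrow> 'l)"
  where "gsum e = (\<Oplus>\<^bsub>A\<^esub>f\<in>gorbit e. f)"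

lemma gorbit_self: "e \<in> AC \<Longrightarrow> e \<in> gorbit e"
proof -
  assume e: "e \<in> AC"
  obtain \<gamma> where g: "\<gamma> \<in> \<Gamma>" "\<And>c. c \<in> carrier k \<Longrightarrow> \<gamma> c = c" using \<Gamma>_id by auto
  have "gal \<gamma> e = e" using twist_cong[of \<gamma> "\<lambda>c. c", OF g(2) e] twist_one[OF e] by simp
  then show ?thesis using g(1) by (metis gorbit_def imageI)
qed

lemma gal_gorbit:
  assumes e: "e \<in> AC" and g: "\<gamma> \<in> \<Gamma>" and f: "f \<in> gorbit e"
  shows "gal \<gamma> f \<in> gorbit e"
proof -
  obtain \<delta> where d: "\<delta> \<in> \<Gamma>" "f = gal \<delta> e" using f by (auto simp: gorbit_def)
  obtain \<eta> where h: "\<eta> \<in> \<Gamma>" "\<And>c. c \<in> carrier k \<Longrightarrow> \<eta> c = \<gamma> (\<delta> c)" using \<Gamma>_comp[OF g d(1)] by auto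
  have "gal \<gamma> f = gal \<eta> e" using d twist_cong[OF h(2) e] by (simp add: twist_twist)
  then show ?thesis using h by (auto simp: gorbit_def)
qed

lemma gal_inverse:
  assumes "\<gamma> \<in> \<Gamma>"
  obtains \<delta> where "\<delta> \<in> \<Gamma>" "\<And>a. a \<in> AC \<Longrightarrow> gal \<delta> (gal \<gamma> a) = a" "\<And>a. a \<in> AC \<Longrightarrow> gal \<gamma> (gal \<delta> a) = a"
proof -
  obtain \<delta> where d: "\<delta> \<in> \<Gamma>" "\<And>c. c \<in> carrier k \<Longrightarrow> \<delta> (\<gamma> c) = c" "\<And>c. c \<in> carrier k \<Longrightarrow> \<gamma> (\<delta> c) = c"
    using \<Gamma>_inverse[OF assms] by auto
  have "gal \<delta> (gal \<gamma> a) = a" "gal \<gamma> (gal \<delta> a) = a" if "a \<in> AC" for a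
    using twist_cong[of "\<lambda>c. \<delta> (\<gamma> c)" "\<lambda>c. c", OF d(2) that]
      twist_cong[of "\<lambda>c. \<gamma> (\<delta> c)" "\<lambda>c. c", OF d(3) that] twist_one[OF that]
    by (simp_all add: twist_twist)
  then show ?thesis using that d by blast
qed

lemma gorbit_gal:
  assumes e: "e \<in> AC" and g: "\<gamma> \<in> \<Gamma>"
  shows "gorbit (gal \<gamma> e) = gorbit e"
proof
  have gA: "gal \<gamma> e \<in> AC" using e \<Gamma>_iso[OF g] by simp
  have sub: "gorbit (gal \<gamma> e) \<subseteq> gorbit e" if "e \<in> AC" "\<gamma> \<in> \<Gamma>" for e \<gamma>
    using gal_gorbit[OF that(1) _ gal_gorbit[OF that gorbit_self[OF that(1)]]] by (auto simp: gorbit_def[of "gal \<gamma> e"])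
  show "gorbit (gal \<gamma> e) \<subseteq> gorbit e" using sub[OF e g] .
  obtain \<delta> where d: "\<delta> \<in> \<Gamma>" "gal \<delta> (gal \<gamma> e) = e" using gal_inverse[OF g] e by metis
  show "gorbit e \<subseteq> gorbit (gal \<gamma> e)" using sub[OF gA d(1)] d(2) by simp
qed

lemma gorbit_block:
  assumes H: "subgroup H G" and e: "block H e" and f: "f \<in> gorbit e"
  shows "block H f" "f \<in> AC"
proof -
  obtain \<gamma> where g: "\<gamma> \<in> \<Gamma>" "f = gal \<gamma> e" using f by (auto simp: gorbit_def)
  show "block H f"
    using block_twist[OF \<Gamma>_iso[OF g(1)] grp.one_closed H e] subgroup.subset[OF H] g(2) by simp
  then show "f \<in> AC" using blockD(1)[OF H] by blast
qed

lemma finite_gorbit: "subgroup H G \<Longrightarrow> block H e \<Longrightarrow> finite (gorbit e)"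
  using gorbit_block(1)[of H e] finite_blocks[of H] by (intro finite_subset[of "gorbit e"]) auto

lemma galois_conjugate_sum_eq:
  assumes H: "subgroup H G" and e: "block H e"
  shows "galois_conjugate_sum k K (G\<lparr>carrier := H\<rparr>) e = gsum e"
proof -
  interpret HG: modular_group_algebra k "G\<lparr>carrier := H\<rparr>" p
    using ring_char p_pos fin subgroup.subset[OF H] grp.subgroup_imp_group[OF H] finite_subset field_axioms
    by (intro modular_group_algebra.intro modular_group_algebra_axioms.intro) auto
  have orb: "(\<lambda>\<gamma>. \<gamma> \<circ> e) ` \<Gamma> = gorbit e"
    using gal_eq[OF blockD(1)[OF H e] \<Gamma>_iso] by (auto simp: gorbit_def)
  have fH: "f \<in> carrier (group_algebra k (G\<lparr>carrier := H\<rparr>))" if "f \<in> gorbit e" for f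
    using blockD(2)[OF H gorbit_block(1)[OF H e that]] by (simp add: kH_def)
  show ?thesis
    unfolding galois_conjugate_sum_def orb gsum_def
  proof
    fix g
    have "(\<Oplus>\<^bsub>group_algebra k (G\<lparr>carrier := H\<rparr>)\<^esub>f\<in>gorbit e. f) g = (\<Oplus>f\<in>gorbit e. f g)"
      using finite_gorbit[OF H e] fH by (intro HG.finsum_apply) auto
    also have "\<dots> = (\<Oplus>\<^bsub>A\<^esub>f\<in>gorbit e. f) g"
      using finite_gorbit[OF H e] gorbit_block(2)[OF H e] by (intro finsum_apply[symmetric]) auto
    finally show "(\<Oplus>\<^bsub>group_algebra k (G\<lparr>carrier := H\<rparr>)\<^esub>f\<in>gorbit e. f) g = (\<Oplus>\<^bsub>A\<^esub>f\<in>gorbit e. f) g" .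
  qed
qed

lemma gsum_Zc:
  assumes H: "subgroup H G" and e: "block H e"
  shows "gsum e \<in> Zc H"
  unfolding gsum_def using finite_gorbit[OF H e] blockD(3)[OF H gorbit_block(1)[OF H e]]
  by (intro subalg_finsum[OF subalg_Zc[OF H]]) auto

lemma gsum_AC: "subgroup H G \<Longrightarrow> block H e \<Longrightarrow> gsum e \<in> AC"
  using subalgD(1)[OF subalg_Zc gsum_Zc] .

lemma mult_gsum:
  assumes H: "subgroup H G" and e: "block H e" and a: "a \<in> AC"
  shows "a \<star> gsum e = (\<Oplus>\<^bsub>A\<^esub>f\<in>gorbit e. a \<star> f)" "gsum e \<star> a = (\<Oplus>\<^bsub>A\<^esub>f\<in>gorbit e. f \<star> a)"
  unfolding gsum_def using finite_gorbit[OF H e] gorbit_block(2)[OF H e] a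
  by (auto intro: A.finsum_rdistr A.finsum_ldistr)

lemma gsum_mult_block:
  assumes H: "subgroup H G" and e: "block H e" and f: "block H f"
  shows "gsum e \<star> f = (if f \<in> gorbit e then f else \<zero>\<^sub>A)"
proof -
  note fD = blockD[OF H f]
  have s: "gsum e \<star> f = (\<Oplus>\<^bsub>A\<^esub>h\<in>gorbit e. h \<star> f)" using mult_gsum(2)[OF H e fD(1)] .
  have orth: "h \<star> f = \<zero>\<^sub>A" if "h \<in> gorbit e" "h \<noteq> f" for h
    using blocks_orthogonal[OF H gorbit_block(1)[OF H e] f] that by auto
  show ?thesis
  proof (cases "f \<in> gorbit e")
    case True
    then have "gsum e \<star> f = f \<star> f"
      unfolding s using finite_gorbit[OF H e] fD(1) orth by (intro A.finsum_delta) auto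
    then show ?thesis using True fD(4) by simp
  next
    case False
    then have "gsum e \<star> f = \<zero>\<^sub>A" unfolding s using orth by (intro A.add.finprod_one_eqI) metis
    then show ?thesis using False by simp
  qed
qed

lemma gsum_idem:
  assumes H: "subgroup H G" and e: "block H e"
  shows "gsum e \<star> gsum e = gsum e"
proof -
  have "gsum e \<star> gsum e = (\<Oplus>\<^bsub>A\<^esub>f\<in>gorbit e. gsum e \<star> f)" using mult_gsum(1)[OF H e gsum_AC[OF H e]] .
  also have "\<dots> = (\<Oplus>\<^bsub>A\<^esub>f\<in>gorbit e. f)"
    using gsum_mult_block[OF H e gorbit_block(1)[OF H e]] gorbit_block(2)[OF H e]
    by (intro A.finsum_cong') auto
  finally show ?thesis by (simp add: gsum_def)
qed

lemma gsum_ne: "subgroup H G \<Longrightarrow> block H e \<Longrightarrow> gsum e \<noteq> \<zero>\<^sub>A"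
  using gsum_mult_block[of H e e] gorbit_self[of e] blockD(1,5)[of H e] by auto

lemma twist_finsum:
  assumes "\<gamma> \<in> ring_iso k k" "x \<in> carrier G" "finite S" "S \<subseteq> AC"
  shows "twist \<gamma> x (\<Oplus>\<^bsub>A\<^esub>f\<in>S. f) = (\<Oplus>\<^bsub>A\<^esub>f\<in>twist \<gamma> x ` S. f)"
proof -
  have "inj_on (twist \<gamma> x) S" using twist_inj[OF assms(1,2)] assms(4) by (auto simp: inj_on_def subset_iff)
  then have r: "(\<Oplus>\<^bsub>A\<^esub>f\<in>twist \<gamma> x ` S. f) = (\<Oplus>\<^bsub>A\<^esub>f\<in>S. twist \<gamma> x f)"
    using assms by (intro A.finsum_reindex) auto
  show ?thesis unfolding r
    using assms(3,4)
    by (induction S rule: finite_induct)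
      (use assms(1,2) in \<open>auto simp: twist_zero twist_add subset_iff Pi_def\<close>)
qed

lemma gsum_gal:
  assumes H: "subgroup H G" and e: "block H e" and g: "\<gamma> \<in> \<Gamma>"
  shows "gal \<gamma> (gsum e) = gsum e" "gsum (gal \<gamma> e) = gsum e"
proof -
  note eA = blockD(1)[OF H e]
  show "gsum (gal \<gamma> e) = gsum e" using gorbit_gal[OF eA g] by (simp add: gsum_def)
  obtain \<delta> where d: "\<delta> \<in> \<Gamma>" "\<And>a. a \<in> AC \<Longrightarrow> gal \<gamma> (gal \<delta> a) = a" using gal_inverse[OF g] by metis
  have "gal \<gamma> ` gorbit e = gorbit e"
  proof
    show "gal \<gamma> ` gorbit e \<subseteq> gorbit e" using gal_gorbit[OF eA g] by auto
    show "gorbit e \<subseteq> gal \<gamma> ` gorbit e"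
    proof
      fix f assume f: "f \<in> gorbit e"
      have "f = gal \<gamma> (gal \<delta> f)" using d(2)[OF gorbit_block(2)[OF H e f]] by simp
      then show "f \<in> gal \<gamma> ` gorbit e" using gal_gorbit[OF eA d(1) f] by (rule image_eqI)
    qed
  qed
  then show "gal \<gamma> (gsum e) = gsum e"
    unfolding gsum_def using \<Gamma>_iso[OF g] finite_gorbit[OF H e] gorbit_block(2)[OF H e]
    by (subst twist_finsum) auto
qed

lemma gsum_cg:
  assumes H: "subgroup H G" and e: "block H e" and x: "x \<in> carrier G"
  shows "cg x (gsum e) = gsum (cg x e)"
proof -
  have "cg x ` gorbit e = gorbit (cg x e)"
    by (simp add: gorbit_def image_image gal_cg[OF x])
  then show ?thesis
    unfolding gsum_def using id_iso x finite_gorbit[OF H e] gorbit_block(2)[OF H e]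
    by (subst twist_finsum) auto
qed

lemma gsum_KAC: "subgroup H G \<Longrightarrow> block H e \<Longrightarrow> gsum e \<in> KAC"
  by (rule KAC_if_fixed[OF gsum_AC gsum_gal(1)])

text \<open>
  Multiplication by the Galois sum of \<open>f\<close> detects which blocks are conjugate to \<open>f\<close>.
\<close>

lemma gsum_eq_imp_conjugate:
  assumes H: "subgroup H G" and e: "block H e" "block H f" and eq: "gsum e = gsum f"
  obtains \<gamma> where "\<gamma> \<in> \<Gamma>" "e = gal \<gamma> f"
proof -
  have "gsum f \<star> e = e"
    using gsum_mult_block[OF H e(1) e(1)] gorbit_self[OF blockD(1)[OF H e(1)]] eq by simp
  then have "e \<in> gorbit f" using gsum_mult_block[OF H e(2) e(1)] blockD(5)[OF H e(1)] by (auto split: if_splits)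
  then show ?thesis using that by (auto simp: gorbit_def)
qed

text \<open>
  An idempotent of \<open>Z(KH)\<close> below the Galois sum of \<open>e\<close> either contains \<open>e\<close>, and then all conjugates
  of \<open>e\<close>, or none of them.
\<close>

lemma gsum_block:
  assumes H: "subgroup H G" and e: "block H e"
  shows "KG.block H (gsum e)"
  unfolding KG.prim_iff
proof (intro conjI ballI impI)
  note eD = blockD[OF H e]
  show "gsum e \<in> KG.Zc H" using gsum_Zc[OF H e] gsum_KAC[OF H e] by (simp add: K_Zc[OF H])
  show "gsum e \<otimes>\<^bsub>KA\<^esub> gsum e = gsum e"
    using gsum_idem[OF H e] gsum_KAC[OF H e] by (simp add: K_mult)
  show "gsum e \<noteq> \<zero>\<^bsub>KA\<^esub>" using gsum_ne[OF H e] by (simp add: K_zero)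
  fix j j'
  assume j: "j \<in> KG.Zc H" "j' \<in> KG.Zc H" and jj: "j \<otimes>\<^bsub>KA\<^esub> j = j"
    and jj': "j \<otimes>\<^bsub>KA\<^esub> j' = \<zero>\<^bsub>KA\<^esub>"
    and sum: "gsum e = j \<oplus>\<^bsub>KA\<^esub> j'"
  have jK: "j \<in> Zc H" "j' \<in> Zc H" "j \<in> KAC" "j' \<in> KAC" using j by (auto simp: K_Zc[OF H])
  have jA: "j \<in> AC" "j' \<in> AC" using jK KAC_AC by auto
  have idem: "j \<star> j = j" "j \<star> j' = \<zero>\<^sub>A" "gsum e = j \<boxplus> j'"
    using jj jj' sum jK by (simp_all add: K_mult K_zero K_add)
  have je: "j \<star> gsum e = j" unfolding idem(3) using jA idem by (simp add: A.r_distr)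
  have conj: "j \<star> gal \<gamma> e = gal \<gamma> (j \<star> e)" if "\<gamma> \<in> \<Gamma>" for \<gamma>
    using twist_mult[OF \<Gamma>_iso[OF that] grp.one_closed jA(1) eD(1)] gal_fixed[OF jK(3) that] by simp
  have sumj: "j = (\<Oplus>\<^bsub>A\<^esub>f\<in>gorbit e. j \<star> f)" using mult_gsum(1)[OF H e jA(1)] je by simp
  have "j = \<zero>\<^sub>A \<or> j' = \<zero>\<^sub>A"
    using block_central_idempotent[OF H e jK(1) idem(1)]
  proof
    assume "j \<star> e = \<zero>\<^sub>A"
    then have "j \<star> f = \<zero>\<^sub>A" if "f \<in> gorbit e" for f
      using that conj \<Gamma>_iso by (auto simp: gorbit_def twist_zero)
    then have "(\<Oplus>\<^bsub>A\<^esub>f\<in>gorbit e. j \<star> f) = \<zero>\<^sub>A" by (intro A.add.finprod_one_eqI) blast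
    then show ?thesis using sumj by simp
  next
    assume "j \<star> e = e"
    then have "j \<star> f = f" if "f \<in> gorbit e" for f using that conj by (auto simp: gorbit_def)
    then have "(\<Oplus>\<^bsub>A\<^esub>f\<in>gorbit e. j \<star> f) = gsum e"
      unfolding gsum_def using gorbit_block(2)[OF H e] by (intro A.finsum_cong') auto
    then have "j = j \<boxplus> j'" using sumj idem by simp
    then show ?thesis using jA by simp
  qed
  then show "j = \<zero>\<^bsub>KA\<^esub> \<or> j' = \<zero>\<^bsub>KA\<^esub>"
    by (simp add: K_zero)
qed

lemma gsum_bpair: "bpair P e \<Longrightarrow> KG.bpair P (gsum e)"
  using gsum_block[OF bpairD(4,5)] bpairD(1) by (auto simp: KG.bpair_def)

text \<open>
  A primitive idempotent of \<open>(KG)\<^sup>P\<close> for the Galois sum of \<open>e\<close> lies above one of \<open>(kG)\<^sup>P\<close> for \<open>e\<close>,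
  so the order on Brauer pairs descends to \<open>K\<close>.
\<close>

lemma brauer_le_gsum:
  assumes le: "brauer_le k G (Q, f) (P, e)"
  shows "brauer_le (k\<lparr>carrier := K\<rparr>) G (Q, gsum f) (P, gsum e)"
proof -
  note D = brauer_leD[OF le]
  note PD = bpairD[OF D(2)] and QD = bpairD[OF D(1)]
  note eD = blockD[OF PD(4,5)] and fD = blockD[OF QD(4,5)]
  obtain i where i: "KG.primitive_for P (gsum e) i" using KG.primitive_for_exists[OF gsum_bpair[OF D(2)]] .
  note iD = KG.primitive_forD[OF gsum_bpair[OF D(2)] i]
  have iK: "i \<in> KAC" "i \<in> AC" "i \<in> fixA P" using iD(1,2) KAC_AC by (auto simp: K_fixA)
  have BK: "Br S i \<in> KAC" for S using iK zero_K by (auto simp: KAC_iff Br_apply)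
  have ii: "i \<star> i = i" using iD(3) iK by (simp add: K_mult)
  have ne: "gsum e \<star> Br P i = Br P i" "Br P i \<noteq> \<zero>\<^sub>A"
    using iD(4,5) BK gsum_KAC[OF PD(4,5)] by (simp_all add: K_Br K_zero K_mult)
  have "e \<star> Br P i \<noteq> \<zero>\<^sub>A"
  proof
    assume z: "e \<star> Br P i = \<zero>\<^sub>A"
    have "h \<star> Br P i = \<zero>\<^sub>A" if h: "h \<in> gorbit e" for h
    proof -
      obtain \<gamma> where g: "\<gamma> \<in> \<Gamma>" "h = gal \<gamma> e" using h by (auto simp: gorbit_def)
      have "h \<star> Br P i = gal \<gamma> (e \<star> Br P i)"
        using twist_mult[OF \<Gamma>_iso[OF g(1)] grp.one_closed eD(1)] gal_fixed[OF BK g(1)] iK g(2) by simp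
      then show ?thesis using z \<Gamma>_iso[OF g(1)] by (simp add: twist_zero)
    qed
    then have "(\<Oplus>\<^bsub>A\<^esub>h\<in>gorbit e. h \<star> Br P i) = \<zero>\<^sub>A" by (intro A.add.finprod_one_eqI) blast
    then show False using mult_gsum(2)[OF PD(4,5), of "Br P i"] ne iK by simp
  qed
  then obtain j where j: "primitive_for P e j" "i \<star> j = j"
    using primitive_for_below[OF D(2) iK(3) ii] by metis
  note jD = primitive_forD[OF D(2) j(1)]
  have jQ: "i \<in> fixA Q" "j \<in> fixA Q" using fixA_mono[OF D(3)] iK jD by auto
  have Bij: "Br Q i \<star> Br Q j = Br Q j" using Br_mult[OF QD(1) jQ] j by simp
  have fj: "f \<star> Br Q j = Br Q j" "Br Q j \<noteq> \<zero>\<^sub>A" using D(4,5)[OF j(1)] .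
  have gA: "gsum f \<in> AC" using gsum_AC[OF QD(4,5)] .
  have "gsum f \<star> Br Q j = gsum f \<star> f \<star> Br Q j"
    using mult_assoc[of "gsum f" f "Br Q j"] gA fD(1) jD(2) fj(1) by simp
  also have "gsum f \<star> f = f" using gsum_mult_block[OF QD(4,5,5)] gorbit_self[OF fD(1)] by simp
  finally have "gsum f \<star> Br Q j = Br Q j" using fj by simp
  then have "gsum f \<star> Br Q i \<star> Br Q j = Br Q j"
    using mult_assoc[of "gsum f" "Br Q i" "Br Q j"] gA iK jD(2) Bij by simp
  then have "gsum f \<star> Br Q i \<noteq> \<zero>\<^sub>A" using fj jD(2) by auto
  then show ?thesis
    using gsum_KAC[OF QD(4,5)] BK
    by (intro KG.brauer_leI[OF gsum_bpair[OF D(2)] gsum_bpair[OF D(1)] D(3) i])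
      (simp add: K_Br K_mult K_zero)
qed


subsection \<open>Comparison of the fusion systems\<close>

lemma fuses_gsum:
  assumes x: "x \<in> carrier G" and f: "fuses P e Q x"
  shows "KG.fuses P (gsum e) Q x"
proof -
  obtain f where f: "brauer_le k G (Q, f) (P, e)" "brauer_le k G (grp.cj x ` Q, cg x f) (P, e)"
    using f by (auto simp: fuses_def)
  note QD = bpairD[OF brauer_leD(1)[OF f(1)]]
  show ?thesis
    using brauer_le_gsum[OF f(1)] brauer_le_gsum[OF f(2)] gsum_cg[OF QD(4,5) x]
    by (auto simp: KG.fuses_def K_twist)
qed

lemma stab_gsum_galois:
  assumes bp: "bpair P e" and h: "h \<in> stab P (gsum e)"
  obtains \<gamma> where "\<gamma> \<in> \<Gamma>" "cg h e = gal \<gamma> e"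
proof -
  note PD = bpairD[OF bp]
  have hG: "h \<in> carrier G" "grp.cj h ` P = P" "cg h (gsum e) = gsum e" using h by auto
  have "grp.cj h ` C P = C P" using grp.centralizer_cj_image[OF hG(1) PD(3)] hG(2) by simp
  then have "block (C P) (cg h e)" using block_twist[OF id_iso hG(1) PD(4,5)] by simp
  moreover have "gsum (cg h e) = gsum e" using gsum_cg[OF PD(4,5) hG(1)] hG(3) by simp
  ultimately show ?thesis using gsum_eq_imp_conjugate[OF PD(4) _ PD(5)] that by blast
qed

lemma brauer_le_gal: "\<gamma> \<in> \<Gamma> \<Longrightarrow> brauer_le k G (Q, f) (P, e) \<Longrightarrow> brauer_le k G (Q, gal \<gamma> f) (P, gal \<gamma> e)"
  using brauer_le_twist[OF \<Gamma>_iso grp.one_closed] bpairD(3) brauer_leD(1,2) grp.cj_one_image by metis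

text \<open>
  The element \<open>x\<close> moves \<open>e\<^sub>Q\<close> to a Galois conjugate by some \<open>\<gamma>\<close> of the subpair of \<open>(P, e)\<close>. The
  pair \<open>(P, \<gamma> e)\<close> belongs to the same block \<open>b\<close>, since it contains a conjugate of \<open>(Q, e\<^sub>Q)\<close>. By
  maximality it is a conjugate of \<open>(P, e)\<close> by some \<open>h\<close>, and \<open>h\<inverse> x\<close> induces a morphism over \<open>k\<close>.
\<close>

lemma fuses_gsum_split:
  assumes b: "block (carrier G) b" and max: "maximal_brauer_pair k G b (P, e)"
    and Q: "subgroup Q G" "Q \<subseteq> P" and x: "x \<in> carrier G" and f: "KG.fuses P (gsum e) Q x"
  obtains h where "h \<in> stab P (gsum e)" "fuses P e Q (inv\<^bsub>G\<^esub> h \<cdot> x)"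
proof -
  note b_le = maximalD(1)[OF b max]
  have bp: "bpair P e" using brauer_leD(2)[OF b_le] .
  note PD = bpairD[OF bp]
  have QG: "Q \<subseteq> carrier G" using Q by (simp add: subgroup.subset)
  obtain f where f: "brauer_le k G (Q, f) (P, e)" using brauer_le_exists[OF bp Q] .
  have xQ: "subgroup (grp.cj x ` Q) G" "grp.cj x ` Q \<subseteq> P"
    using grp.subgroup_cj_image[OF x Q(1)] KG.fuses_image[OF assms(6)] .
  obtain f' where f': "brauer_le k G (grp.cj x ` Q, f') (P, e)" using brauer_le_exists[OF bp xQ] .
  note QD = bpairD[OF brauer_leD(1)[OF f]] and QD' = bpairD[OF brauer_leD(1)[OF f']]
  obtain f0 where f0: "brauer_le (k\<lparr>carrier := K\<rparr>) G (Q, f0) (P, gsum e)"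
      "brauer_le (k\<lparr>carrier := K\<rparr>) G (grp.cj x ` Q, cg x f0) (P, gsum e)"
    using assms(6) by (auto simp: KG.fuses_def K_twist)
  have "f0 = gsum f" using KG.brauer_le_unique[OF f0(1) brauer_le_gsum[OF f]] .
  then have "gsum (cg x f) = gsum f'"
    using KG.brauer_le_unique[OF f0(2) brauer_le_gsum[OF f']] gsum_cg[OF QD(4,5) x] by simp
  moreover have "block (C (grp.cj x ` Q)) (cg x f)"
    using bpairD(5)[OF bpair_twist[OF id_iso x brauer_leD(1)[OF f]]] .
  ultimately obtain \<gamma> where g: "\<gamma> \<in> \<Gamma>" "cg x f = gal \<gamma> f'"
    using gsum_eq_imp_conjugate[OF QD'(4) _ QD'(5)] by blast
  have le: "brauer_le k G (grp.cj x ` Q, cg x f) (P, gal \<gamma> e)"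
    using brauer_le_gal[OF g(1) f'] g(2) by simp
  have one: "{\<one>\<^bsub>G\<^esub>} \<subseteq> Q" using Q by (simp add: subgroup.one_closed)
  have "brauer_le k G ({\<one>\<^bsub>G\<^esub>}, b) (Q, f)" by (rule brauer_le_subpair[OF b_le f one])
  from brauer_le_cg[OF x this] have "brauer_le k G ({\<one>\<^bsub>G\<^esub>}, b) (grp.cj x ` Q, cg x f)"
    using x block_cg[OF b x] by simp
  then have "brauer_le k G ({\<one>\<^bsub>G\<^esub>}, b) (P, gal \<gamma> e)" using le by (rule brauer_le_trans)
  then obtain h where h: "h \<in> carrier G" "grp.cj h ` P = P" "cg h e = gal \<gamma> e"
    using maximal_pairs_conjugate[OF b max] by blast
  have "cg h (gsum e) = gsum e"
    using gsum_cg[OF PD(4,5) h(1)] h(3) gsum_gal(2)[OF PD(4,5) g(1)] by simp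
  then have hN: "h \<in> stab P (gsum e)" using h by simp
  have hP: "grp.cj (inv\<^bsub>G\<^esub> h) ` P = P" using grp.cj_image_cancel(2)[OF h(1) PD(3)] h(2) by simp
  have "brauer_le k G (grp.cj (inv\<^bsub>G\<^esub> h) ` grp.cj x ` Q, cg (inv\<^bsub>G\<^esub> h) (cg x f)) (P, e)"
    using brauer_le_cg[OF grp.inv_closed[OF h(1)] le] hP cg_cancel(1)[OF h(1) bpair_AC[OF bp]] h(3) by simp
  then have "fuses P e Q (inv\<^bsub>G\<^esub> h \<cdot> x)"
    using f h x QG by (auto simp: fuses_def grp.cj_image_mult cg_mult)
  then show ?thesis using that hN by blast
qed

lemma stab_gsum_fuses:
  assumes bp: "bpair P e" and Q: "subgroup Q G" "Q \<subseteq> P" and h: "h \<in> stab P (gsum e)"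
  shows "KG.fuses P (gsum e) Q h"
proof -
  have hG: "h \<in> carrier G" "grp.cj h ` P = P" "cg h (gsum e) = gsum e" using h by auto
  obtain f where f: "brauer_le (k\<lparr>carrier := K\<rparr>) G (Q, f) (P, gsum e)"
    using KG.brauer_le_exists[OF gsum_bpair[OF bp] Q] .
  then show ?thesis using KG.brauer_le_cg[OF hG(1) f] hG by (auto simp: KG.fuses_def K_twist)
qed

text \<open>
  On \<open>e\<close> the element \<open>h\<close> acts as some \<open>\<gamma>\<close>. So conjugation by \<open>h\<close> followed by \<open>\<gamma>\<inverse>\<close> fixes \<open>(P, e)\<close> and
  permutes its subpairs.
\<close>

lemma fuses_conjugate:
  assumes bp: "bpair P e" and h: "h \<in> stab P (gsum e)" and y: "y \<in> carrier G" and f: "fuses P e Q y"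
  shows "fuses P e (grp.cj h ` Q) (h \<cdot> y \<cdot> inv\<^bsub>G\<^esub> h)"
proof -
  have hG: "h \<in> carrier G" "grp.cj h ` P = P" using h by auto
  obtain \<gamma> where g: "\<gamma> \<in> \<Gamma>" "cg h e = gal \<gamma> e" using stab_gsum_galois[OF bp h] .
  obtain \<delta> where d: "\<delta> \<in> \<Gamma>" "\<And>a. a \<in> AC \<Longrightarrow> gal \<delta> (gal \<gamma> a) = a" using gal_inverse[OF g(1)] by metis
  have de: "twist \<delta> h e = e"
    using d(2)[OF bpair_AC[OF bp]] hG by (simp add: twist_twist flip: g(2))
  obtain f where f: "brauer_le k G (Q, f) (P, e)" "brauer_le k G (grp.cj y ` Q, cg y f) (P, e)"
    using f by (auto simp: fuses_def)
  have QG: "Q \<subseteq> carrier G" using bpairD(3)[OF brauer_leD(1)[OF f(1)]] .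
  have "brauer_le k G (grp.cj h ` Q, twist \<delta> h f) (P, e)"
    using brauer_le_twist[OF \<Gamma>_iso[OF d(1)] hG(1) f(1)] hG(2) de by simp
  moreover have "brauer_le k G (grp.cj h ` grp.cj y ` Q, twist \<delta> h (cg y f)) (P, e)"
    using brauer_le_twist[OF \<Gamma>_iso[OF d(1)] hG(1) f(2)] hG(2) de by simp
  moreover have "twist \<delta> h (cg y f) = cg (h \<cdot> y \<cdot> inv\<^bsub>G\<^esub> h) (twist \<delta> h f)"
    using hG y by (simp add: twist_twist grp.m_assoc)
  moreover have "grp.cj h ` grp.cj y ` Q = grp.cj (h \<cdot> y \<cdot> inv\<^bsub>G\<^esub> h) ` grp.cj h ` Q"
    using hG y QG by (simp add: grp.m_assoc flip: grp.cj_image_mult)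
  ultimately show ?thesis unfolding fuses_def by metis
qed

end

section \<open>Fusion systems generated by an automorphism\<close>

lemma fusion_systemD:
  assumes "fusion_system P E"
  shows "\<phi> \<in> E Q R \<Longrightarrow> subgroup Q P" "\<phi> \<in> E Q R \<Longrightarrow> subgroup R P"
    "\<phi> \<in> E Q R \<Longrightarrow> \<psi> \<in> E R S \<Longrightarrow> compose Q \<psi> \<phi> \<in> E Q S"
    "\<phi> \<in> E Q R \<Longrightarrow> \<phi> \<in> extensional Q" "\<phi> \<in> E Q R \<Longrightarrow> \<phi> ` Q \<subseteq> R"
    "\<phi> \<in> E Q R \<Longrightarrow> \<phi> \<in> E Q (\<phi> ` Q)"
    "\<phi> \<in> E Q R \<Longrightarrow> restrict (inv_into Q \<phi>) (\<phi> ` Q) \<in> E (\<phi> ` Q) Q"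
    "subgroup Q P \<Longrightarrow> subgroup R P \<Longrightarrow> x \<in> carrier P \<Longrightarrow> conj_map P x Q ` Q \<subseteq> R \<Longrightarrow> conj_map P x Q \<in> E Q R"
proof -
  note d = assms[unfolded fusion_system_def]
  note d1 = d[THEN conjunct1, rule_format] and e1 = d[THEN conjunct2]
  note d2 = e1[THEN conjunct1, rule_format] and e2 = e1[THEN conjunct2]
  note d3 = e2[THEN conjunct1, rule_format] and e3 = e2[THEN conjunct2]
  note d4 = e3[THEN conjunct1, rule_format] and d5 = e3[THEN conjunct2, rule_format]
  show "\<phi> \<in> E Q R \<Longrightarrow> subgroup Q P" "\<phi> \<in> E Q R \<Longrightarrow> subgroup R P" using d1[of Q R] by blast+
  have h: "\<phi> \<in> group_homs P Q R" if "\<phi> \<in> E Q R" using subsetD[OF d2 that] by simp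
  show "\<phi> \<in> E Q R \<Longrightarrow> \<phi> \<in> extensional Q" using h by (simp add: group_homs_def)
  show "\<phi> \<in> E Q R \<Longrightarrow> \<phi> ` Q \<subseteq> R" using h by (auto simp: group_homs_def hom_def)
  show "\<phi> \<in> E Q R \<Longrightarrow> \<psi> \<in> E R S \<Longrightarrow> compose Q \<psi> \<phi> \<in> E Q S" by (rule d3)
  show "\<phi> \<in> E Q R \<Longrightarrow> \<phi> \<in> E Q (\<phi> ` Q)" using d5 by blast
  show "\<phi> \<in> E Q R \<Longrightarrow> restrict (inv_into Q \<phi>) (\<phi> ` Q) \<in> E (\<phi> ` Q) Q" using d5 by blast
  show "subgroup Q P \<Longrightarrow> subgroup R P \<Longrightarrow> x \<in> carrier P \<Longrightarrow> conj_map P x Q ` Q \<subseteq> R \<Longrightarrow> conj_map P x Q \<in> E Q R"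
    by (rule d4) auto
qed

lemma fusion_system_inclusion:
  assumes P: "group P" and E: "fusion_system P E" and Q: "subgroup Q P" "subgroup R P" "Q \<subseteq> R"
  shows "restrict (\<lambda>u. u) Q \<in> E Q R"
proof -
  interpret P: group P by (rule P)
  have "Q \<subseteq> carrier P" using Q by (simp add: subgroup.subset)
  then have "conj_map P \<one>\<^bsub>P\<^esub> Q = restrict (\<lambda>u. u) Q"
    by (auto simp: conj_map_def intro!: restrict_ext)
  moreover have "conj_map P \<one>\<^bsub>P\<^esub> Q \<in> E Q R"
    by (rule fusion_systemD(8)[OF E Q(1,2) P.one_closed]) (use calculation Q in simp)
  ultimately show ?thesis by simp
qed

lemma fusion_system_restrict:
  assumes P: "group P" and E: "fusion_system P E" and f: "\<phi> \<in> E S T" and Q: "subgroup Q P" "Q \<subseteq> S"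
  shows "restrict \<phi> Q \<in> E Q T"
proof -
  have "compose Q \<phi> (restrict (\<lambda>u. u) Q) \<in> E Q T"
    using fusion_systemD(3)[OF E fusion_system_inclusion[OF P E Q(1) _ Q(2)] f] fusion_systemD(1)[OF E f] .
  moreover have "compose Q \<phi> (restrict (\<lambda>u. u) Q) = restrict \<phi> Q" by (auto simp: compose_def intro!: restrict_ext)
  ultimately show ?thesis by simp
qed

lemma fusion_system_codomain:
  assumes P: "group P" and E: "fusion_system P E" and f: "\<phi> \<in> E Q S" and R: "subgroup R P" "\<phi> ` Q \<subseteq> R"
  shows "\<phi> \<in> E Q R"
proof -
  have f': "\<phi> \<in> E Q (\<phi> ` Q)" using fusion_systemD(6)[OF E f] .
  have "compose Q (restrict (\<lambda>u. u) (\<phi> ` Q)) \<phi> \<in> E Q R"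
    using fusion_systemD(3)[OF E f' fusion_system_inclusion[OF P E fusion_systemD(2)[OF E f'] R]] .
  moreover have "compose Q (restrict (\<lambda>u. u) (\<phi> ` Q)) \<phi> = \<phi>"
    using fusion_systemD(4)[OF E f] by (intro extensionalityI[of _ Q]) (auto simp: compose_def)
  ultimately show ?thesis by simp
qed

context group
begin

lemma int_pow_subgroup: "subgroup H G \<Longrightarrow> x \<in> H \<Longrightarrow> x [^] (i::int) \<in> H"
  using int_pow_consistent[of H x i] group.int_pow_closed[OF subgroup_imp_group, of H x i] by simp

lemma normalizer_hom_AutoGroup:
  assumes P: "subgroup P G"
  shows "(\<lambda>h. restrict (cj h) P) \<in> hom (G\<lparr>carrier := normalizer (carrier G) P\<rparr>) (AutoGroup (G\<lparr>carrier := P\<rparr>))"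
proof -
  have PG: "P \<subseteq> carrier G" using P by (rule subgroup.subset)
  have auto: "restrict (cj h) P \<in> auto (G\<lparr>carrier := P\<rparr>)" if h: "h \<in> carrier G" "cj h ` P = P" for h
  proof -
    have "restrict (cj h) P \<in> hom (G\<lparr>carrier := P\<rparr>) (G\<lparr>carrier := P\<rparr>)"
      using restrict_cj_in_group_homs[OF h(1) P, of P] h by (simp add: group_homs_def)
    moreover have "bij_betw (restrict (cj h) P) P P"
      using inj_on_cj[OF h(1) PG] h(2) by (simp add: bij_betw_def inj_on_restrict_eq)
    ultimately show ?thesis by (simp add: auto_def Bij_def)
  qed
  have "restrict (cj (g \<otimes> h)) P = restrict (cj g) P \<otimes>\<^bsub>AutoGroup (G\<lparr>carrier := P\<rparr>)\<^esub> restrict (cj h) P"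
    if g: "g \<in> carrier G" "cj g ` P = P" and h: "h \<in> carrier G" "cj h ` P = P" for g h
  proof -
    have "restrict (cj g) P \<in> Bij P" "restrict (cj h) P \<in> Bij P"
      using auto g h by (auto simp: auto_def)
    then show ?thesis
      using compose_restrict_cj[OF h(1) g(1) PG, of P] h by (simp add: AutoGroup_def BijGroup_def)
  qed
  then show ?thesis using auto by (auto simp: hom_def normalizer_def AutoGroup_def)
qed

lemma AutoGroup_int_pow_cj:
  assumes P: "subgroup P G" and h: "h \<in> carrier G" "cj h ` P = P"
  shows "restrict (cj h) P [^]\<^bsub>AutoGroup (G\<lparr>carrier := P\<rparr>)\<^esub> (i::int) = restrict (cj (h [^] i)) P"
proof -
  let ?N = "normalizer (carrier G) P"
  have N: "subgroup ?N G" by (rule normalizer_subgroup[OF subgroup_self subgroup.subset[OF P]])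
  have hN: "h \<in> ?N" using h by (simp add: normalizer_def)
  have "restrict (cj (h [^]\<^bsub>G\<lparr>carrier := ?N\<rparr>\<^esub> i)) P =
      restrict (cj h) P [^]\<^bsub>AutoGroup (G\<lparr>carrier := P\<rparr>)\<^esub> i"
    using hom_int_pow[OF normalizer_hom_AutoGroup[OF P], of h i] hN N subgroup_imp_group[OF N]
      group.AutoGroup[OF subgroup_imp_group[OF P]] by simp
  then show ?thesis using int_pow_consistent[OF N hN, of i] by simp
qed

lemma cyclic_quotient_decomposition:
  assumes T: "subgroup T G" and N: "N \<lhd> G\<lparr>carrier := T\<rparr>" and g0: "g0 \<in> T"
    and gen: "generate (G\<lparr>carrier := T\<rparr> Mod N) {g0 <# N} = carrier (G\<lparr>carrier := T\<rparr> Mod N)" and g: "g \<in> T"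
  obtains i :: int and n where "n \<in> N" "g = n \<otimes> g0 [^] i"
proof -
  let ?T = "G\<lparr>carrier := T\<rparr>"
  interpret N: normal N ?T by (rule N)
  interpret M: group "?T Mod N" by (rule N.factorgroup_is_group)
  have co: "N #>\<^bsub>?T\<^esub> a = N #> a" "a <#\<^bsub>?T\<^esub> N = a <# N" for a by (auto simp: r_coset_def l_coset_def)
  have eq: "g0 <# N = N #> g0" using N.coset_eq g0 co by simp
  have mem: "N #> a \<in> carrier (?T Mod N)" if "a \<in> T" for a
    using that co(1) by (auto simp: FactGroup_def RCOSETS_def)
  have "N #> g \<in> generate (?T Mod N) {N #> g0}" using gen mem[OF g] eq by simp
  then obtain i :: int where "N #> g = (N #> g0) [^]\<^bsub>?T Mod N\<^esub> i"
    using M.generate_pow[OF mem[OF g0]] by auto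
  also have "\<dots> = N #> (g0 [^]\<^bsub>?T\<^esub> i)"
    using hom_int_pow[OF N.r_coset_hom_Mod, of g0 i] g0 N.is_group M.is_group by (simp add: co)
  also have "g0 [^]\<^bsub>?T\<^esub> i = g0 [^] i" using int_pow_consistent[OF T g0] by simp
  finally have "N #> g = N #> (g0 [^] i)" .
  moreover have "g \<in> N #> g"
    using subgroup.one_closed[OF N.subgroup_axioms] g T by (auto simp: r_coset_def subgroup.mem_carrier intro!: bexI[of _ \<one>])
  ultimately obtain n where "n \<in> N" "g = n \<otimes> g0 [^] i" by (auto simp: r_coset_def)
  then show ?thesis using that by blast
qed

end


section \<open>Fusion over the subfield\<close>

context galois_group_algebra
begin

lemma fuses_stabilizer:
  assumes n: "n \<in> carrier G" "grp.cj n ` P = P" "cg n e = e"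
    and y: "y \<in> carrier G" and f: "fuses P e Q y"
  shows "fuses P e Q (n \<cdot> y)"
proof -
  obtain f where f: "brauer_le k G (Q, f) (P, e)" "brauer_le k G (grp.cj y ` Q, cg y f) (P, e)"
    using f by (auto simp: fuses_def)
  have "Q \<subseteq> carrier G" using bpairD(3)[OF brauer_leD(1)[OF f(1)]] .
  then show ?thesis
    using f brauer_le_cg[OF n(1) f(2)] n y by (auto simp: fuses_def grp.cj_image_mult cg_mult)
qed

lemma stabilizer_subgroup_cg:
  assumes "P \<subseteq> carrier G" "a \<in> AC"
  shows "subgroup (stab P a) G"
proof (rule grp.subgroupI)
  have "\<one>\<^bsub>G\<^esub> \<in> stab P a" using assms by (simp add: twist_one)
  then show "stab P a \<noteq> {}" by blast
  fix x assume x: "x \<in> stab P a"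
  then have "grp.cj (inv\<^bsub>G\<^esub> x) ` P = P" using assms grp.cj_image_cancel(2)[of x P] by simp
  moreover have "cg (inv\<^bsub>G\<^esub> x) a = a" using x assms cg_cancel(1)[of x a] by simp
  ultimately show "inv\<^bsub>G\<^esub> x \<in> stab P a" using x by simp
  fix y assume "y \<in> stab P a"
  then show "x \<cdot> y \<in> stab P a"
    using x assms by (simp add: grp.cj_image_mult cg_mult)
qed auto

text \<open>
  The inverse of \<open>g\<close> moves \<open>e\<close> to a Galois conjugate, and the Galois action commutes with conjugation,
  so an element that fixes \<open>e\<close> fixes this conjugate as well.
\<close>

lemma stabilizer_normal:
  assumes bp: "bpair P e"
  shows "stab P e \<lhd> G\<lparr>carrier := stab P (gsum e)\<rparr>" (is "?N \<lhd> _")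
proof -
  note PD = bpairD[OF bp]
  have eA: "e \<in> AC" "gsum e \<in> AC" using bpair_AC[OF bp] gsum_AC[OF PD(4,5)] .
  have T: "subgroup (stab P (gsum e)) G" using stabilizer_subgroup_cg[OF PD(3) eA(2)] .
  have N: "subgroup ?N G" using stabilizer_subgroup_cg[OF PD(3) eA(1)] .
  have sub: "?N \<subseteq> stab P (gsum e)" using gsum_cg[OF PD(4,5)] by auto
  have conj: "g \<cdot> n \<cdot> inv\<^bsub>G\<^esub> g \<in> ?N" if g: "g \<in> stab P (gsum e)" and n: "n \<in> ?N" for g n
  proof -
    have ig: "inv\<^bsub>G\<^esub> g \<in> stab P (gsum e)" using subgroup.m_inv_closed[OF T g] .
    have G: "g \<in> carrier G" "n \<in> carrier G" "inv\<^bsub>G\<^esub> g \<in> carrier G" using g n by auto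
    obtain \<gamma> where \<gamma>: "\<gamma> \<in> \<Gamma>" "cg (inv\<^bsub>G\<^esub> g) e = gal \<gamma> e" using stab_gsum_galois[OF bp ig] .
    have "cg (g \<cdot> n \<cdot> inv\<^bsub>G\<^esub> g) e = cg g (cg n (cg (inv\<^bsub>G\<^esub> g) e))" using G by (simp add: cg_mult)
    also have "\<dots> = cg g (gal \<gamma> (cg n e))" using \<gamma> G by (simp add: gal_cg)
    also have "\<dots> = cg g (cg (inv\<^bsub>G\<^esub> g) e)" using n \<gamma> by simp
    also have "\<dots> = e" using eA G by simp
    finally have "cg (g \<cdot> n \<cdot> inv\<^bsub>G\<^esub> g) e = e" .
    moreover have "grp.cj (g \<cdot> n \<cdot> inv\<^bsub>G\<^esub> g) ` P = P" using g n ig G PD(3) by (simp add: grp.cj_image_mult)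
    ultimately show ?thesis using G by simp
  qed
  have TG: "group (G\<lparr>carrier := stab P (gsum e)\<rparr>)" using grp.subgroup_imp_group[OF T] .
  show ?thesis
    unfolding group.normal_inv_iff[OF TG]
  proof (intro conjI ballI)
    show "subgroup ?N (G\<lparr>carrier := stab P (gsum e)\<rparr>)" by (rule grp.subgroup_incl[OF N T sub])
    fix x h assume x: "x \<in> carrier (G\<lparr>carrier := stab P (gsum e)\<rparr>)" and h: "h \<in> ?N"
    then show "x \<otimes>\<^bsub>G\<lparr>carrier := stab P (gsum e)\<rparr>\<^esub> h \<otimes>\<^bsub>G\<lparr>carrier := stab P (gsum e)\<rparr>\<^esub> inv\<^bsub>G\<lparr>carrier := stab P (gsum e)\<rparr>\<^esub> x \<in> ?N"
      using conj[of x h] grp.m_inv_consistent[OF T] by simp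
  qed
qed

text \<open>
  An element that induces a morphism over \<open>K\<close> differs by an element of the stabilizer of the Galois sum
  from one that induces a morphism over \<open>k\<close>. Modulo the stabilizer of \<open>e\<close>, which acts inside the fusion
  system over \<open>k\<close>, this element is a power of \<open>g\<^sub>0\<close>.
\<close>

lemma decomposition_over_subfield:
  assumes b: "block (carrier G) b" and max: "maximal_brauer_pair k G b (P, e)"
    and g0: "g0 \<in> stab P (gsum e)"
    and gen: "generate ((G\<lparr>carrier := stab P (gsum e)\<rparr>) Mod stab P e)
        {g0 <#\<^bsub>G\<^esub> stab P e} =
      carrier ((G\<lparr>carrier := stab P (gsum e)\<rparr>) Mod stab P e)"
    and \<phi>: "\<phi> \<in> block_fusion_system (k\<lparr>carrier := K\<rparr>) G bt (P, gsum e) Q R"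
  obtains i :: int and y where "y \<in> carrier G" "fuses P e Q y"
    "\<phi> = restrict (grp.cj (g0 [^]\<^bsub>G\<^esub> i \<cdot> y)) Q" "grp.cj (g0 [^]\<^bsub>G\<^esub> i \<cdot> y) ` Q \<subseteq> R"
    "subgroup Q G" "Q \<subseteq> P" "subgroup R G" "R \<subseteq> P"
proof -
  have bp: "bpair P e" using brauer_leD(2)[OF maximalD(1)[OF b max]] .
  note PD = bpairD[OF bp]
  have T: "subgroup (stab P (gsum e)) G" using stabilizer_subgroup_cg[OF PD(3) gsum_AC[OF PD(4,5)]] .
  obtain x where x: "subgroup Q G" "Q \<subseteq> P" "subgroup R G" "R \<subseteq> P" "x \<in> carrier G"
      "\<phi> = restrict (grp.cj x) Q" "grp.cj x ` Q \<subseteq> R" "KG.fuses P (gsum e) Q x"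
    using \<phi> unfolding KG.mem_block_fusion_system[OF gsum_bpair[OF bp]] by blast
  obtain h where h: "h \<in> stab P (gsum e)" "fuses P e Q (inv\<^bsub>G\<^esub> h \<cdot> x)"
    using fuses_gsum_split[OF b max x(1,2,5,8)] .
  have ih: "inv\<^bsub>G\<^esub> h \<in> stab P (gsum e)" using subgroup.m_inv_closed[OF T h(1)] .
  obtain i :: int and n where "n \<in> stab P e"
      "inv\<^bsub>G\<^esub> h = n \<cdot> g0 [^]\<^bsub>G\<^esub> i"
    by (rule grp.cyclic_quotient_decomposition[OF T stabilizer_normal[OF bp] g0 gen ih])
  then have n: "n \<in> carrier G" "grp.cj n ` P = P" "cg n e = e" "inv\<^bsub>G\<^esub> h = n \<cdot> g0 [^]\<^bsub>G\<^esub> i" by auto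
  have G: "g0 \<in> carrier G" "h \<in> carrier G" "g0 [^]\<^bsub>G\<^esub> i \<in> carrier G" using g0 h by auto
  define y where "y = g0 [^]\<^bsub>G\<^esub> i \<cdot> x"
  have yG: "y \<in> carrier G" using G x by (simp add: y_def)
  have N: "subgroup (stab P e) G"
    using stabilizer_subgroup_cg[OF PD(3) bpair_AC[OF bp]] .
  have n': "inv\<^bsub>G\<^esub> n \<in> stab P e"
    using n by (intro subgroup.m_inv_closed[OF N]) simp
  have "inv\<^bsub>G\<^esub> n \<cdot> (inv\<^bsub>G\<^esub> h \<cdot> x) = y" using n(1,4) G x by (simp add: y_def grp.m_assoc)
  then have "fuses P e Q y" using fuses_stabilizer[of "inv\<^bsub>G\<^esub> n" P e "inv\<^bsub>G\<^esub> h \<cdot> x" Q] n' h(2) G x by simp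
  moreover have "g0 [^]\<^bsub>G\<^esub> (- i) \<cdot> y = x"
    using G x by (simp add: y_def grp.int_pow_neg)
  ultimately show ?thesis using that[of y "- i"] yG x by simp
qed

lemma fusion_le:
  assumes bp: "bpair P e"
  shows "block_fusion_system k G b (P, e) \<le> block_fusion_system (k\<lparr>carrier := K\<rparr>) G bt (P, gsum e)"
proof (intro le_funI subsetI)
  fix Q R \<phi> assume "\<phi> \<in> block_fusion_system k G b (P, e) Q R"
  then show "\<phi> \<in> block_fusion_system (k\<lparr>carrier := K\<rparr>) G bt (P, gsum e) Q R"
    unfolding mem_block_fusion_system[OF bp] KG.mem_block_fusion_system[OF gsum_bpair[OF bp]]
    by (elim conjE bexE) (intro conjI bexI; simp add: fuses_gsum)
qed

lemma pair_stabilizers: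
  assumes bp: "bpair P e"
  shows "pair_stabilizer k G (P, e) = stab P e"
    "pair_stabilizer (k\<lparr>carrier := K\<rparr>) G (P, gsum e) = stab P (gsum e)"
  unfolding pair_stabilizer_def
  using bpair_AC[OF bp] KG.bpair_AC[OF gsum_bpair[OF bp]]
  by (intro Collect_cong conj_cong refl; simp add: conj_pair_eq KG.conj_pair_eq K_twist del: conj_pair.simps)+

text \<open>
  Over \<open>K\<close> every morphism is a conjugation by \<open>g\<^sub>0\<^sup>i y\<close> with \<open>y\<close> inducing a morphism over \<open>k\<close>. Read from
  the right this is the first factorization; moving \<open>y\<close> past \<open>g\<^sub>0\<^sup>i\<close> gives the second.
\<close>

lemma morphism_factorization:
  assumes b: "block (carrier G) b" and max: "maximal_brauer_pair k G b (P, e)"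
    and g0: "g0 \<in> stab P (gsum e)"
    and gen: "generate ((G\<lparr>carrier := stab P (gsum e)\<rparr>) Mod stab P e)
        {g0 <#\<^bsub>G\<^esub> stab P e} =
      carrier ((G\<lparr>carrier := stab P (gsum e)\<rparr>) Mod stab P e)"
    and \<phi>: "\<phi> \<in> block_fusion_system (k\<lparr>carrier := K\<rparr>) G bt (P, gsum e) Q R"
    and s: "\<And>j::int. s j = restrict (grp.cj (g0 [^]\<^bsub>G\<^esub> j)) P"
  shows "\<exists>i::int. \<exists>\<psi>\<in>block_fusion_system k G b (P, e) Q (s (- i) ` R).
    \<exists>\<psi>'\<in>block_fusion_system k G b (P, e) (s i ` Q) R.
      \<phi> = compose Q (restrict (s i) (s (- i) ` R)) \<psi> \<and> \<phi> = compose Q \<psi>' (restrict (s i) Q)"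
proof -
  have bp: "bpair P e" using brauer_leD(2)[OF maximalD(1)[OF b max]] .
  note PD = bpairD[OF bp]
  have T: "subgroup (stab P (gsum e)) G" using stabilizer_subgroup_cg[OF PD(3) gsum_AC[OF PD(4,5)]] .
  obtain i :: int and y where y: "y \<in> carrier G" "fuses P e Q y"
      "\<phi> = restrict (grp.cj (g0 [^]\<^bsub>G\<^esub> i \<cdot> y)) Q" "grp.cj (g0 [^]\<^bsub>G\<^esub> i \<cdot> y) ` Q \<subseteq> R"
    and Q: "subgroup Q G" "Q \<subseteq> P" and R: "subgroup R G" "R \<subseteq> P"
    by (rule decomposition_over_subfield[OF b max g0 gen \<phi>])
  define h where "h = g0 [^]\<^bsub>G\<^esub> i"
  have hN: "h \<in> stab P (gsum e)" unfolding h_def using grp.int_pow_subgroup[OF T g0] .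
  have hG: "h \<in> carrier G" "grp.cj h ` P = P" using hN by auto
  have ih: "g0 [^]\<^bsub>G\<^esub> (- i) = inv\<^bsub>G\<^esub> h" using g0 by (simp add: h_def grp.int_pow_neg)
  have ihP: "grp.cj (inv\<^bsub>G\<^esub> h) ` P = P" using grp.cj_image_cancel(2)[OF hG(1) PD(3)] hG(2) by simp
  have QG: "Q \<subseteq> carrier G" "R \<subseteq> carrier G" using Q R PD(3) by auto
  let ?R = "grp.cj (inv\<^bsub>G\<^esub> h) ` R" and ?Q = "grp.cj h ` Q"
  have sR: "s (- i) ` R = ?R" and sQ: "s i ` Q = ?Q" using Q R by (auto simp: s ih h_def)
  have R': "subgroup ?R G" "?R \<subseteq> P"
    using grp.subgroup_cj_image[OF grp.inv_closed[OF hG(1)] R(1)] image_mono[OF R(2), of "grp.cj (inv\<^bsub>G\<^esub> h)"] ihP by auto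
  have Q': "subgroup ?Q G" "?Q \<subseteq> P"
    using grp.subgroup_cj_image[OF hG(1) Q(1)] image_mono[OF Q(2), of "grp.cj h"] hG by auto
  have yR: "grp.cj y ` Q \<subseteq> ?R"
  proof -
    have "grp.cj (inv\<^bsub>G\<^esub> h) ` grp.cj (h \<cdot> y) ` Q \<subseteq> ?R" using y(4) unfolding h_def by (rule image_mono)
    moreover have "grp.cj y ` Q \<subseteq> carrier G" using y(1) QG by auto
    then have "grp.cj (inv\<^bsub>G\<^esub> h) ` grp.cj (h \<cdot> y) ` Q = grp.cj y ` Q"
      using grp.cj_image_mult[OF hG(1) y(1) QG(1)] grp.cj_image_cancel(2)[OF hG(1)] by metis
    ultimately show ?thesis by simp
  qed
  define \<psi> where "\<psi> = restrict (grp.cj y) Q"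
  define \<psi>' where "\<psi>' = restrict (grp.cj (h \<cdot> y \<cdot> inv\<^bsub>G\<^esub> h)) ?Q"
  have "\<psi> \<in> block_fusion_system k G b (P, e) Q (s (- i) ` R)"
    unfolding mem_block_fusion_system[OF bp] sR \<psi>_def using Q R' y yR by blast
  moreover have "\<psi>' \<in> block_fusion_system k G b (P, e) (s i ` Q) R"
  proof -
    have "grp.cj (h \<cdot> y \<cdot> inv\<^bsub>G\<^esub> h) ` ?Q = grp.cj (h \<cdot> y) ` Q"
      using hG y QG by (simp add: grp.m_assoc flip: grp.cj_image_mult)
    then have "grp.cj (h \<cdot> y \<cdot> inv\<^bsub>G\<^esub> h) ` ?Q \<subseteq> R" using y(4) by (simp add: h_def)
    moreover have "fuses P e ?Q (h \<cdot> y \<cdot> inv\<^bsub>G\<^esub> h)" using fuses_conjugate[OF bp hN y(1,2)] .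
    ultimately show ?thesis
      unfolding mem_block_fusion_system[OF bp] sQ \<psi>'_def using Q' R hG y
      by (intro conjI bexI[of _ "h \<cdot> y \<cdot> inv\<^bsub>G\<^esub> h"]) auto
  qed
  moreover have "\<phi> = compose Q (restrict (s i) (s (- i) ` R)) \<psi>"
  proof -
    have "restrict (s i) (s (- i) ` R) = restrict (grp.cj h) ?R"
      using R'(2) unfolding sR unfolding s h_def[symmetric] by (simp add: Int_absorb1)
    then show ?thesis
      unfolding \<psi>_def using grp.compose_restrict_cj[OF y(1) hG(1) QG(1) yR] y(3) by (simp add: h_def)
  qed
  moreover have "\<phi> = compose Q \<psi>' (restrict (s i) Q)"
  proof -
    have "restrict (s i) Q = restrict (grp.cj h) Q"
      using Q(2) by (simp add: s h_def Int_absorb1)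
    moreover have "h \<cdot> y \<cdot> inv\<^bsub>G\<^esub> h \<cdot> h = h \<cdot> y" using hG y by (simp add: grp.m_assoc)
    ultimately show ?thesis
      unfolding \<psi>'_def
      using grp.compose_restrict_cj[OF hG(1) _ QG(1), of "h \<cdot> y \<cdot> inv\<^bsub>G\<^esub> h" ?Q] y(1,3) hG(1) by (simp add: h_def)
  qed
  ultimately show ?thesis by blast
qed

text \<open>
  A fusion system over \<open>P\<close> that contains conjugation by \<open>g\<^sub>0\<close> contains the restrictions of all its
  powers, so it contains the composites above.
\<close>

lemma fusion_over_subfield_generated:
  assumes b: "block (carrier G) b" and max: "maximal_brauer_pair k G b (P, e)"
    and g0: "g0 \<in> stab P (gsum e)"
    and gen: "generate ((G\<lparr>carrier := stab P (gsum e)\<rparr>) Mod stab P e)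
        {g0 <#\<^bsub>G\<^esub> stab P e} =
      carrier ((G\<lparr>carrier := stab P (gsum e)\<rparr>) Mod stab P e)"
    and E: "fusion_system (G\<lparr>carrier := P\<rparr>) E" "block_fusion_system k G b (P, e) \<le> E"
      "restrict (grp.cj g0) P \<in> E P P"
  shows "block_fusion_system (k\<lparr>carrier := K\<rparr>) G bt (P, gsum e) \<le> E"
proof (intro le_funI subsetI)
  have bp: "bpair P e" using brauer_leD(2)[OF maximalD(1)[OF b max]] .
  note PD = bpairD[OF bp]
  have grpP: "group (G\<lparr>carrier := P\<rparr>)" using grp.subgroup_imp_group[OF PD(2)] .
  have PP: "subgroup P (G\<lparr>carrier := P\<rparr>)" using grp.subgroup_restrict_iff[OF PD(2)] PD(2) by simp
  let ?M = "{h \<in> carrier G. grp.cj h ` P = P \<and> restrict (grp.cj h) P \<in> E P P}"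
  have M: "subgroup ?M G"
  proof (rule grp.subgroupI)
    have "restrict (grp.cj \<one>\<^bsub>G\<^esub>) P = restrict (\<lambda>u. u) P" using PD(3) by (auto intro!: restrict_ext)
    then have "\<one>\<^bsub>G\<^esub> \<in> ?M" using fusion_system_inclusion[OF grpP E(1) PP PP] PD(3) by simp
    then show "?M \<noteq> {}" by blast
    fix x assume "x \<in> ?M"
    then have x: "x \<in> carrier G" "grp.cj x ` P = P" "restrict (grp.cj x) P \<in> E P P" by auto
    have "grp.cj (inv\<^bsub>G\<^esub> x) ` P = P" using grp.cj_image_cancel(2)[OF x(1) PD(3)] x(2) by simp
    moreover have im: "restrict (grp.cj x) P ` P = P" using x(2) by simp
    have "restrict (grp.cj (inv\<^bsub>G\<^esub> x)) P \<in> E P P"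
      using fusion_systemD(7)[OF E(1) x(3)]
      unfolding im grp.inverse_restrict_cj[OF x(1) PD(3), unfolded x(2)] .
    ultimately show "inv\<^bsub>G\<^esub> x \<in> ?M" using x by simp
    fix z assume "z \<in> ?M"
    then have z: "z \<in> carrier G" "grp.cj z ` P = P" "restrict (grp.cj z) P \<in> E P P" by auto
    have "restrict (grp.cj (x \<cdot> z)) P \<in> E P P"
      using fusion_systemD(3)[OF E(1) z(3) x(3)]
      unfolding grp.compose_restrict_cj[OF z(1) x(1) PD(3) eq_refl[OF z(2)]] .
    then show "x \<cdot> z \<in> ?M" using x z PD(3) by (simp add: grp.cj_image_mult)
  qed auto
  fix Q R \<phi> assume \<phi>: "\<phi> \<in> block_fusion_system (k\<lparr>carrier := K\<rparr>) G bt (P, gsum e) Q R"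
  define s where "s j = restrict (grp.cj (g0 [^]\<^bsub>G\<^esub> (j::int))) P" for j
  obtain i :: int and \<psi> where \<psi>: "\<psi> \<in> block_fusion_system k G b (P, e) Q (s (- i) ` R)"
      "\<phi> = compose Q (restrict (s i) (s (- i) ` R)) \<psi>"
    using morphism_factorization[OF b max g0 gen \<phi> s_def] by blast
  have im: "\<phi> ` Q \<subseteq> R" and Rs: "subgroup R (G\<lparr>carrier := P\<rparr>)"
    using fusion_systemD(5,2)[OF KG.fusion_system_block[OF gsum_bpair[OF bp]] \<phi>] .
  have \<psi>E: "\<psi> \<in> E Q (s (- i) ` R)" using E(2) \<psi>(1) by (auto simp: le_fun_def)
  have sub: "subgroup (s (- i) ` R) (G\<lparr>carrier := P\<rparr>)" using fusion_systemD(2)[OF E(1) \<psi>E] .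
  then have subP: "s (- i) ` R \<subseteq> P" using grp.subgroup_restrict_iff[OF PD(2)] by simp
  have "g0 \<in> ?M" using g0 E(3) by simp
  then have "g0 [^]\<^bsub>G\<^esub> i \<in> ?M" using grp.int_pow_subgroup[OF M] by blast
  then have "s i \<in> E P P" by (simp add: s_def)
  then have "restrict (s i) (s (- i) ` R) \<in> E (s (- i) ` R) P"
    by (rule fusion_system_restrict[OF grpP E(1) _ sub subP])
  then have "\<phi> \<in> E Q P" unfolding \<psi>(2) using fusion_systemD(3)[OF E(1) \<psi>E] by blast
  then show "\<phi> \<in> E Q R" by (rule fusion_system_codomain[OF grpP E(1) _ Rs im])
qed

end

theorem theorem5p2:
  fixes G :: "('g, 'n) monoid_scheme"
    and L :: "('l, 'm) ring_scheme" and K :: "'l set"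
    and p :: nat
    and b e bt et :: "'g \<Rightarrow> 'l"
    and P N Nt :: "'g set"
    and F Ft :: "'g hom_system"
    and g0 :: 'g and \<sigma> :: "'g \<Rightarrow> 'g"
  assumes "group G" and "finite (carrier G)"
    and "finite_galois_extension L K"
    and "ring_char L = p" and "p > 0"
    and "block_idempotent L G b"
    and "maximal_brauer_pair L G b (P, e)"
    and "bt = galois_conjugate_sum L K G b"
    and "et = galois_conjugate_sum L K (G\<lparr>carrier := centralizer G P\<rparr>) e"
    and "F = block_fusion_system L G b (P, e)"
    and "Ft = block_fusion_system (L\<lparr>carrier := K\<rparr>) G bt (P, et)"
    and "N = pair_stabilizer L G (P, e)"
    and "Nt = pair_stabilizer (L\<lparr>carrier := K\<rparr>) G (P, et)"
    and "g0 \<in> Nt"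
    and "generate ((G\<lparr>carrier := Nt\<rparr>) Mod N) {g0 <#\<^bsub>G\<^esub> N} = carrier ((G\<lparr>carrier := Nt\<rparr>) Mod N)"
    and "\<sigma> = (\<lambda>u\<in>P. g0 \<otimes>\<^bsub>G\<^esub> u \<otimes>\<^bsub>G\<^esub> inv\<^bsub>G\<^esub> g0)"
  shows "Ft = generated_fusion_system (G\<lparr>carrier := P\<rparr>) F \<sigma> \<and>
    \<sigma> \<in> Ft P P \<and>
    (\<forall>Q R \<phi>. subgroup Q (G\<lparr>carrier := P\<rparr>) \<and> subgroup R (G\<lparr>carrier := P\<rparr>) \<and> \<phi> \<in> Ft Q R \<longrightarrow>
      (\<exists>i::int. let s = (\<lambda>j::int. \<sigma> [^]\<^bsub>AutoGroup (G\<lparr>carrier := P\<rparr>)\<^esub> j) in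
        \<exists>\<psi>\<in>F Q (s (- i) ` R). \<exists>\<psi>'\<in>F (s i ` Q) R.
          \<phi> = compose Q (restrict (s i) (s (- i) ` R)) \<psi> \<and>
          \<phi> = compose Q \<psi>' (restrict (s i) Q)))"
proof -
  have L: "field L" using assms(3) by (simp add: finite_galois_extension_def)
  interpret GA: galois_group_algebra L G p K
    using assms(1-5) L
    by (intro galois_group_algebra.intro modular_group_algebra.intro modular_group_algebra_axioms.intro
        galois_group_algebra_axioms.intro)
  let ?N = "GA.stab P e"
  have b: "GA.block (carrier G) b" using assms(6) by (simp add: GA.block_idempotent_carrier)
  have max: "maximal_brauer_pair L G b (P, e)" by (rule assms(7))
  have bp: "GA.bpair P e" using GA.brauer_leD(2)[OF GA.maximalD(1)[OF b max]] .
  note PD = GA.bpairD[OF bp]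
  have et: "et = GA.gsum e" using assms(9) GA.galois_conjugate_sum_eq[OF PD(4,5)] by simp
  have N: "N = ?N" and Nt: "Nt = GA.stab P (GA.gsum e)" using assms(12,13) GA.pair_stabilizers[OF bp] et by simp_all
  have g0: "g0 \<in> GA.stab P (GA.gsum e)" using assms(14) Nt by simp
  note gen = assms(15)[unfolded N Nt]
  have \<sigma>: "\<sigma> = restrict (GA.grp.cj g0) P" unfolding assms(16) by (auto simp: GA.grp.cj_def intro!: restrict_ext)
  have g0G: "g0 \<in> carrier G" "GA.grp.cj g0 ` P = P" using g0 by auto
  have Ft: "Ft = block_fusion_system (L\<lparr>carrier := K\<rparr>) G bt (P, GA.gsum e)" using assms(11) et by simp
  have fus: "fusion_system (G\<lparr>carrier := P\<rparr>) Ft" unfolding Ft by (rule GA.KG.fusion_system_block[OF GA.gsum_bpair[OF bp]])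
  have F_le: "F \<le> Ft" unfolding Ft assms(10) by (rule GA.fusion_le[OF bp])
  have \<sigma>_Ft: "\<sigma> \<in> Ft P P"
    unfolding Ft \<sigma> GA.KG.mem_block_fusion_system[OF GA.gsum_bpair[OF bp]]
    using PD(2) g0G GA.stab_gsum_fuses[OF bp PD(2) subset_refl g0] by blast
  have "Ft = generated_fusion_system (G\<lparr>carrier := P\<rparr>) F \<sigma>"
    unfolding generated_fusion_system_def
  proof (rule antisym)
    show "Ft \<le> Inf {E. fusion_system (G\<lparr>carrier := P\<rparr>) E \<and> F \<le> E \<and>
        \<sigma> \<in> E (carrier (G\<lparr>carrier := P\<rparr>)) (carrier (G\<lparr>carrier := P\<rparr>))}"
    proof (rule Inf_greatest)
      fix E assume "E \<in> {E. fusion_system (G\<lparr>carrier := P\<rparr>) E \<and> F \<le> E \<and>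
        \<sigma> \<in> E (carrier (G\<lparr>carrier := P\<rparr>)) (carrier (G\<lparr>carrier := P\<rparr>))}"
      then have E: "fusion_system (G\<lparr>carrier := P\<rparr>) E" "F \<le> E" "\<sigma> \<in> E P P" by auto
      show "Ft \<le> E"
        unfolding Ft
        by (rule GA.fusion_over_subfield_generated[OF b max g0 gen E(1) E(2)[unfolded assms(10)] E(3)[unfolded \<sigma>]])
    qed
    show "Inf {E. fusion_system (G\<lparr>carrier := P\<rparr>) E \<and> F \<le> E \<and>
        \<sigma> \<in> E (carrier (G\<lparr>carrier := P\<rparr>)) (carrier (G\<lparr>carrier := P\<rparr>))} \<le> Ft"
      by (rule Inf_lower) (use fus F_le \<sigma>_Ft in simp)
  qed
  moreover have "\<exists>i::int. let s = (\<lambda>j::int. \<sigma> [^]\<^bsub>AutoGroup (G\<lparr>carrier := P\<rparr>)\<^esub> j) in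
        \<exists>\<psi>\<in>F Q (s (- i) ` R). \<exists>\<psi>'\<in>F (s i ` Q) R.
          \<phi> = compose Q (restrict (s i) (s (- i) ` R)) \<psi> \<and>
          \<phi> = compose Q \<psi>' (restrict (s i) Q)" if "\<phi> \<in> Ft Q R" for Q R \<phi>
    unfolding Let_def assms(10)
    by (rule GA.morphism_factorization[OF b max g0 gen that[unfolded Ft]])
      (unfold \<sigma>, rule GA.grp.AutoGroup_int_pow_cj[OF PD(2) g0G])
  ultimately show ?thesis using \<sigma>_Ft by blast
qed

end
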